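(* Let $n\ge 2$, let $B>0$ and $0<a<b$, and let $\Omega=\{x=(x_1,\dots,x_{n-1},z): -B<x_1,\dots,x_{n-1}<B,\ a<z<b\}$. There exist a constant $C=C(\Omega)>0$ and a number $\lambda_0=\lambda_0(\Omega)>1$, both depending only on $\Omega$, such that for all $\lambda\ge\lambda_0$ and all $u\in H^2_0(\Omega)$, $$\int_\Omega(\Delta u)^2e^{2\lambda z^2}\,dx\ \ge\ C\int_\Omega\big(\lambda|\nabla u|^2+\lambda^3u^2\big)e^{2\lambda z^2}\,dx\ -\ C\lambda^3\Big(\|u\|^2_{H^1(\partial_2\Omega)}+\|\partial_zu\|^2_{L_2(\partial_2\Omega)}\Big)e^{2\lambda b^2}.$$
   Context: Points of $\mathbb R^n$ are written $x=(x_1,\dots,x_{n-1},z)$. The boundary of the prism $\Omega$ is $\partial\Omega=\partial_1\Omega\cup\partial_2\Omega\cup\partial_3\Omega$ where $\partial_1\Omega=\{-B<x_1,\dots,x_{n-1}<B,\ z=a\}$ (bottom face), $\partial_2\Omega=\{-B<x_1,\dots,x_{n-1}<B,\ z=b\}$ (top face) and $\partial_3\Omega=\{x_i=\pm B \text{ for some } i\in\{1,\dots,n-1\},\ z\in(a,b)\}$ (lateral faces). $H^2_0(\Omega)=\{u\in H^2(\Omega): u=0 \text{ on } \partial\Omega\setminus\partial_2\Omega\}$ (i.e. $u$ vanishes on the bottom and lateral faces, with no condition on the top face $z=b$). *)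

theory Defs
  imports "HOL-Analysis.Analysis"
begin

definition L2_on :: "'a::euclidean_space set \<Rightarrow> ('a \<Rightarrow> real) \<Rightarrow> bool" where
  "L2_on U f \<longleftrightarrow> set_borel_measurable lborel U f \<and> set_integrable lborel U (\<lambda>x. (f x)^2)"

definition test_function :: "'a::euclidean_space set \<Rightarrow> ('a \<Rightarrow> real) \<Rightarrow> bool" where
  "test_function U \<phi> \<longleftrightarrow>
     (\<exists>D. (\<forall>x. (\<phi> has_derivative D x) (at x)) \<and> (\<forall>v. continuous_on UNIV (\<lambda>x. D x v)))
     \<and> compact (closure {x. \<phi> x \<noteq> 0}) \<and> closure {x. \<phi> x \<noteq> 0} \<subseteq> U"

definition weak_deriv :: "'a::euclidean_space set \<Rightarrow> ('a \<Rightarrow> real) \<Rightarrow> 'a \<Rightarrow> ('a \<Rightarrow> real) \<Rightarrow> bool" where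
  "weak_deriv U u v g \<longleftrightarrow>
     (\<forall>\<phi>. test_function U \<phi> \<longrightarrow>
        (LINT x:U|lborel. u x * frechet_derivative \<phi> (at x) v) = - (LINT x:U|lborel. g x * \<phi> x))"

definition H1_on :: "'a::euclidean_space set \<Rightarrow> ('a \<Rightarrow> real) \<Rightarrow> ('a \<Rightarrow> 'a \<Rightarrow> real) \<Rightarrow> bool" where
  "H1_on U u du \<longleftrightarrow> L2_on U u \<and> (\<forall>i\<in>Basis. L2_on U (du i) \<and> weak_deriv U u i (du i))"

definition H2_on :: "'a::euclidean_space set \<Rightarrow> ('a \<Rightarrow> real) \<Rightarrow> ('a \<Rightarrow> 'a \<Rightarrow> real)
                     \<Rightarrow> ('a \<Rightarrow> 'a \<Rightarrow> 'a \<Rightarrow> real) \<Rightarrow> bool" where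
  "H2_on U u du d2u \<longleftrightarrow> H1_on U u du \<and>
     (\<forall>i\<in>Basis. \<forall>j\<in>Basis. L2_on U (d2u i j) \<and> weak_deriv U (du i) j (d2u i j))"

definition H1_norm_sq :: "'a::euclidean_space set \<Rightarrow> ('a \<Rightarrow> real) \<Rightarrow> ('a \<Rightarrow> 'a \<Rightarrow> real) \<Rightarrow> real" where
  "H1_norm_sq U g dg = (LINT x:U|lborel. (g x)^2) + (\<Sum>i\<in>Basis. LINT x:U|lborel. (dg i x)^2)"

text \<open>The prism. Points of R^n are pairs (x', z) with x' \<in> R^(n-1) = real^'m, z \<in> R.\<close>

definition face :: "real \<Rightarrow> (real^'m) set" where
  "face B = {x. \<forall>i. -B < x$i \<and> x$i < B}"

definition prism :: "real \<Rightarrow> real \<Rightarrow> real \<Rightarrow> ((real^'m) \<times> real) set" where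
  "prism B a b = {p. fst p \<in> face B \<and> a < snd p \<and> snd p < b}"

text \<open>Zero trace on the bottom face and the lateral faces (trace sense):
  the mean square of u over the boundary layer of width h, divided by h, tends to 0.\<close>
definition vanishes_bottom_lateral :: "real \<Rightarrow> real \<Rightarrow> real \<Rightarrow> ((real^'m) \<times> real \<Rightarrow> real) \<Rightarrow> bool" where
  "vanishes_bottom_lateral B a b u \<longleftrightarrow>
     ((\<lambda>h. (1/h) * (LINT p:(prism B a b \<inter> {p. snd p < a + h})|lborel. (u p)^2)) \<longlongrightarrow> 0) (at_right 0)
   \<and> (\<forall>i. ((\<lambda>h. (1/h) * (LINT p:(prism B a b \<inter> {p. B - h < fst p $ i})|lborel. (u p)^2)) \<longlongrightarrow> 0) (at_right 0))
   \<and> (\<forall>i. ((\<lambda>h. (1/h) * (LINT p:(prism B a b \<inter> {p. fst p $ i < -B + h})|lborel. (u p)^2)) \<longlongrightarrow> 0) (at_right 0))"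

definition H2_0 :: "real \<Rightarrow> real \<Rightarrow> real \<Rightarrow> ((real^'m) \<times> real \<Rightarrow> real) \<Rightarrow> ((real^'m) \<times> real \<Rightarrow> (real^'m) \<times> real \<Rightarrow> real)
                   \<Rightarrow> ((real^'m) \<times> real \<Rightarrow> (real^'m) \<times> real \<Rightarrow> (real^'m) \<times> real \<Rightarrow> real) \<Rightarrow> bool" where
  "H2_0 B a b u du d2u \<longleftrightarrow> H2_on (prism B a b) u du d2u \<and> vanishes_bottom_lateral B a b u"

definition trace_top :: "real \<Rightarrow> real \<Rightarrow> real \<Rightarrow> ((real^'m) \<times> real \<Rightarrow> real) \<Rightarrow> (real^'m \<Rightarrow> real) \<Rightarrow> bool" where
  "trace_top B a b u g \<longleftrightarrow> L2_on (face B) g \<and>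
     ((\<lambda>h. (1/h) * (LINT p:(prism B a b \<inter> {p. b - h < snd p})|lborel. (u p - g (fst p))^2)) \<longlongrightarrow> 0) (at_right 0)"

end

theory Submission
  imports Defs
begin

text \<open>The lateral condition allows an expansion of \<open>u\<close> in the Dirichlet eigenfunctions of the cube,
  with coefficients \<open>v\<^sub>k(z)\<close>; the Laplacian becomes \<open>v\<^sub>k'' - \<mu>\<^sub>k v\<^sub>k\<close> with \<open>\<mu>\<^sub>k \<ge> 0\<close>. By Parseval's
  identity, with cosines in the variable \<open>x\<^sub>i\<close> for \<open>\<partial>u/\<partial>x\<^sub>i\<close>, the theorem is the sum over \<open>k\<close> of a Carleman
  estimate on \<open>(a, b)\<close> that is uniform in \<open>\<mu>\<^sub>k\<close>. The vanishing of the mean squares over thin layers is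
  exactly what removes the boundary terms created by cutting off the test functions \<open>e\<^sub>k(x) \<psi>(z)\<close>.

  In one dimension put \<open>y = exp(\<lambda>z\<^sup>2) v\<close>. Then \<open>F = exp(\<lambda>z\<^sup>2) (v'' - \<mu>v)\<close> is \<open>S + A\<close> with
  \<open>S = y'' + X y\<close>, \<open>X = 4\<lambda>\<^sup>2z\<^sup>2 - \<mu>\<close> and \<open>A = -4\<lambda>z y' - 2\<lambda>y\<close>, and \<open>2SA\<close> is \<open>8\<lambda>y'\<^sup>2 + 32\<lambda>\<^sup>3z\<^sup>2y\<^sup>2\<close> plus
  an exact derivative. At \<open>z = a\<close> its boundary value has the good sign; at \<open>z = b\<close> it costs
  \<open>K\<lambda>\<^sup>3(v\<^sup>2 + v'\<^sup>2)\<close>. Since the statement has one constant \<open>C\<close> in front of both the bulk term and the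
  boundary term, this \<open>K\<close> has to be replaced by a quantity that tends to \<open>0\<close> as \<open>\<lambda>\<close> grows. To
  this end \<open>F\<close> is multiplied by \<open>G y\<close> with \<open>G = X/(X\<^sup>2 + 16b\<^sup>2\<lambda>\<^sup>3)\<close>: the resulting coefficient
  \<open>4\<lambda>z G' + 2G X\<close> of \<open>y\<^sup>2\<close> stays above \<open>a\<^sup>2/b\<^sup>2\<close>, while \<open>G = O(\<lambda>\<^sup>-\<^sup>3\<^sup>/\<^sup>2)\<close> makes the boundary terms small.\<close>

subsection \<open>Absolutely continuous functions through their densities\<close>

text \<open>What decides the constant is a spare half power of \<open>lam\<close>. The identity for
  \<open>2SA\<close> bounds \<open>S\<close>, \<open>A\<close> and \<open>lam^3 y^2\<close>, but at
  boundary cost \<open>lam^3\<close>. Divided by \<open>sqrt lam\<close> this cost is acceptable,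
  and two of the three bulk terms survive the division: \<open>A\<close> controls
  \<open>lam^2 y'^2\<close> where only \<open>lam y'^2\<close> is wanted, and
  \<open>lam mu y^2\<close> follows from \<open>S^2 / sqrt lam\<close> together with
  \<open>lam^3 y^2\<close>. Only \<open>lam^3 y^2\<close> has no slack, hence the separate
  multiplier \<open>G y\<close>. The ideal \<open>G = 1/X\<close> would make \<open>2 G X\<close>
  constant, but it is singular where \<open>4 lam^2 z^2 = mu\<close>, which happens inside the
  interval for some values of \<open>mu\<close>. The summand \<open>16 b^2 lam^3\<close> regularises
  it: where \<open>X\<close> is small, \<open>4 lam z G'\<close> takes over, and the number 16 makes
  the mixed terms add up to a nonnegative multiple of \<open>b^2 - z^2\<close>. Nothing is
  approximated by smooth functions: each mode is tested directly and represented by an absolutely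
  continuous profile. This is why \<open>AC_density\<close> takes the integral formula itself as the
  definition of a density.\<close>

definition AC_density :: "real \<Rightarrow> real \<Rightarrow> (real \<Rightarrow> real) \<Rightarrow> (real \<Rightarrow> real) \<Rightarrow> bool" where
  "AC_density a b F f \<longleftrightarrow> set_integrable lborel {a..b} f
     \<and> (\<forall>z\<in>{a..b}. (LINT t:{a..z}|lborel. f t) = F z - F a)"

lemma AC_density_integrable: "AC_density a b F f \<Longrightarrow> set_integrable lborel {a..b} f"
  by (simp add: AC_density_def)

lemma AC_density_eq: "AC_density a b F f \<Longrightarrow> a \<le> z \<Longrightarrow> z \<le> b \<Longrightarrow> (LINT t:{a..z}|lborel. f t) = F z - F a"
  by (simp add: AC_density_def)

lemma AC_density_continuous:
  assumes "AC_density a b F f"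
  shows "continuous_on {a..b} F"
proof -
  have i: "set_integrable lborel {a..b} f" by (rule AC_density_integrable[OF assms])
  have "continuous_on {a..b} (\<lambda>z. F a + integral {a..z} f)"
    by (intro continuous_intros indefinite_integral_continuous_1 set_borel_integral_eq_integral(1)[OF i])
  moreover have "F a + integral {a..z} f = F z" if "z \<in> {a..b}" for z
  proof -
    have "set_integrable lborel {a..z} f" by (rule set_integrable_subset[OF i]) (use that in auto)
    then show ?thesis using AC_density_eq[OF assms, of z] that set_borel_integral_eq_integral(2)[of "{a..z}" f]
      by simp
  qed
  ultimately show ?thesis by (rule continuous_on_eq)
qed

lemma set_integrable_continuous_mult:
  fixes f g :: "real \<Rightarrow> real"
  assumes "set_integrable lborel {a..b} f" "continuous_on {a..b} g"
  shows "set_integrable lborel {a..b} (\<lambda>x. g x * f x)"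
proof -
  obtain K where K: "\<And>x. x \<in> {a..b} \<Longrightarrow> \<bar>g x\<bar> \<le> K"
    using compact_imp_bounded[OF compact_continuous_image[OF assms(2) compact_Icc]]
    unfolding bounded_iff by (metis imageI real_norm_def)
  have m: "(\<lambda>x. indicator {a..b} x * g x) \<in> borel_measurable lborel"
    using borel_measurable_continuous_on_indicator[OF _ assms(2)] by simp
  have m2: "(\<lambda>x. indicator {a..b} x * f x) \<in> borel_measurable lborel"
    using assms(1) by (simp add: set_integrable_def)
  have "integrable lborel (\<lambda>x. K * (indicator {a..b} x * f x))"
    using assms(1) by (simp add: set_integrable_def)
  then show ?thesis
    unfolding set_integrable_def
  proof (rule Bochner_Integration.integrable_bound)
    have "(\<lambda>x. (indicator {a..b} x * g x) * (indicator {a..b} x * f x)) \<in> borel_measurable lborel"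
      using m m2 by simp
    then show "(\<lambda>x. indicator {a..b} x *\<^sub>R (g x * f x)) \<in> borel_measurable lborel"
      by (rule measurable_cong[THEN iffD1, rotated]) (auto simp: indicator_def)
    show "AE x in lborel. norm (indicator {a..b} x *\<^sub>R (g x * f x)) \<le> norm (K * (indicator {a..b} x * f x))"
    proof (rule AE_I2)
      fix x
      show "norm (indicator {a..b} x *\<^sub>R (g x * f x)) \<le> norm (K * (indicator {a..b} x * f x))"
      proof (cases "x \<in> {a..b}")
        case True
        then show ?thesis using mult_right_mono[of "\<bar>g x\<bar>" "\<bar>K\<bar>" "\<bar>f x\<bar>"] K[OF True] by (simp add: abs_mult)
      qed simp
    qed
  qed
qed

lemma AC_density_C1:
  assumes "a \<le> b" "\<And>x. a \<le> x \<Longrightarrow> x \<le> b \<Longrightarrow> (F has_real_derivative f x) (at x)" "continuous_on {a..b} f"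
  shows "AC_density a b F f"
  unfolding AC_density_def
proof (intro conjI ballI)
  show "set_integrable lborel {a..b} f"
    unfolding set_integrable_def
    by (rule borel_integrable_compact[OF compact_Icc assms(3)])
next
  fix z assume z: "z \<in> {a..b}"
  have "(LINT t:{a..z}|lborel. f t) = F z - F a"
    unfolding set_lebesgue_integral_def
  proof (rule integral_FTC_atLeastAtMost)
    show "a \<le> z" using z by simp
    show "(F has_vector_derivative f x) (at x within {a..z})" if "a \<le> x" "x \<le> z" for x
      using assms(2)[of x] that z
      by (simp add: has_real_derivative_iff_has_vector_derivative has_vector_derivative_at_within)
    show "continuous_on {a..z} f" using z by (intro continuous_on_subset[OF assms(3)]) auto
  qed
  then show "(LINT t:{a..z}|lborel. f t) = F z - F a" .
qed

lemma AC_density_indefinite: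
  assumes "set_integrable lborel {a..b} f" "a \<le> b"
  shows "AC_density a b (\<lambda>z. c + (LINT t:{a..z}|lborel. f t)) f"
proof -
  have "(LINT t:{a..a}|lborel. f t) = 0"
    unfolding set_lebesgue_integral_def
    by (rule integral_eq_zero_AE, use AE_lborel_singleton[of a] in eventually_elim) (auto simp: indicator_def)
  then show ?thesis using assms by (simp add: AC_density_def)
qed

text \<open>Integration by parts through Fubini: the product of the two integrals is an integral
  over the square \<open>[a,z] x [a,z]\<close>, cut along its diagonal. The half
  \<open>s <= t\<close> is integrated first in \<open>s\<close>, the half \<open>t < s\<close> first
  in \<open>t\<close>; each gives one term of the product rule.\<close>

lemma AC_density_mult:
  assumes F: "AC_density a b F f" and G: "AC_density a b G g"
  shows "AC_density a b (\<lambda>t. F t * G t) (\<lambda>t. G t * f t + F t * g t)"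
  unfolding AC_density_def
proof (intro conjI ballI)
  show "set_integrable lborel {a..b} (\<lambda>t. G t * f t + F t * g t)"
    by (intro set_integral_add set_integrable_continuous_mult AC_density_integrable[OF F]
        AC_density_integrable[OF G] AC_density_continuous[OF F] AC_density_continuous[OF G])
next
  fix z assume z: "z \<in> {a..b}"
  define f' where "f' t = indicator {a..z} t * f t" for t
  define g' where "g' t = indicator {a..z} t * g t" for t
  have fi: "set_integrable lborel {a..z} f" and gi: "set_integrable lborel {a..z} g"
    using z by (auto intro!: set_integrable_subset[OF AC_density_integrable[OF F]]
        set_integrable_subset[OF AC_density_integrable[OF G]])
  have f': "integrable lborel f'" and g': "integrable lborel g'"
    using fi gi unfolding f'_def g'_def set_integrable_def by auto
  have [measurable]: "f' \<in> borel_measurable borel" "g' \<in> borel_measurable borel"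
    using f' g' by auto
  have prod: "integrable (lborel \<Otimes>\<^sub>M lborel) (\<lambda>(t,s). f' t * g' s)"
    using f' g' by (intro lborel_pair.Fubini_integrable) (auto simp: abs_mult)
  have [measurable]: "fst \<in> borel_measurable (borel :: (real \<times> real) measure)"
      "snd \<in> borel_measurable (borel :: (real \<times> real) measure)"
    by (auto intro!: borel_measurable_continuous_onI continuous_intros)
  have [measurable]: "{p. snd p \<le> fst p} \<in> sets (borel :: (real \<times> real) measure)"
      "{p. fst p < snd p} \<in> sets (borel :: (real \<times> real) measure)"
    by (intro borel_closed closed_Collect_le borel_open open_Collect_less continuous_intros)+
  have prodA: "integrable (lborel \<Otimes>\<^sub>M lborel) (\<lambda>(t,s). f' t * g' s * indicator {p. snd p \<le> fst p} (t,s))"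
  proof (rule Bochner_Integration.integrable_bound[OF prod])
    show "(\<lambda>(t,s). f' t * g' s * indicator {p. snd p \<le> fst p} (t,s)) \<in> borel_measurable (lborel \<Otimes>\<^sub>M lborel)"
      unfolding lborel_prod by (simp add: split_beta)
  qed (simp add: indicator_def split_beta)
  have prodB: "integrable (lborel \<Otimes>\<^sub>M lborel) (\<lambda>(t,s). f' t * g' s * indicator {p. fst p < snd p} (t,s))"
  proof (rule Bochner_Integration.integrable_bound[OF prod])
    show "(\<lambda>(t,s). f' t * g' s * indicator {p. fst p < snd p} (t,s)) \<in> borel_measurable (lborel \<Otimes>\<^sub>M lborel)"
      unfolding lborel_prod by (simp add: split_beta)
  qed (simp add: indicator_def split_beta)
  have inG: "(LINT s|lborel. g' s * indicator {p. snd p \<le> fst p} (t,s)) = G t - G a" if "t \<in> {a..z}" for t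
  proof -
    have "(LINT s|lborel. g' s * indicator {p. snd p \<le> fst p} (t,s)) = (LINT s:{a..t}|lborel. g s)"
      unfolding set_lebesgue_integral_def g'_def
      by (rule Bochner_Integration.integral_cong) (use that in \<open>auto simp: indicator_def\<close>)
    then show ?thesis using AC_density_eq[OF G] that z by simp
  qed
  have inF: "(LINT t|lborel. f' t * indicator {p. fst p < snd p} (t,s)) = F s - F a" if "s \<in> {a..z}" for s
  proof -
    \<comment> \<open>The strict half leaves out the point \<open>t = s\<close>, so the integrands
      agree only almost everywhere.\<close>
    have "(LINT t|lborel. f' t * indicator {p. fst p < snd p} (t,s)) = (LINT t:{a..s}|lborel. f t)"
      unfolding set_lebesgue_integral_def f'_def
    proof (rule integral_cong_AE)
      have "(\<lambda>x. indicator {a..s} x *\<^sub>R f x) = (\<lambda>x. indicator {a..s} x * f' x)"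
        using that by (auto simp: f'_def indicator_def)
      then show "(\<lambda>x. indicator {a..s} x *\<^sub>R f x) \<in> borel_measurable lborel" by simp
      show "AE x in lborel. indicat_real {a..z} x * f x * indicat_real {p. fst p < snd p} (x, s) = indicat_real {a..s} x *\<^sub>R f x"
        using AE_lborel_singleton[of s] by eventually_elim (use that in \<open>auto simp: indicator_def\<close>)
      show "(\<lambda>x. indicat_real {a..z} x * f x * indicat_real {p. fst p < snd p} (x, s)) \<in> borel_measurable lborel"
      proof -
        have "(\<lambda>x. indicat_real {a..z} x * f x * indicat_real {p. fst p < snd p} (x, s)) = (\<lambda>x. f' x * indicator {..<s} x)"
          by (auto simp: f'_def indicator_def)
        then show ?thesis by simp
      qed
    qed
    then show ?thesis using AC_density_eq[OF F] that z by simp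
  qed
  have A: "(LINT t|lborel. LINT s|lborel. f' t * g' s * indicator {p. snd p \<le> fst p} (t,s))
      = (LINT t:{a..z}|lborel. f t * (G t - G a))"
    unfolding set_lebesgue_integral_def
  proof (rule Bochner_Integration.integral_cong[OF refl])
    fix t
    have "(LINT s|lborel. f' t * g' s * indicator {p. snd p \<le> fst p} (t,s)) = f' t * (LINT s|lborel. g' s * indicator {p. snd p \<le> fst p} (t,s))"
      by (simp add: mult.assoc)
    then show "(LINT s|lborel. f' t * g' s * indicator {p. snd p \<le> fst p} (t,s)) = indicator {a..z} t *\<^sub>R (f t * (G t - G a))"
      using inG[of t] by (auto simp: f'_def indicator_def)
  qed
  have B: "(LINT s|lborel. LINT t|lborel. f' t * g' s * indicator {p. fst p < snd p} (t,s))
      = (LINT s:{a..z}|lborel. (F s - F a) * g s)"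
    unfolding set_lebesgue_integral_def
  proof (rule Bochner_Integration.integral_cong[OF refl])
    fix s
    have "(LINT t|lborel. f' t * g' s * indicator {p. fst p < snd p} (t,s)) = g' s * (LINT t|lborel. f' t * indicator {p. fst p < snd p} (t,s))"
      by (subst integral_mult_right_zero[symmetric]) (simp add: ac_simps)
    then show "(LINT t|lborel. f' t * g' s * indicator {p. fst p < snd p} (t,s)) = indicator {a..z} s *\<^sub>R ((F s - F a) * g s)"
      using inF[of s] by (auto simp: g'_def indicator_def)
  qed
  have "(LINT t:{a..z}|lborel. f t) * (LINT t:{a..z}|lborel. g t)
      = (LINT p|(lborel \<Otimes>\<^sub>M lborel). (\<lambda>(t,s). f' t * g' s) p)"
  proof -
    have "(LINT p|(lborel \<Otimes>\<^sub>M lborel). (\<lambda>(t,s). f' t * g' s) p) = (LINT t|lborel. LINT s|lborel. f' t * g' s)"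
      using lborel_pair.integral_fst'[OF prod] by simp
    then show ?thesis
      by (simp add: f'_def g'_def set_lebesgue_integral_def)
  qed
  also have "\<dots> = (LINT p|(lborel \<Otimes>\<^sub>M lborel). (\<lambda>(t,s). f' t * g' s * indicator {p. snd p \<le> fst p} (t,s)) p
        + (\<lambda>(t,s). f' t * g' s * indicator {p. fst p < snd p} (t,s)) p)"
    by (rule Bochner_Integration.integral_cong) (auto simp: indicator_def)
  also have "\<dots> = (LINT p|(lborel \<Otimes>\<^sub>M lborel). (\<lambda>(t,s). f' t * g' s * indicator {p. snd p \<le> fst p} (t,s)) p)
      + (LINT p|(lborel \<Otimes>\<^sub>M lborel). (\<lambda>(t,s). f' t * g' s * indicator {p. fst p < snd p} (t,s)) p)"
    by (rule Bochner_Integration.integral_add[OF prodA prodB])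
  also have "\<dots> = (LINT t:{a..z}|lborel. f t * (G t - G a)) + (LINT s:{a..z}|lborel. (F s - F a) * g s)"
    using lborel_pair.integral_fst'[OF prodA] lborel_pair.integral_snd[OF prodB] A B
    unfolding prod.case by (metis (no_types))
  also have "\<dots> = (LINT t:{a..z}|lborel. (G t * f t + F t * g t) - (G a * f t + F a * g t))"
  proof -
    have cF: "continuous_on {a..z} F" and cG: "continuous_on {a..z} G"
      using z by (auto intro!: continuous_on_subset[OF AC_density_continuous[OF F]]
          continuous_on_subset[OF AC_density_continuous[OF G]])
    have "set_integrable lborel {a..z} (\<lambda>t. (G t - G a) * f t)" "set_integrable lborel {a..z} (\<lambda>t. (F t - F a) * g t)"
      by (intro set_integrable_continuous_mult fi gi continuous_intros cF cG)+
    then have "(LINT t:{a..z}|lborel. (G t - G a) * f t) + (LINT t:{a..z}|lborel. (F t - F a) * g t)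
       = (LINT t:{a..z}|lborel. (G t - G a) * f t + (F t - F a) * g t)"
      by (rule set_integral_add(2)[symmetric])
    also have "\<dots> = (LINT t:{a..z}|lborel. (G t * f t + F t * g t) - (G a * f t + F a * g t))"
      by (rule arg_cong[where f="set_lebesgue_integral lborel {a..z}"]) (simp add: fun_eq_iff algebra_simps)
    finally show ?thesis by (simp only: mult.commute)
  qed
  also have "\<dots> = (LINT t:{a..z}|lborel. G t * f t + F t * g t) - (G a * (LINT t:{a..z}|lborel. f t) + F a * (LINT t:{a..z}|lborel. g t))"
  proof -
    have cF: "continuous_on {a..z} F" and cG: "continuous_on {a..z} G"
      using z by (auto intro!: continuous_on_subset[OF AC_density_continuous[OF F]]
          continuous_on_subset[OF AC_density_continuous[OF G]])
    have "set_integrable lborel {a..z} (\<lambda>t. G t * f t + F t * g t)"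
      by (intro set_integral_add set_integrable_continuous_mult fi gi cF cG)
    moreover have "set_integrable lborel {a..z} (\<lambda>t. G a * f t)" "set_integrable lborel {a..z} (\<lambda>t. F a * g t)"
      using fi gi by auto
    ultimately show ?thesis
      by (simp only: set_integral_diff(2)[OF _ set_integral_add(1)] set_integral_add(2) set_integral_mult_right)
  qed
  finally show "(LINT t:{a..z}|lborel. G t * f t + F t * g t) = F z * G z - F a * G a"
    using AC_density_eq[OF F, of z] AC_density_eq[OF G, of z] z by (simp only: atLeastAtMost_iff) algebra
qed

lemma AC_density_add:
  assumes "AC_density a b F f" "AC_density a b G g"
  shows "AC_density a b (\<lambda>t. F t + G t) (\<lambda>t. f t + g t)"
  unfolding AC_density_def
proof (intro conjI ballI)
  show "set_integrable lborel {a..b} (\<lambda>t. f t + g t)"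
    using assms by (intro set_integral_add) (auto simp: AC_density_def)
  fix z assume z: "z \<in> {a..b}"
  have "set_integrable lborel {a..z} f" "set_integrable lborel {a..z} g"
    using z assms by (auto simp: AC_density_def intro: set_integrable_subset)
  then show "(LINT t:{a..z}|lborel. f t + g t) = F z + G z - (F a + G a)"
    using AC_density_eq[OF assms(1), of z] AC_density_eq[OF assms(2), of z] z by (simp add: set_integral_add)
qed

subsection \<open>The one-dimensional Carleman estimate\<close>

text \<open>Every exact derivative in the one-dimensional estimate is that of a quadratic form in
  \<open>y\<close> and \<open>r = y'\<close> with variable coefficients. The three steps below
  differ only in the choice of \<open>\<alpha>\<close>, \<open>\<beta>\<close>,
  \<open>\<gamma>\<close>.\<close>

lemma AC_density_quadratic:
  assumes ab: "a \<le> b" and y: "AC_density a b y r" and r: "AC_density a b r s"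
    and "\<And>x. a \<le> x \<Longrightarrow> x \<le> b \<Longrightarrow> (\<alpha> has_real_derivative \<alpha>' x) (at x)" "continuous_on {a..b} \<alpha>'"
    and "\<And>x. a \<le> x \<Longrightarrow> x \<le> b \<Longrightarrow> (\<beta> has_real_derivative \<beta>' x) (at x)" "continuous_on {a..b} \<beta>'"
    and "\<And>x. a \<le> x \<Longrightarrow> x \<le> b \<Longrightarrow> (\<gamma> has_real_derivative \<gamma>' x) (at x)" "continuous_on {a..b} \<gamma>'"
  shows "AC_density a b (\<lambda>t. \<alpha> t * (r t)\<^sup>2 + \<beta> t * (y t * r t) + \<gamma> t * (y t)\<^sup>2)
     (\<lambda>t. \<alpha>' t * (r t)\<^sup>2 + 2 * \<alpha> t * (r t * s t) + \<beta>' t * (y t * r t) + \<beta> t * (r t)\<^sup>2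
        + \<beta> t * (y t * s t) + \<gamma>' t * (y t)\<^sup>2 + 2 * \<gamma> t * (y t * r t))"
proof -
  have \<alpha>: "AC_density a b \<alpha> \<alpha>'" and \<beta>: "AC_density a b \<beta> \<beta>'" and \<gamma>: "AC_density a b \<gamma> \<gamma>'"
    using assms by (auto intro!: AC_density_C1)
  show ?thesis
    using AC_density_add[OF AC_density_add[OF AC_density_mult[OF \<alpha> AC_density_mult[OF r r]]
          AC_density_mult[OF \<beta> AC_density_mult[OF y r]]] AC_density_mult[OF \<gamma> AC_density_mult[OF y y]]]
    by (simp add: algebra_simps power2_eq_square)
qed

section \<open>Three multiplier estimates for the conjugated equation\<close>

lemma set_integrable_continuous:
  fixes f :: "real \<Rightarrow> real"
  shows "continuous_on {a..b} f \<Longrightarrow> set_integrable lborel {a..b} f"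
  unfolding set_integrable_def by (rule borel_integrable_compact[OF compact_Icc])

lemma set_integrable_square_add:
  fixes s h :: "real \<Rightarrow> real"
  assumes "set_integrable lborel {a..b} s" "set_integrable lborel {a..b} (\<lambda>t. (s t)\<^sup>2)"
    and h: "continuous_on {a..b} h"
  shows "set_integrable lborel {a..b} (\<lambda>t. (s t + h t)\<^sup>2)"
proof -
  have "set_integrable lborel {a..b} (\<lambda>t. (s t)\<^sup>2 + (2 * h t) * s t + (h t)\<^sup>2)"
    by (intro set_integral_add set_integrable_continuous_mult set_integrable_continuous assms continuous_intros)
  then show ?thesis by (simp add: power2_sum ac_simps)
qed

text \<open>Expanding \<open>(S + A)^2\<close> and integrating \<open>2SA\<close> by parts. Both
  squares are kept on the left, because the later steps draw the bounds for \<open>r\<close> and for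
  the \<open>mu\<close> term from them. The boundary cost at \<open>b\<close> is of the full order
  \<open>lam^3\<close> and has to be weakened afterwards.\<close>

lemma carleman_step1:
  fixes a b lam mu :: real
  assumes ab: "0 < a" "a < b" and lam: "lam \<ge> 1" and mu: "mu \<ge> 0"
    and y: "AC_density a b y r" and r: "AC_density a b r s"
    and s2: "set_integrable lborel {a..b} (\<lambda>t. (s t)\<^sup>2)" and ya: "y a = 0"
  shows "(LINT t:{a..b}|lborel. (s t + (4*lam^2*t^2 - mu) * y t)\<^sup>2)
       + (LINT t:{a..b}|lborel. (4*lam*t*r t + 2*lam*y t)\<^sup>2)
       + 32*lam^3*a^2 * (LINT t:{a..b}|lborel. (y t)\<^sup>2)
     \<le> (LINT t:{a..b}|lborel. (s t - 4*lam*t*r t + (4*lam^2*t^2 - mu - 2*lam) * y t)\<^sup>2)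
       + (48*b^3 + 16*b + 4) * lam^3 * ((y b)\<^sup>2 + (r b - 2*lam*b*y b)\<^sup>2)"
proof -
  let ?S = "\<lambda>t. (s t + (4*lam^2*t^2 - mu) * y t)\<^sup>2"
  let ?A = "\<lambda>t. (4*lam*t*r t + 2*lam*y t)\<^sup>2"
  let ?F = "\<lambda>t. (s t - 4*lam*t*r t + (4*lam^2*t^2 - mu - 2*lam) * y t)\<^sup>2"
  let ?Y = "\<lambda>t. (-4*lam*t) * (r t)\<^sup>2 + (-4*lam) * (y t * r t) + (-4*lam*t*(4*lam^2*t^2-mu)) * (y t)\<^sup>2"
  let ?D = "\<lambda>t. (-4*lam) * (r t)\<^sup>2 + 2 * (-4*lam*t) * (r t * s t) + 0 * (y t * r t) + (-4*lam) * (r t)\<^sup>2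
        + (-4*lam) * (y t * s t) + (-4*lam*(12*lam^2*t^2-mu)) * (y t)\<^sup>2 + 2 * (-4*lam*t*(4*lam^2*t^2-mu)) * (y t * r t)"
  note cy = AC_density_continuous[OF y] and cr = AC_density_continuous[OF r]
  have s: "set_integrable lborel {a..b} s" by (rule AC_density_integrable[OF r])
  have D: "AC_density a b ?Y ?D"
    by (rule AC_density_quadratic[OF less_imp_le[OF ab(2)] y r])
      (auto intro!: derivative_eq_intros continuous_intros simp: algebra_simps power2_eq_square)
  have iD: "set_integrable lborel {a..b} ?D" by (rule AC_density_integrable[OF D])
  have iS: "set_integrable lborel {a..b} ?S"
    by (intro set_integrable_square_add s s2 continuous_intros cy)
  have iA: "set_integrable lborel {a..b} ?A"
    by (intro set_integrable_continuous continuous_intros cy cr)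
  have iy: "set_integrable lborel {a..b} (\<lambda>t. (32*lam^3*a^2) * (y t)\<^sup>2)"
    by (intro set_integrable_continuous continuous_intros cy)
  have iF: "set_integrable lborel {a..b} ?F"
  proof -
    have "set_integrable lborel {a..b} (\<lambda>t. (s t + (- 4*lam*t*r t + (4*lam^2*t^2 - mu - 2*lam) * y t))\<^sup>2)"
      by (intro set_integrable_square_add s s2 continuous_intros cy cr)
    then show ?thesis by (simp add: algebra_simps)
  qed
  have "(LINT t:{a..b}|lborel. ?S t + ?A t + (32*lam^3*a^2) * (y t)\<^sup>2 + ?D t) \<le> (LINT t:{a..b}|lborel. ?F t)"
  proof (rule set_integral_mono)
    show "set_integrable lborel {a..b} (\<lambda>t. ?S t + ?A t + (32*lam^3*a^2) * (y t)\<^sup>2 + ?D t)"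
      by (intro set_integral_add(1) iS iA iy iD)
    fix t assume t: "t \<in> {a..b}"
    have "(32*lam^3*a^2) * (y t)\<^sup>2 \<le> (32*lam^3*t^2) * (y t)\<^sup>2"
      using t ab lam by (intro mult_right_mono mult_left_mono power_mono) auto
    \<comment> \<open>The cross product \<open>2SA\<close> is \<open>?D\<close> plus two nonnegative
      terms. The term \<open>8*lam*(r t)^2\<close> is then discarded, since \<open>?A\<close> yields
      a stronger bound for \<open>r\<close>.\<close>
    moreover have "?F t = ?S t + ?A t + (32*lam^3*t^2) * (y t)\<^sup>2 + 8*lam*(r t)\<^sup>2 + ?D t"
      by (simp add: algebra_simps power2_eq_square power3_eq_cube)
    moreover have "8*lam*(r t)\<^sup>2 \<ge> 0" using lam by simp
    ultimately show "?S t + ?A t + (32*lam^3*a^2) * (y t)\<^sup>2 + ?D t \<le> ?F t" by linarith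
  qed (rule iF)
  then have main: "(LINT t:{a..b}|lborel. ?S t) + (LINT t:{a..b}|lborel. ?A t)
      + 32*lam^3*a^2 * (LINT t:{a..b}|lborel. (y t)\<^sup>2) + (?Y b - ?Y a) \<le> (LINT t:{a..b}|lborel. ?F t)"
    unfolding set_integral_add(2)[OF set_integral_add(1)[OF set_integral_add(1)[OF iS iA] iy] iD]
      set_integral_add(2)[OF set_integral_add(1)[OF iS iA] iy] set_integral_add(2)[OF iS iA]
      AC_density_eq[OF D less_imp_le[OF ab(2)] order_refl] set_integral_mult_right .
  have "?Y a \<le> 0" using ab lam by (simp add: ya)
  moreover have "- ?Y b \<le> (48*b^3 + 16*b + 4) * lam^3 * ((y b)\<^sup>2 + (r b - 2*lam*b*y b)\<^sup>2)"
  proof -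
    \<comment> \<open>For \<open>y = exp(lam*z^2) v\<close> this is
      \<open>exp(lam*b^2) v'(b)\<close>. Using \<open>y b\<close> and \<open>P\<close> as boundary
      data lets the conjugation be undone at the end. The boundary term with \<open>mu\<close> has
      the good sign at \<open>b\<close>, so the constant does not depend on the mode.\<close>
    define P where "P = r b - 2*lam*b*y b"
    have rb: "r b = P + 2*lam*b*y b" by (simp add: P_def)
    have l1: "lam \<le> lam^3" "lam^2 \<le> lam^3" "0 < lam" using lam power_increasing[of 1 3 lam] power_increasing[of 2 3 lam] by auto
    have b: "0 < b" using ab by simp
    have "- ?Y b = 4*lam*b*(r b)\<^sup>2 + 4*lam*(y b * r b) + 16*lam^3*b^3*(y b)\<^sup>2 - 4*lam*b*mu*(y b)\<^sup>2"
      by (simp add: algebra_simps power2_eq_square power3_eq_cube)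
    also have "\<dots> \<le> 4*lam*b*(r b)\<^sup>2 + 4*lam*(y b * r b) + 16*lam^3*b^3*(y b)\<^sup>2"
      using b mu l1 by simp
    also have "4*lam*b*(r b)\<^sup>2 \<le> 8*lam*b*P\<^sup>2 + 32*lam^3*b^3*(y b)\<^sup>2"
    proof -
      have "(r b)\<^sup>2 \<le> 2*P\<^sup>2 + 8*lam^2*b^2*(y b)\<^sup>2"
        using sum_squares_bound[of P "2*lam*b*y b"] unfolding rb by (simp add: power2_sum power_mult_distrib algebra_simps)
      then have "4*lam*b*(r b)\<^sup>2 \<le> 4*lam*b*(2*P\<^sup>2 + 8*lam^2*b^2*(y b)\<^sup>2)"
        using b l1 by (intro mult_left_mono) auto
      then show ?thesis by (simp add: algebra_simps power2_eq_square power3_eq_cube)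
    qed
    also have "4*lam*(y b * r b) \<le> 2*lam*((y b)\<^sup>2 + P\<^sup>2) + 8*lam^2*b*(y b)\<^sup>2"
    proof -
      have "2 * (y b * r b) \<le> (y b)\<^sup>2 + P\<^sup>2 + 4*lam*b*(y b)\<^sup>2"
        using sum_squares_bound[of P "y b"] unfolding rb by (simp add: algebra_simps power2_eq_square)
      then have "2*lam*(2*(y b * r b)) \<le> 2*lam*((y b)\<^sup>2 + P\<^sup>2 + 4*lam*b*(y b)\<^sup>2)"
        using l1 by (intro mult_left_mono) auto
      then show ?thesis by (simp add: algebra_simps power2_eq_square)
    qed
    finally have "- ?Y b \<le> (8*b+2)*(lam*P\<^sup>2) + 48*b^3*(lam^3*(y b)\<^sup>2) + 2*(lam*(y b)\<^sup>2) + 8*b*(lam^2*(y b)\<^sup>2)"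
      by (simp add: algebra_simps)
    also have "\<dots> \<le> (8*b+2)*(lam^3*P\<^sup>2) + 48*b^3*(lam^3*(y b)\<^sup>2) + 2*(lam^3*(y b)\<^sup>2) + 8*b*(lam^3*(y b)\<^sup>2)"
      using b l1 by (intro add_mono mult_left_mono mult_right_mono) auto
    also have "\<dots> \<le> (48*b^3 + 16*b + 4) * lam^3 * ((y b)\<^sup>2 + P\<^sup>2)"
    proof -
      have "0 \<le> (48*b^3 + 8*b+2)*(lam^3*P\<^sup>2) + (8*b + 2) * (lam^3*(y b)\<^sup>2)" using b l1 by simp
      then show ?thesis by (simp add: algebra_simps)
    qed
    finally show ?thesis by (simp add: P_def)
  qed
  ultimately show ?thesis using main by linarith
qed

text \<open>Here \<open>l\<close> is \<open>sqrt lam\<close>, which keeps half powers polynomial.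
  Over the common denominator \<open>D^2\<close> the mixed terms in \<open>X^2\<close> add up to
  \<open>32*l^6*X^2*(b^2 - z^2)\<close>, which is nonnegative because of the constant 16 in
  \<open>D\<close>; what remains is \<open>2*X^4 + 512*z^2*b^2*l^12\<close>, and this dominates a
  multiple of \<open>D^2\<close>. The bound for \<open>X/D\<close> is the inequality of the means
  applied to the two summands of \<open>D\<close>.\<close>

lemma carleman_weight_quotient:
  fixes X l a b z :: real
  assumes ab: "0 < a" "a \<le> z" "z \<le> b" and l: "l \<ge> 1"
  defines "D \<equiv> X^2 + 16*b^2*l^6"
  shows "4*l^2*z*(8*l^4*z*(16*b^2*l^6 - X^2)/D^2) + 2*(X/D)*X \<ge> a^2/b^2"
    and "\<bar>X/D\<bar> \<le> 1/(8*b*l^3)"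
    and "\<bar>8*l^4*z*(16*b^2*l^6 - X^2)/D^2\<bar> \<le> 1/(2*b*l^2)"
proof -
  have b: "b > 0" using ab by simp
  have D: "D > 0" unfolding D_def using b l by (intro add_nonneg_pos) auto
  have zb: "z^2 \<le> b^2" and az: "a^2 \<le> z^2" using ab by (auto intro!: power_mono)
  have "a^2/b^2 * D^2 \<le> 32*l^6*z^2*(16*b^2*l^6 - X^2) + 2*X^2*D"
  proof -
    have ab1: "a^2/b^2 \<le> 1" using zb az b by simp
    have "a^2/b^2 * D^2 \<le> a^2/b^2 * (2*X^4 + 512*b^4*l^12)"
    proof (rule mult_left_mono)
      show "D^2 \<le> 2*X^4 + 512*b^4*l^12"
        using sum_squares_bound[of "X^2" "16*b^2*l^6"] unfolding D_def
        by (simp add: power2_sum power_mult_distrib flip: power_mult)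
    qed simp
    also have "\<dots> = a^2/b^2*(2*X^4) + 512*a^2*b^2*l^12"
      using b by (simp add: field_simps power2_eq_square power4_eq_xxxx)
    also have "\<dots> \<le> 1*(2*X^4) + 512*z^2*b^2*l^12"
      using ab1 az by (intro add_mono mult_right_mono mult_left_mono) auto
    \<comment> \<open>The added term is nonnegative since \<open>z <= b\<close>, and it completes
      the expression to the exact numerator.\<close>
    also have "\<dots> \<le> 1*(2*X^4) + 512*z^2*b^2*l^12 + 32*l^6*X^2*(b^2 - z^2)"
      using zb l by simp
    also have "\<dots> = 32*l^6*z^2*(16*b^2*l^6 - X^2) + 2*X^2*D"
      unfolding D_def by (simp add: algebra_simps flip: power_add)
    finally show ?thesis .
  qed
  then have "a^2/b^2 \<le> (32*l^6*z^2*(16*b^2*l^6 - X^2) + 2*X^2*D) / D^2"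
    using D by (simp add: pos_le_divide_eq)
  also have "\<dots> = 4*l^2*z*(8*l^4*z*(16*b^2*l^6 - X^2)/D^2) + 2*(X/D)*X"
  proof -
    have l6: "l^6 = l^2*l^4" by (simp flip: power_add)
    show ?thesis unfolding l6 using D by (simp add: field_simps power2_eq_square)
  qed
  finally show "4*l^2*z*(8*l^4*z*(16*b^2*l^6 - X^2)/D^2) + 2*(X/D)*X \<ge> a^2/b^2" .
  have "\<bar>X\<bar> * (8*b*l^3) \<le> D"
    using sum_squares_bound[of "\<bar>X\<bar>" "4*b*l^3"] unfolding D_def by (simp add: power_mult_distrib flip: power_mult)
  then show "\<bar>X/D\<bar> \<le> 1/(8*b*l^3)" using D b l by (simp add: abs_div_pos[symmetric] divide_simps mult.commute)
  have "\<bar>16*b^2*l^6 - X^2\<bar> \<le> D" unfolding D_def using b l by (auto simp: abs_le_iff)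
  then have "\<bar>8*l^4*z*(16*b^2*l^6 - X^2)/D^2\<bar> \<le> 8*l^4*b*D/D^2"
    using ab D l by (auto simp: abs_mult abs_div_pos[symmetric] intro!: divide_right_mono mult_mono)
  also have "\<dots> = 8*l^4*b/D" using D by (simp add: power2_eq_square)
  also have "\<dots> \<le> 8*l^4*b/(16*b^2*l^6)"
    using D b l by (intro divide_left_mono) (auto simp: D_def)
  also have "\<dots> = 1/(2*b*l^2)"
  proof -
    have l6: "l^6 = l^2*l^4" by (simp flip: power_add)
    show ?thesis unfolding l6 using b l by (simp add: field_simps power2_eq_square)
  qed
  finally show "\<bar>8*l^4*z*(16*b^2*l^6 - X^2)/D^2\<bar> \<le> 1/(2*b*l^2)" .
qed


text \<open>The equation is multiplied by \<open>2*G*y\<close> and integrated by parts, which leaves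
  \<open>y^2\<close> with the coefficient \<open>4*lam*t*G' + 2*G*X >= a^2/b^2\<close>. Half of this
  pays for the products \<open>y F\<close> and \<open>y r\<close>. After scaling by
  \<open>lam^3\<close> the bounds for \<open>G\<close> and \<open>G'\<close> leave
  \<open>F^2\<close> with a coefficient independent of \<open>lam\<close>, and \<open>r^2\<close>
  with at most \<open>lam*l\<close>, which the first step can cover.\<close>

lemma carleman_step2:
  fixes a b lam l mu :: real
  assumes ab: "0 < a" "a < b" and l: "l \<ge> 1" "lam = l^2"
    and y: "AC_density a b y r" and r: "AC_density a b r s"
    and s2: "set_integrable lborel {a..b} (\<lambda>t. (s t)\<^sup>2)" and ya: "y a = 0"
  shows "a^2/b^2/2 * lam^3 * (LINT t:{a..b}|lborel. (y t)\<^sup>2)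
     \<le> (LINT t:{a..b}|lborel. (s t - 4*lam*t*r t + (4*lam^2*t^2 - mu - 2*lam) * y t)\<^sup>2) / (16*a^2)
       + (lam/a^2 + lam*l/(4*b)) * (LINT t:{a..b}|lborel. (r t)\<^sup>2)
       + (1/(8*b) + 1) * (lam^2*l) * ((y b)\<^sup>2 + (r b - 2*lam*b*y b)\<^sup>2)"
proof -
  define X where "X t = 4*lam^2*t^2 - mu" for t
  define D where "D t = (X t)^2 + 16*b^2*lam^3" for t
  define G where "G t = X t / D t" for t
  define G' where "G' t = 8*lam^2*t*(16*b^2*lam^3 - (X t)^2) / (D t)^2" for t
  define F where "F t = s t - 4*lam*t*r t + (4*lam^2*t^2 - mu - 2*lam) * y t" for t
  have b: "b > 0" using ab by simp
  have lam: "lam \<ge> 1" using l by (simp add: one_le_power)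
  have Dpos: "D t > 0" for t unfolding D_def using b lam by (intro add_nonneg_pos) auto
  have lam3: "lam^3 = lam^2*lam" by (simp add: power2_eq_square power3_eq_cube)
  have l4: "l^4 = lam^2" "l^6 = lam^3" "l^3 = lam*l" by (simp_all add: l flip: power_mult power_Suc2)
  have quot: "4*lam*t*G' t + 2*G t*X t \<ge> a^2/b^2" "\<bar>G t\<bar> \<le> 1/(8*b*(lam*l))" "\<bar>G' t\<bar> \<le> 1/(2*b*lam)"
    if "t \<in> {a..b}" for t
    using carleman_weight_quotient[OF ab(1), of t b l "X t"] that l
    unfolding G_def G'_def D_def l4 l(2)[symmetric] by auto
  have dG: "(G has_real_derivative G' t) (at t)" for t
  proof -
    have "((\<lambda>t. X t / D t) has_real_derivative
        ((8*lam^2*t) * D t - X t * (2 * X t * (8*lam^2*t))) / (D t * D t)) (at t)"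
      using Dpos[of t] unfolding X_def D_def by (auto intro!: derivative_eq_intros)
    moreover have "((8*lam^2*t) * D t - X t * (2 * X t * (8*lam^2*t))) / (D t * D t) = G' t"
      unfolding G'_def by (simp add: D_def power2_eq_square algebra_simps)
    ultimately show ?thesis by (simp add: G_def[abs_def])
  qed
  have cX: "continuous_on {a..b} X" unfolding X_def[abs_def] by (intro continuous_intros)
  have cD: "continuous_on {a..b} D" unfolding D_def[abs_def] by (intro continuous_intros cX)
  have cG: "continuous_on {a..b} G" unfolding G_def[abs_def] using Dpos
    by (intro continuous_intros cX cD) (auto simp: less_imp_neq[symmetric])
  have cG': "continuous_on {a..b} G'" unfolding G'_def[abs_def] using Dpos
    by (intro continuous_intros cX cD) (auto simp: less_imp_neq[symmetric])
  note cy = AC_density_continuous[OF y] and cr = AC_density_continuous[OF r]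
  have s: "set_integrable lborel {a..b} s" by (rule AC_density_integrable[OF r])
  let ?Y = "\<lambda>t. 0 * (r t)\<^sup>2 + (2*G t) * (y t * r t) + (-4*lam*(t*G t)) * (y t)\<^sup>2"
  let ?D = "\<lambda>t. 0 * (r t)\<^sup>2 + 2 * 0 * (r t * s t) + (2*G' t) * (y t * r t) + (2*G t) * (r t)\<^sup>2
        + (2*G t) * (y t * s t) + (-4*lam*(G t + t*G' t)) * (y t)\<^sup>2 + 2 * (-4*lam*(t*G t)) * (y t * r t)"
  have DY: "AC_density a b ?Y ?D"
    by (rule AC_density_quadratic[OF less_imp_le[OF ab(2)] y r])
      (auto intro!: derivative_eq_intros dG continuous_intros cG cG')
  have iD: "set_integrable lborel {a..b} (\<lambda>t. lam^3 * ?D t)"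
    using AC_density_integrable[OF DY] by (rule set_integrable_mult_right)
  have iF: "set_integrable lborel {a..b} (\<lambda>t. 1/(16*a^2) * (F t)\<^sup>2)"
  proof -
    have "set_integrable lborel {a..b} (\<lambda>t. (s t + (- 4*lam*t*r t + (4*lam^2*t^2 - mu - 2*lam) * y t))\<^sup>2)"
      by (intro set_integrable_square_add s s2 continuous_intros cy cr)
    then have "set_integrable lborel {a..b} (\<lambda>t. (F t)\<^sup>2)" by (simp add: F_def algebra_simps)
    then show ?thesis by (rule set_integrable_mult_right)
  qed
  have ir: "set_integrable lborel {a..b} (\<lambda>t. (lam/a^2 + lam*l/(4*b)) * (r t)\<^sup>2)"
    by (intro set_integrable_continuous continuous_intros cr)
  have iy: "set_integrable lborel {a..b} (\<lambda>t. (a^2/b^2/2 * lam^3) * (y t)\<^sup>2)"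
    by (intro set_integrable_continuous continuous_intros cy)
  have pw: "(a^2/b^2/2 * lam^3) * (y t)\<^sup>2 \<le> 1/(16*a^2) * (F t)\<^sup>2 + (lam/a^2 + lam*l/(4*b)) * (r t)\<^sup>2 - lam^3 * ?D t"
    if t: "t \<in> {a..b}" for t
  proof -
    have "a^2/b^2 * (y t)\<^sup>2 \<le> (4*lam*t*G' t + 2*G t*X t) * (y t)\<^sup>2"
      using quot(1)[OF t] by (rule mult_right_mono) simp
    also have "\<dots> = 2*G t*y t*F t - ?D t + 2*G' t*(y t*r t) + 2*G t*(r t)\<^sup>2"
      unfolding F_def X_def by (simp add: algebra_simps power2_eq_square)
    finally have "lam^3 * (a^2/b^2 * (y t)\<^sup>2)
        \<le> lam^3 * (2*G t*y t*F t - ?D t + 2*G' t*(y t*r t) + 2*G t*(r t)\<^sup>2)"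
      using lam by (intro mult_left_mono) auto
    then have 1: "lam^3 * (a^2/b^2 * (y t)\<^sup>2) \<le> lam^3*(2*G t*y t*F t) + lam^3*(2*G' t*(y t*r t))
        + lam^3*(2*G t*(r t)\<^sup>2) - lam^3 * ?D t"
      by (simp only: ring_distribs)
    have 2: "lam^3*(2*G t*y t*F t) \<le> a^2/b^2/4*lam^3*(y t)\<^sup>2 + 1/(16*a^2)*(F t)\<^sup>2"
    proof -
      have "lam^3*(2*G t*y t*F t) \<le> lam^3*(2*\<bar>G t\<bar>*\<bar>y t\<bar>*\<bar>F t\<bar>)"
        using lam by (intro mult_left_mono) (auto simp: abs_mult[symmetric])
      also have "\<dots> \<le> lam^3*(2*(1/(8*b*(lam*l)))*\<bar>y t\<bar>*\<bar>F t\<bar>)"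
        using lam quot(2)[OF t] by (intro mult_left_mono mult_right_mono) auto
      \<comment> \<open>The split is weighted so that the square of the first factor is a quarter of
        the available \<open>a^2/b^2*lam^3*y^2\<close>, by \<open>lam^2*l^2 = lam^3\<close>. The
        product \<open>y r\<close> takes a second quarter, and half is left for the
        conclusion.\<close>
      also have "\<dots> = 2 * (a/b/2*(lam*l)*\<bar>y t\<bar>) * (1/(4*a)*\<bar>F t\<bar>)"
        using lam ab b l by (simp add: field_simps power2_eq_square power3_eq_cube)
      also have "\<dots> \<le> (a/b/2*(lam*l)*\<bar>y t\<bar>)^2 + (1/(4*a)*\<bar>F t\<bar>)^2"
        by (rule sum_squares_bound)
      also have "\<dots> = a^2/b^2/4*lam^3*(y t)\<^sup>2 + 1/(16*a^2)*(F t)\<^sup>2"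
        by (simp add: power_mult_distrib power_divide l(2)[symmetric] lam3)
      finally show ?thesis .
    qed
    have 3: "lam^3*(2*G' t*(y t*r t)) \<le> a^2/b^2/4*lam^3*(y t)\<^sup>2 + lam/a^2*(r t)\<^sup>2"
    proof -
      have "lam^3*(2*G' t*(y t*r t)) \<le> lam^3*(2*\<bar>G' t\<bar>*(\<bar>y t\<bar>*\<bar>r t\<bar>))"
        using lam by (intro mult_left_mono) (auto simp: abs_mult[symmetric])
      also have "\<dots> \<le> lam^3*(2*(1/(2*b*lam))*(\<bar>y t\<bar>*\<bar>r t\<bar>))"
        using lam quot(3)[OF t] by (intro mult_left_mono mult_right_mono) auto
      also have "\<dots> = 2 * (a/b/2*(lam*l)*\<bar>y t\<bar>) * (l/a*\<bar>r t\<bar>)"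
        using lam ab b l by (simp add: field_simps power2_eq_square power3_eq_cube)
      also have "\<dots> \<le> (a/b/2*(lam*l)*\<bar>y t\<bar>)^2 + (l/a*\<bar>r t\<bar>)^2"
        by (rule sum_squares_bound)
      also have "\<dots> = a^2/b^2/4*lam^3*(y t)\<^sup>2 + lam/a^2*(r t)\<^sup>2"
        by (simp add: power_mult_distrib power_divide l(2)[symmetric] lam3)
      finally show ?thesis .
    qed
    have 4: "lam^3*(2*G t*(r t)\<^sup>2) \<le> lam*l/(4*b)*(r t)\<^sup>2"
    proof -
      have "lam^3*(2*G t*(r t)\<^sup>2) \<le> lam^3*(2*(1/(8*b*(lam*l)))*(r t)\<^sup>2)"
        using lam quot(2)[OF t] by (intro mult_left_mono mult_right_mono) auto
      also have "\<dots> = lam*l/(4*b)*(r t)\<^sup>2"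
        using lam b l by (simp add: field_simps power2_eq_square power3_eq_cube)
      finally show ?thesis .
    qed
    have "lam^3 * (a^2/b^2 * (y t)\<^sup>2) \<le> (a^2/b^2/4*lam^3*(y t)\<^sup>2 + 1/(16*a^2)*(F t)\<^sup>2)
        + (a^2/b^2/4*lam^3*(y t)\<^sup>2 + lam/a^2*(r t)\<^sup>2) + lam*l/(4*b)*(r t)\<^sup>2 - lam^3 * ?D t"
      using 1 2 3 4 by linarith
    moreover have "H \<le> B + M - E" if "L \<le> (A + B) + (A + C) + D - E" "L = 2*A + H" "M = C + D"
      for A B C D E H L M :: real
      using that by linarith
    moreover have "lam^3 * (a^2/b^2 * (y t)\<^sup>2) = 2 * (a^2/b^2/4*lam^3*(y t)\<^sup>2) + (a^2/b^2/2 * lam^3) * (y t)\<^sup>2"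
      by simp
    moreover have "(lam/a^2 + lam*l/(4*b)) * (r t)\<^sup>2 = lam/a^2*(r t)\<^sup>2 + lam*l/(4*b)*(r t)\<^sup>2"
      by (rule distrib_right)
    ultimately show ?thesis by blast
  qed
  have "(LINT t:{a..b}|lborel. (a^2/b^2/2 * lam^3) * (y t)\<^sup>2)
      \<le> (LINT t:{a..b}|lborel. 1/(16*a^2) * (F t)\<^sup>2 + (lam/a^2 + lam*l/(4*b)) * (r t)\<^sup>2 - lam^3 * ?D t)"
    using pw by (intro set_integral_mono set_integral_add(1) set_integral_diff(1) iF ir iD iy)
  then have main: "a^2/b^2/2 * lam^3 * (LINT t:{a..b}|lborel. (y t)\<^sup>2)
      \<le> 1/(16*a^2) * (LINT t:{a..b}|lborel. (F t)\<^sup>2) + (lam/a^2 + lam*l/(4*b)) * (LINT t:{a..b}|lborel. (r t)\<^sup>2)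
       - lam^3 * (?Y b - ?Y a)"
    unfolding set_integral_diff(2)[OF set_integral_add(1)[OF iF ir] iD] set_integral_add(2)[OF iF ir]
      set_integral_mult_right AC_density_eq[OF DY less_imp_le[OF ab(2)] order_refl] .
  have "?Y a = 0" by (simp add: ya)
  moreover have "- (lam^3 * ?Y b) \<le> (1/(8*b) + 1) * (lam^2*l) * ((y b)\<^sup>2 + (r b - 2*lam*b*y b)\<^sup>2)"
  proof -
    define P where "P = r b - 2*lam*b*y b"
    define W where "W = (y b)\<^sup>2 + P\<^sup>2"
    have rb: "r b = P + 2*lam*b*y b" by (simp add: P_def)
    \<comment> \<open>The terms \<open>y r\<close> and \<open>lam y^2\<close> at \<open>b\<close>
      combine into the single product \<open>y b * P\<close>. No loose factor \<open>lam\<close>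
      remains, and after multiplication by \<open>lam^3\<close> the cost is of order
      \<open>lam*l\<close>, below the admissible \<open>lam^2*l\<close>.\<close>
    have "- ?Y b = G b * (- (2 * (y b * P)))"
      by (simp add: rb algebra_simps power2_eq_square)
    also have "\<dots> \<le> \<bar>G b\<bar> * \<bar>2 * (y b * P)\<bar>" by (metis abs_ge_self abs_minus_cancel abs_mult)
    also have "\<dots> \<le> 1/(8*b*(lam*l)) * W"
      using quot(2)[of b] ab b lam l(1) sum_squares_bound[of "y b" P] sum_squares_bound[of "y b" "-P"] unfolding W_def
      by (intro mult_mono) auto
    finally have "lam^3 * (- ?Y b) \<le> lam^3 * (1/(8*b*(lam*l)) * W)"
      using lam by (intro mult_left_mono) auto
    also have "\<dots> = 1/(8*b) * (lam*l) * W" using lam b l by (simp add: field_simps power2_eq_square power3_eq_cube)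
    also have "\<dots> \<le> (1/(8*b) + 1) * (lam^2*l) * W"
      using lam b l by (intro mult_right_mono mult_mono) (auto simp: W_def power2_eq_square)
    finally show ?thesis unfolding W_def P_def mult_minus_right .
  qed
  moreover have "x \<le> p + w" if "x \<le> p - c * (u - v)" "v = 0" "- (c * u) \<le> w" for x p w c u v :: real
    using that by simp
  ultimately show ?thesis using main unfolding F_def times_divide_eq_left mult_1 by blast
qed

text \<open>Testing \<open>S\<close> with \<open>lam*y\<close> isolates \<open>lam*mu*y^2\<close>:
  integration by parts of \<open>s y\<close> gives \<open>-r^2\<close>, which has the good sign. The
  product \<open>lam*S*y\<close> is split with weight \<open>1/l\<close> on \<open>S^2\<close>, the
  remaining \<open>l*lam^2*y^2\<close> being at most \<open>lam^3*y^2\<close> by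
  \<open>l <= lam\<close>. The weight \<open>1/l\<close> is what makes the expensive bound for
  \<open>S^2\<close> usable.\<close>

lemma carleman_step3:
  fixes a b lam l mu :: real
  assumes ab: "0 < a" "a < b" and l: "l \<ge> 1" "lam = l^2"
    and y: "AC_density a b y r" and r: "AC_density a b r s"
    and s2: "set_integrable lborel {a..b} (\<lambda>t. (s t)\<^sup>2)" and ya: "y a = 0"
  shows "lam * mu * (LINT t:{a..b}|lborel. (y t)\<^sup>2)
     \<le> (4*b^2 + 1) * lam^3 * (LINT t:{a..b}|lborel. (y t)\<^sup>2)
       + (LINT t:{a..b}|lborel. (s t + (4*lam^2*t^2 - mu) * y t)\<^sup>2) / l
       + (2*b + 1) * lam^2 * ((y b)\<^sup>2 + (r b - 2*lam*b*y b)\<^sup>2)"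
proof -
  define S where "S t = s t + (4*lam^2*t^2 - mu) * y t" for t
  have b: "b > 0" using ab by simp
  have lam: "lam \<ge> 1" using l by (simp add: one_le_power)
  note cy = AC_density_continuous[OF y] and cr = AC_density_continuous[OF r]
  have s: "set_integrable lborel {a..b} s" by (rule AC_density_integrable[OF r])
  let ?Y = "\<lambda>t. 0 * (r t)\<^sup>2 + lam * (y t * r t) + 0 * (y t)\<^sup>2"
  let ?D = "\<lambda>t. 0 * (r t)\<^sup>2 + 2 * 0 * (r t * s t) + 0 * (y t * r t) + lam * (r t)\<^sup>2
        + lam * (y t * s t) + 0 * (y t)\<^sup>2 + 2 * 0 * (y t * r t)"
  have DY: "AC_density a b ?Y ?D"
    by (rule AC_density_quadratic[OF less_imp_le[OF ab(2)] y r])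
      (auto intro!: derivative_eq_intros continuous_intros)
  note iD = AC_density_integrable[OF DY]
  have iS: "set_integrable lborel {a..b} (\<lambda>t. 1/l * (S t)\<^sup>2)"
    unfolding S_def by (intro set_integrable_mult_right set_integrable_square_add s s2 continuous_intros cy)
  have iy: "set_integrable lborel {a..b} (\<lambda>t. c * (y t)\<^sup>2)" for c
    by (intro set_integrable_continuous continuous_intros cy)
  have pw: "(lam*mu) * (y t)\<^sup>2 \<le> ((4*b^2 + 1) * lam^3) * (y t)\<^sup>2 + 1/l * (S t)\<^sup>2 + ?D t"
    if t: "t \<in> {a..b}" for t
  proof -
    have "(lam*mu) * (y t)\<^sup>2 = ?D t - lam*(r t)\<^sup>2 + (4*t^2*lam^3)*(y t)\<^sup>2 - lam * S t * y t"
      unfolding S_def by (simp add: algebra_simps power2_eq_square power3_eq_cube)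
    moreover have "0 \<le> lam*(r t)\<^sup>2" using lam by simp
    moreover have "(4*t^2*lam^3)*(y t)\<^sup>2 \<le> (4*b^2*lam^3)*(y t)\<^sup>2"
      using t lam ab by (intro mult_right_mono mult_left_mono power_mono) auto
    moreover have "- (lam * S t * y t) \<le> 1/l*(S t)\<^sup>2 + lam^3*(y t)\<^sup>2"
    proof -
      have "- (lam * S t * y t) \<le> \<bar>lam * S t * y t\<bar>" by simp
      also have "\<dots> = \<bar>S t\<bar> * \<bar>lam * y t\<bar>" using lam by (simp add: abs_mult)
      also have "\<dots> \<le> (S t)\<^sup>2/l + l * (lam*y t)\<^sup>2"
      proof -
        have "2 * (\<bar>S t\<bar>/l) * \<bar>lam * y t\<bar> \<le> (\<bar>S t\<bar>/l)^2 + \<bar>lam * y t\<bar>^2" by (rule sum_squares_bound)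
        then have "l * (2 * (\<bar>S t\<bar>/l) * \<bar>lam * y t\<bar>) \<le> l * ((\<bar>S t\<bar>/l)^2 + \<bar>lam * y t\<bar>^2)"
          using l by (intro mult_left_mono) auto
        moreover have "l * (2 * (\<bar>S t\<bar>/l) * \<bar>lam * y t\<bar>) = 2 * (\<bar>S t\<bar> * \<bar>lam * y t\<bar>)"
          using l(1) by simp
        moreover have "l * ((\<bar>S t\<bar>/l)^2 + \<bar>lam * y t\<bar>^2) = (S t)\<^sup>2/l + l * (lam*y t)\<^sup>2"
          using l(1) by (simp add: power_divide distrib_left) (simp add: power2_eq_square)
        ultimately have "2 * (\<bar>S t\<bar> * \<bar>lam * y t\<bar>) \<le> (S t)\<^sup>2/l + l * (lam*y t)\<^sup>2" by linarith
        moreover have "0 \<le> \<bar>S t\<bar> * \<bar>lam * y t\<bar>" by simp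
        ultimately show ?thesis by linarith
      qed
      also have "l * (lam*y t)\<^sup>2 \<le> lam * (lam*y t)\<^sup>2"
        using l by (intro mult_right_mono) (auto simp: power2_eq_square)
      also have "\<dots> = lam^3*(y t)\<^sup>2" by (simp add: power2_eq_square power3_eq_cube)
      finally show ?thesis by simp
    qed
    ultimately show ?thesis by (simp add: algebra_simps)
  qed
  have "(LINT t:{a..b}|lborel. (lam*mu) * (y t)\<^sup>2)
      \<le> (LINT t:{a..b}|lborel. ((4*b^2 + 1) * lam^3) * (y t)\<^sup>2 + 1/l * (S t)\<^sup>2 + ?D t)"
    using pw by (intro set_integral_mono set_integral_add(1) iS iD iy)
  then have main: "lam*mu * (LINT t:{a..b}|lborel. (y t)\<^sup>2)
      \<le> (4*b^2 + 1) * lam^3 * (LINT t:{a..b}|lborel. (y t)\<^sup>2) + 1/l * (LINT t:{a..b}|lborel. (S t)\<^sup>2) + (?Y b - ?Y a)"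
    unfolding set_integral_add(2)[OF set_integral_add(1)[OF iy iS] iD] set_integral_add(2)[OF iy iS]
      set_integral_mult_right AC_density_eq[OF DY less_imp_le[OF ab(2)] order_refl] .
  have "?Y b \<le> (2*b + 1) * lam^2 * ((y b)\<^sup>2 + (r b - 2*lam*b*y b)\<^sup>2)"
  proof -
    define P where "P = r b - 2*lam*b*y b"
    have rb: "r b = P + 2*lam*b*y b" by (simp add: P_def)
    have "?Y b = lam * (y b * P) + 2*b*lam^2*(y b)\<^sup>2"
      by (simp add: rb algebra_simps power2_eq_square)
    also have "\<dots> \<le> lam^2 * ((y b)\<^sup>2 + P\<^sup>2) + 2*b*lam^2*((y b)\<^sup>2 + P\<^sup>2)"
    proof (rule add_mono)
      have "2 * (y b * P) \<le> (y b)\<^sup>2 + P\<^sup>2" using sum_squares_bound[of "y b" P] by simp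
      moreover have "0 \<le> (y b)\<^sup>2 + P\<^sup>2" by simp
      ultimately have "y b * P \<le> (y b)\<^sup>2 + P\<^sup>2" by linarith
      then have "lam * (y b * P) \<le> lam * ((y b)\<^sup>2 + P\<^sup>2)" using lam by simp
      also have "\<dots> \<le> lam^2 * ((y b)\<^sup>2 + P\<^sup>2)"
        using lam by (intro mult_right_mono) (auto simp: power2_eq_square)
      finally show "lam * (y b * P) \<le> lam^2 * ((y b)\<^sup>2 + P\<^sup>2)" .
      show "2*b*lam^2*(y b)\<^sup>2 \<le> 2*b*lam^2*((y b)\<^sup>2 + P\<^sup>2)"
        using b by (intro mult_left_mono) auto
    qed
    finally show ?thesis by (simp add: P_def algebra_simps)
  qed
  moreover have "?Y a = 0" by (simp add: ya)
  ultimately show ?thesis using main unfolding S_def times_divide_eq_left mult_1 by linarith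
qed


text \<open>Everything is measured by \<open>T\<close>, the integral of \<open>F^2\<close> plus
  boundary terms of weight \<open>lam^3/l\<close>. The first step divided by \<open>l\<close> gives
  \<open>J/l <= (1+K1)*T\<close>; this bounds \<open>lam*l*r^2\<close> through \<open>A\<close> and
  \<open>S^2/l\<close> through \<open>S\<close>. The second step then gives
  \<open>lam^3*y^2\<close>, and the third gives \<open>lam*mu*y^2\<close>. The constants
  \<open>c0\<close> and \<open>c1\<close> record how the second step consumes the first.\<close>

lemma carleman_conjugated:
  fixes a b lam l mu :: real
  assumes ab: "0 < a" "a < b" and l: "l \<ge> 1" "lam = l^2" "1 \<le> 4*a^2*lam" and mu: "mu \<ge> 0"
    and y: "AC_density a b y r" and r: "AC_density a b r s"
    and s2: "set_integrable lborel {a..b} (\<lambda>t. (s t)\<^sup>2)" and ya: "y a = 0"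
    and K: "K1 = 48*b^3 + 16*b + 4" "c0 = 2*b^2/a^2"
      "c1 = c0 * (1/(16*a^2) + (1/a^2 + 1/(4*b))/(8*a^2)*(1+K1) + 1/(8*b) + 1)"
  shows "2*lam * (LINT t:{a..b}|lborel. (r t)\<^sup>2) + (8*b^2+1)*lam^3 * (LINT t:{a..b}|lborel. (y t)\<^sup>2)
       + lam*mu * (LINT t:{a..b}|lborel. (y t)\<^sup>2)
     \<le> ((1+K1)/(4*a^2) + (12*b^2+2) * c1 + (1+K1) + 2*b + 1)
       * ((LINT t:{a..b}|lborel. (s t - 4*lam*t*r t + (4*lam^2*t^2 - mu - 2*lam) * y t)\<^sup>2)
         + lam^3/l * ((y b)\<^sup>2 + (r b - 2*lam*b*y b)\<^sup>2))"
proof -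
  define IS where "IS = (LINT t:{a..b}|lborel. (s t + (4*lam^2*t^2 - mu) * y t)\<^sup>2)"
  define IA where "IA = (LINT t:{a..b}|lborel. (4*lam*t*r t + 2*lam*y t)\<^sup>2)"
  define IF where "IF = (LINT t:{a..b}|lborel. (s t - 4*lam*t*r t + (4*lam^2*t^2 - mu - 2*lam) * y t)\<^sup>2)"
  define Z where "Z = (LINT t:{a..b}|lborel. (y t)\<^sup>2)"
  define R where "R = (LINT t:{a..b}|lborel. (r t)\<^sup>2)"
  define W where "W = (y b)\<^sup>2 + (r b - 2*lam*b*y b)\<^sup>2"
  define J where "J = IS + IA + 32*lam^3*a^2*Z"
  define T where "T = IF + lam^3/l*W"
  have lam: "lam \<ge> 1" using l by (simp add: one_le_power)
  have b: "b > 0" using ab by simp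
  have nn: "IS \<ge> 0" "IA \<ge> 0" "IF \<ge> 0" "Z \<ge> 0" "R \<ge> 0" "W \<ge> 0"
    unfolding IS_def IA_def IF_def Z_def R_def W_def by (auto simp: set_lebesgue_integral_def)
  have K1: "K1 \<ge> 0" "c0 > 0" using ab by (auto simp: K)
  have c1: "c1 \<ge> 0" using K1 ab by (auto simp: K(3))
  have 1: "J \<le> IF + K1 * lam^3 * W"
    using carleman_step1[OF ab lam mu y r s2 ya] unfolding J_def IS_def IA_def IF_def Z_def W_def K by simp
  have T: "T \<ge> 0" "IF \<le> T" "lam^3/l*W \<le> T" using nn lam l(1) by (auto simp: T_def)
  have Jl: "J/l \<le> (1+K1)*T"
  proof -
    have "J/l \<le> (IF + K1 * lam^3 * W)/l" using 1 l(1) by (intro divide_right_mono) auto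
    also have "\<dots> \<le> IF + K1 * (lam^3/l*W)"
    proof -
      have "IF/l \<le> IF/1" using nn l(1) by (intro divide_left_mono) auto
      then show ?thesis by (simp add: add_divide_distrib)
    qed
    also have "\<dots> \<le> T + K1 * T" using T K1 by (intro add_mono mult_left_mono) auto
    finally show ?thesis by (simp add: algebra_simps)
  qed
  have lR: "lam*l*R \<le> (1+K1)/(8*a^2)*T"
  proof -
    have cy: "continuous_on {a..b} y" and cr: "continuous_on {a..b} r"
      using y r by (auto intro: AC_density_continuous)
    have "(LINT t:{a..b}|lborel. (16*a^2*lam^2)*(r t)\<^sup>2)
        \<le> (LINT t:{a..b}|lborel. 2*(4*lam*t*r t + 2*lam*y t)\<^sup>2 + (8*lam^2)*(y t)\<^sup>2)"
    proof (rule set_integral_mono)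
      fix t assume t: "t \<in> {a..b}"
      have "(16*a^2*lam^2)*(r t)\<^sup>2 \<le> (16*t^2*lam^2)*(r t)\<^sup>2"
        using t ab by (intro mult_right_mono mult_left_mono power_mono) auto
      also have "\<dots> = ((4*lam*t*r t + 2*lam*y t) - 2*lam*y t)^2" by (simp add: power_mult_distrib)
      also have "\<dots> \<le> 2*(4*lam*t*r t + 2*lam*y t)\<^sup>2 + 2*(2*lam*y t)^2"
      proof -
        have "(u - w)^2 \<le> 2*u^2 + 2*w^2" for u w :: real
          using sum_squares_bound[of u "-w"] by (simp add: power2_diff)
        then show ?thesis .
      qed
      finally show "(16*a^2*lam^2)*(r t)\<^sup>2 \<le> 2*(4*lam*t*r t + 2*lam*y t)\<^sup>2 + (8*lam^2)*(y t)\<^sup>2"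
        by (simp add: power_mult_distrib)
    qed (intro set_integrable_continuous continuous_intros cy cr)+
    also have "\<dots> = (LINT t:{a..b}|lborel. 2*(4*lam*t*r t + 2*lam*y t)\<^sup>2) + (LINT t:{a..b}|lborel. (8*lam^2)*(y t)\<^sup>2)"
      by (intro set_integral_add(2) set_integrable_continuous continuous_intros cy cr)
    finally have "16*a^2*lam^2*R \<le> 2*IA + 8*lam^2*Z"
      unfolding set_integral_mult_right R_def IA_def Z_def .
    \<comment> \<open>The undifferentiated part of \<open>A\<close> leaves
      \<open>8*lam^2*y^2\<close>; the condition \<open>1 <= 4*a^2*lam\<close> lets it be absorbed by
      the \<open>32*lam^3*a^2*y^2\<close> contained in \<open>J\<close>.\<close>
    also have "8*lam^2*Z \<le> 8*lam^2*Z*(4*a^2*lam)"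
      using mult_left_mono[OF l(3), of "8*lam^2*Z"] nn by simp
    also have "2*IA + 8*lam^2*Z*(4*a^2*lam) \<le> 2*J"
      proof -
        have "8*lam^2*Z*(4*a^2*lam) = 32*lam^3*a^2*Z" by (simp add: power2_eq_square power3_eq_cube)
        moreover have "0 \<le> 32*lam^3*a^2*Z" using nn lam by simp
        moreover have "2*IA + x \<le> 2*(IS + IA + x)" if "0 \<le> x" for x using nn that by simp
        ultimately show ?thesis unfolding J_def by metis
      qed
    finally have "8*a^2*(lam^2*R) \<le> J" by (simp add: ac_simps)
    then have "lam^2*R \<le> J/(8*a^2)" using ab by (simp add: field_simps)
    moreover have "lam*l*R*l = lam^2*R" using l(2) by (simp add: power2_eq_square)
    ultimately have "lam*l*R*l \<le> J/(8*a^2)" by metis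
    then have "lam*l*R \<le> (J/(8*a^2))/l"
      by (rule mult_imp_le_div_pos[OF less_le_trans[OF zero_less_one l(1)]])
    also have "\<dots> = (J/l)/(8*a^2)" by (simp add: mult.commute)
    also have "\<dots> \<le> ((1+K1)*T)/(8*a^2)" using Jl by (intro divide_right_mono) auto
    finally show ?thesis by simp
  qed
  have R: "lam*R \<le> (1+K1)/(8*a^2)*T"
  proof -
    have "lam*R*1 \<le> lam*R*l" using nn lam l by (intro mult_left_mono) auto
    then show ?thesis using lR by (simp add: ac_simps)
  qed
  have l5: "lam^2*l = lam^3/l" using l by (simp add: field_simps power2_eq_square power3_eq_cube)
  have Z: "lam^3*Z \<le> c1*T"
  proof -
    have "a^2/b^2/2 * lam^3 * Z \<le> IF/(16*a^2) + (lam/a^2 + lam*l/(4*b)) * R + (1/(8*b) + 1) * (lam^2*l) * W"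
      using carleman_step2[OF ab l(1,2) y r s2 ya, of mu] unfolding Z_def IF_def R_def W_def by simp
    also have "\<dots> = IF/(16*a^2) + (1/a^2*(lam*R) + 1/(4*b)*(lam*l*R)) + (1/(8*b) + 1) * (lam^3/l * W)"
      unfolding l5 by (simp add: algebra_simps)
    also have "\<dots> \<le> T/(16*a^2) + (1/a^2*((1+K1)/(8*a^2)*T) + 1/(4*b)*((1+K1)/(8*a^2)*T)) + (1/(8*b) + 1) * T"
      using T R lR b by (intro add_mono divide_right_mono mult_left_mono) auto
    also have "\<dots> = (c1/c0)*T"
    proof -
      have "c1/c0 = 1/(16*a^2) + (1/a^2 + 1/(4*b))/(8*a^2)*(1+K1) + 1/(8*b) + 1"
        using K1(2) unfolding K(3) by simp
      then show ?thesis by (simp add: algebra_simps add_divide_distrib)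
    qed
    finally have "c0*(a^2/b^2/2 * lam^3 * Z) \<le> c0*((c1/c0)*T)" using K1(2) by (intro mult_left_mono) auto
    then show ?thesis using ab K1(2) unfolding K(2) by simp
  qed
  have S: "lam*mu*Z \<le> (4*b^2+1)*(c1*T) + (1+K1)*T + (2*b+1)*T"
  proof -
    have "lam * mu * Z \<le> (4*b^2 + 1) * (lam^3 * Z) + IS / l + (2*b + 1) * (lam^2 * W)"
      using carleman_step3[OF ab l(1,2) y r s2 ya, of mu] unfolding Z_def IS_def W_def by (simp only: mult.assoc)
    also have "\<dots> \<le> (4*b^2 + 1) * (c1*T) + (1+K1)*T + (2*b+1)*T"
    proof (intro add_mono mult_left_mono)
      have "IS \<le> J" using nn lam ab unfolding J_def by simp
      then show "IS/l \<le> (1+K1)*T" using Jl l(1) divide_right_mono[of IS J l] by simp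
      have "lam^2*W*1 \<le> lam^2*W*l" using nn l by (intro mult_left_mono) auto
      then have "lam^2*W \<le> lam^3/l*W" unfolding l5[symmetric] by (simp add: ac_simps)
      then show "lam^2*W \<le> T" using T by simp
    qed (use Z b in auto)
    finally show ?thesis .
  qed
  have "2*lam*R + (8*b^2+1)*lam^3*Z + lam*mu*Z
      \<le> 2*((1+K1)/(8*a^2)*T) + (8*b^2+1)*(c1*T) + ((4*b^2+1)*(c1*T) + (1+K1)*T + (2*b+1)*T)"
  proof (intro add_mono)
    show "(8*b^2+1)*lam^3*Z \<le> (8*b^2+1)*(c1*T)" using mult_left_mono[OF Z, of "8*b^2+1"] by (simp add: mult.assoc)
    show "2*lam*R \<le> 2*((1+K1)/(8*a^2)*T)" using mult_left_mono[OF R, of 2] by (simp only: mult.assoc)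
  qed (rule S)
  also have "\<dots> = ((1+K1)/(4*a^2) + (12*b^2+2) * c1 + (1+K1) + 2*b + 1) * T"
    by (simp add: algebra_simps add_divide_distrib)
  finally show ?thesis unfolding T_def R_def Z_def IF_def W_def .
qed

text \<open>The conjugation is undone here and the constants are balanced. The preceding estimate
  gives the constant \<open>1/K\<close> in front of the bulk and \<open>lam^3/l\<close> in front of
  the boundary; \<open>C = 1/K\<close> works for both as soon as \<open>l >= K\<close>.\<close>

lemma carleman_1d:
  fixes a b :: real
  assumes ab: "0 < a" "a < b"
  shows "\<exists>C>0. \<exists>lam0>1. \<forall>lam\<ge>lam0. \<forall>mu\<ge>0. \<forall>v p q.
     AC_density a b v p \<longrightarrow> AC_density a b p q \<longrightarrow> set_integrable lborel {a..b} (\<lambda>t. (q t)\<^sup>2) \<longrightarrow> v a = 0 \<longrightarrow>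
     C * (LINT t:{a..b}|lborel. (lam * ((p t)\<^sup>2 + mu * (v t)\<^sup>2) + lam^3 * (v t)\<^sup>2) * exp (2*lam*t^2))
     \<le> (LINT t:{a..b}|lborel. (q t - mu * v t)\<^sup>2 * exp (2*lam*t^2))
       + C * lam^3 * ((v b)\<^sup>2 + (p b)\<^sup>2) * exp (2*lam*b^2)"
proof -
  define K1 where "K1 = 48*b^3 + 16*b + 4"
  define c0 where "c0 = 2*b^2/a^2"
  define c1 where "c1 = c0 * (1/(16*a^2) + (1/a^2 + 1/(4*b))/(8*a^2)*(1+K1) + 1/(8*b) + 1)"
  define K where "K = (1+K1)/(4*a^2) + (12*b^2+2) * c1 + (1+K1) + 2*b + 1"
  have b: "b > 0" using ab by simp
  have "K1 \<ge> 0" "c0 \<ge> 0" using b by (auto simp: K1_def c0_def)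
  then have "c1 \<ge> 0" using b by (simp add: c1_def)
  then have K: "K > 0" unfolding K_def using b \<open>K1 \<ge> 0\<close>
    by (intro add_nonneg_pos add_nonneg_nonneg mult_nonneg_nonneg divide_nonneg_nonneg) auto
  \<comment> \<open>\<open>K^2\<close> yields \<open>sqrt lam >= K\<close>, the summand
    \<open>1/(4*a^2)\<close> yields the absorption condition \<open>1 <= 4*a^2*lam\<close>, and 2
    keeps the threshold above one.\<close>
  define lam0 where "lam0 = 2 + K^2 + 1/(4*a^2)"
  have "lam0 > 1" unfolding lam0_def by (smt (verit) zero_le_power2 divide_nonneg_nonneg)
  have "(1/K) * (LINT t:{a..b}|lborel. (lam * ((p t)\<^sup>2 + mu * (v t)\<^sup>2) + lam^3 * (v t)\<^sup>2) * exp (2*lam*t^2))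
     \<le> (LINT t:{a..b}|lborel. (q t - mu * v t)\<^sup>2 * exp (2*lam*t^2))
       + (1/K) * lam^3 * ((v b)\<^sup>2 + (p b)\<^sup>2) * exp (2*lam*b^2)"
    if lam0: "lam \<ge> lam0" and mu: "mu \<ge> 0" and v: "AC_density a b v p" and p: "AC_density a b p q"
      and q2: "set_integrable lborel {a..b} (\<lambda>t. (q t)\<^sup>2)" and va: "v a = 0" for lam mu v p q
  proof -
    define l where "l = sqrt lam"
    have lamK: "lam \<ge> K^2" and lam1: "lam \<ge> 1" and lama: "lam \<ge> 1/(4*a^2)"
      using lam0 unfolding lam0_def by (smt (verit) zero_le_power2 divide_nonneg_nonneg)+
    have l: "l \<ge> 1" "lam = l^2" "1 \<le> 4*a^2*lam" "l \<ge> K"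
      using lam1 lama ab lamK K by (auto simp: l_def field_simps real_le_rsqrt)
    define E where "E t = exp (lam*t^2)" for t
    have E2: "(E t)^2 = exp (2*lam*t^2)" for t by (simp add: E_def flip: exp_double)
    define y where "y t = E t * v t" for t
    define r where "r t = E t * p t + 2*lam*t*E t * v t" for t
    define s where "s t = E t * q t + 4*lam*t*E t * p t + (2*lam + 4*lam^2*t^2) * E t * v t" for t
    have E: "AC_density a b E (\<lambda>t. 2*lam*t*E t)"
      unfolding E_def using ab by (intro AC_density_C1) (auto intro!: derivative_eq_intros continuous_intros)
    have E': "AC_density a b (\<lambda>t. 2*lam*t*E t) (\<lambda>t. (2*lam + 4*lam^2*t^2) * E t)"
      unfolding E_def using ab
      by (intro AC_density_C1) (auto intro!: derivative_eq_intros continuous_intros simp: algebra_simps power2_eq_square)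
    have y: "AC_density a b y r"
      using AC_density_mult[OF E v] by (simp add: y_def[abs_def] r_def[abs_def] algebra_simps)
    have r: "AC_density a b r s"
      using AC_density_add[OF AC_density_mult[OF E p] AC_density_mult[OF E' v]]
      by (simp add: r_def[abs_def] s_def[abs_def] algebra_simps)
    note cv = AC_density_continuous[OF v] and cp = AC_density_continuous[OF p] and cE = AC_density_continuous[OF E]
    have q: "set_integrable lborel {a..b} q" by (rule AC_density_integrable[OF p])
    have s2: "set_integrable lborel {a..b} (\<lambda>t. (s t)\<^sup>2)"
    proof -
      have "set_integrable lborel {a..b} (\<lambda>t. (E t)^2 * (q t + (4*lam*t*p t + (2*lam + 4*lam^2*t^2) * v t))^2)"
        by (intro set_integrable_continuous_mult set_integrable_square_add q q2 continuous_intros cp cv cE)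
      then show ?thesis by (simp add: s_def algebra_simps flip: power_mult_distrib)
    qed
    have ya: "y a = 0" using va by (simp add: y_def)
    have F: "s t - 4*lam*t*r t + (4*lam^2*t^2 - mu - 2*lam) * y t = E t * (q t - mu * v t)" for t
      by (simp add: s_def r_def y_def algebra_simps power2_eq_square)
    have P: "r t - 2*lam*t*y t = E t * p t" for t by (simp add: r_def y_def)
    have cy: "continuous_on {a..b} y" and cr: "continuous_on {a..b} r"
      using y r by (auto intro: AC_density_continuous)
    let ?R = "LINT t:{a..b}|lborel. (r t)\<^sup>2" and ?Z = "LINT t:{a..b}|lborel. (y t)\<^sup>2"
    let ?M = "LINT t:{a..b}|lborel. (lam * ((p t)\<^sup>2 + mu * (v t)\<^sup>2) + lam^3 * (v t)\<^sup>2) * exp (2*lam*t^2)"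
    let ?I = "LINT t:{a..b}|lborel. (q t - mu * v t)\<^sup>2 * exp (2*lam*t^2)"
    let ?W = "((v b)\<^sup>2 + (p b)\<^sup>2) * exp (2*lam*b^2)"
    have "?M \<le> (LINT t:{a..b}|lborel. (2*lam)*(r t)\<^sup>2 + ((8*b^2+1)*lam^3) * (y t)\<^sup>2 + (lam*mu) * (y t)\<^sup>2)"
    proof (rule set_integral_mono)
      show "set_integrable lborel {a..b} (\<lambda>t. (lam * ((p t)\<^sup>2 + mu * (v t)\<^sup>2) + lam^3 * (v t)\<^sup>2) * exp (2*lam*t^2))"
        by (intro set_integrable_continuous continuous_intros cv cp)
      show "set_integrable lborel {a..b} (\<lambda>t. (2*lam)*(r t)\<^sup>2 + ((8*b^2+1)*lam^3) * (y t)\<^sup>2 + (lam*mu) * (y t)\<^sup>2)"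
        by (intro set_integrable_continuous continuous_intros cy cr)
      fix t assume t: "t \<in> {a..b}"
      \<comment> \<open>Returning from \<open>r = y'\<close> to the derivative of \<open>v\<close>
        costs \<open>2*lam*t*y\<close>. Its square is of order \<open>lam^2*y^2\<close>, which
        explains the factor \<open>8*b^2+1\<close> of \<open>lam^3*y^2\<close> in the conjugated
        estimate.\<close>
      have "(E t * p t)^2 \<le> 2*(r t)^2 + 8*lam^2*b^2*(y t)^2"
      proof -
        have "(E t * p t)^2 \<le> 2*(r t)^2 + 2*(2*lam*t*y t)^2"
          using sum_squares_bound[of "r t" "-(2*lam*t*y t)"] unfolding P[symmetric] by (simp add: power2_diff)
        also have "2*(2*lam*t*y t)^2 = 8*lam^2*t^2*(y t)^2" by (simp add: power_mult_distrib)
        also have "\<dots> \<le> 8*lam^2*b^2*(y t)^2"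
          using t ab by (intro mult_right_mono mult_left_mono power_mono) auto
        finally show ?thesis by simp
      qed
      then have "lam*(E t * p t)^2 \<le> lam*(2*(r t)^2 + 8*lam^2*b^2*(y t)^2)"
        using lam1 by (intro mult_left_mono) auto
      moreover have "(lam * ((p t)\<^sup>2 + mu * (v t)\<^sup>2) + lam^3 * (v t)\<^sup>2) * exp (2*lam*t^2)
          = lam*(E t * p t)^2 + lam*mu*(y t)^2 + lam^3*(y t)^2"
        unfolding E2[symmetric] y_def by (simp add: power_mult_distrib algebra_simps)
      ultimately show "(lam * ((p t)\<^sup>2 + mu * (v t)\<^sup>2) + lam^3 * (v t)\<^sup>2) * exp (2*lam*t^2)
          \<le> (2*lam)*(r t)\<^sup>2 + ((8*b^2+1)*lam^3) * (y t)\<^sup>2 + (lam*mu) * (y t)\<^sup>2"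
        by (simp add: algebra_simps power2_eq_square power3_eq_cube)
    qed
    also have "\<dots> = 2*lam*?R + (8*b^2+1)*lam^3*?Z + lam*mu*?Z"
    proof -
      have i: "set_integrable lborel {a..b} (\<lambda>t. c * (y t)\<^sup>2)" "set_integrable lborel {a..b} (\<lambda>t. c * (r t)\<^sup>2)" for c
        by (intro set_integrable_continuous continuous_intros cy cr)+
      show ?thesis
        unfolding set_integral_add(2)[OF set_integral_add(1)[OF i(2) i(1)] i(1)] set_integral_add(2)[OF i(2) i(1)]
          set_integral_mult_right ..
    qed
    also have "\<dots> \<le> K * (?I + lam^3/l * ?W)"
      using carleman_conjugated[OF ab l(1-3) mu y r s2 ya K1_def c0_def c1_def]
      unfolding F P K_def[symmetric] unfolding y_def power_mult_distrib E2
      by (simp only: mult.commute[of "exp _"] distrib_right[symmetric])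
    finally have "?M \<le> K * (?I + lam^3/l * ?W)" .
    then have "(1/K) * ?M \<le> ?I + lam^3/l * ?W" using K by (simp add: field_simps)
    \<comment> \<open>The gain of half a power is spent here: \<open>l >= K\<close> turns the
      boundary coefficient into the constant of the bulk term.\<close>
    also have "lam^3/l * ?W \<le> (1/K) * lam^3 * ?W"
    proof (rule mult_right_mono)
      show "lam^3/l \<le> 1/K*lam^3" using K l lam1 by (simp add: frac_le)
    qed simp
    finally show ?thesis by (simp add: mult.assoc)
  qed
  with K \<open>lam0 > 1\<close> show ?thesis
    by (intro exI[of _ "1/K"] conjI exI[of _ lam0]) auto
qed

subsection \<open>Smooth cutoffs and the fundamental lemmas\<close>

text \<open>The cubic Hermite polynomial between two constants. Test functions are required to be
  only continuously differentiable, so this explicit choice is smooth enough.\<close>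

definition smoothstep :: "real \<Rightarrow> real" where
  "smoothstep t = (if t \<le> 0 then 0 else if t \<ge> 1 then 1 else 3*t^2 - 2*t^3)"

text \<open>Clamping the argument instead of distinguishing cases makes continuity and the bound 2
  immediate.\<close>

definition smoothstep' :: "real \<Rightarrow> real" where
  "smoothstep' t = 6 * (max 0 (min 1 t)) * (1 - max 0 (min 1 t))"

lemma smoothstep_alt: "smoothstep t = 3 * (max 0 (min 1 t))^2 - 2 * (max 0 (min 1 t))^3"
  by (auto simp: smoothstep_def)

lemma smoothstep_0: "t \<le> 0 \<Longrightarrow> smoothstep t = 0" and smoothstep_1: "t \<ge> 1 \<Longrightarrow> smoothstep t = 1"
  by (auto simp: smoothstep_def)

lemma smoothstep'_eq_0: "t \<le> 0 \<or> t \<ge> 1 \<Longrightarrow> smoothstep' t = 0"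
  by (auto simp: smoothstep'_def)

lemma smoothstep_bounds: "0 \<le> smoothstep t" "smoothstep t \<le> 1"
proof -
  define x where "x = max 0 (min 1 t)"
  have x: "0 \<le> x" "x \<le> 1" by (auto simp: x_def)
  have e: "smoothstep t = x^2 * (1 + 2*(1-x))" "1 - smoothstep t = (1-x)^2 * (1 + 2*x)"
    unfolding smoothstep_alt x_def[symmetric] by (simp_all add: algebra_simps power2_eq_square power3_eq_cube)
  show "0 \<le> smoothstep t" unfolding e(1) using x by simp
  have "0 \<le> 1 - smoothstep t" unfolding e(2) using x by simp
  then show "smoothstep t \<le> 1" by simp
qed

lemma smoothstep'_bound: "\<bar>smoothstep' t\<bar> \<le> 2"
proof -
  define x where "x = max 0 (min 1 t)"
  have x: "0 \<le> x" "x \<le> 1" by (auto simp: x_def)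
  have "4 * (x*(1-x)) \<le> 1" using zero_le_power2[of "2*x-1"] by (simp add: algebra_simps power2_eq_square)
  then show ?thesis unfolding smoothstep'_def x_def[symmetric] using x by (simp add: abs_mult)
qed

lemma continuous_on_smoothstep' [continuous_intros]:
  "continuous_on A f \<Longrightarrow> continuous_on A (\<lambda>x. smoothstep' (f x))"
  unfolding smoothstep'_def[abs_def] by (intro continuous_intros)

lemma DERIV_smoothstep: "(smoothstep has_real_derivative smoothstep' t) (at t)"
proof -
  let ?p = "\<lambda>t::real. 3*t^2 - 2*t^3" and ?p' = "\<lambda>t::real. 6*t*(1-t)"
  have p: "(?p has_real_derivative ?p' t) (at t)" for t
    by (auto intro!: derivative_eq_intros simp: algebra_simps power2_eq_square)
  \<comment> \<open>Applied at 0 and at 1, where value and slope of the cubic agree with those of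
    the constants.\<close>
  have glue: "((\<lambda>t. if t \<le> c then f t else g t) has_real_derivative (if t \<le> c then f' t else g' t)) (at t)"
    if "\<And>t. (f has_real_derivative f' t) (at t)" "\<And>t. (g has_real_derivative g' t) (at t)" "f c = g c" "f' c = g' c"
    for f g f' g' :: "real \<Rightarrow> real" and c t
  proof -
    have "((\<lambda>t. if t \<in> {..c} then f t else g t) has_derivative (if t \<in> {..c} then (*) (f' t) else (*) (g' t)))
        (at t within {..c} \<union> {c..})"
    proof (rule has_derivative_If_within_closures)
      show "(f has_derivative (*) (f' t)) (at t within {..c} \<union> closure {..c} \<inter> closure {c..})"
        using that(1)[of t] by (auto simp: has_field_derivative_def intro: has_derivative_at_withinI)
      show "(g has_derivative (*) (g' t)) (at t within {c..} \<union> closure {..c} \<inter> closure {c..})"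
        using that(2)[of t] by (auto simp: has_field_derivative_def intro: has_derivative_at_withinI)
    qed (use that in auto)
    moreover have "{..c} \<union> {c..} = (UNIV :: real set)" by auto
    ultimately show ?thesis unfolding has_field_derivative_def by (auto simp: if_distrib)
  qed
  have "((\<lambda>t. if t \<le> 0 then 0 else if t \<le> 1 then ?p t else 1) has_real_derivative
      (if t \<le> 0 then 0 else if t \<le> 1 then ?p' t else 0)) (at t)"
    by (intro glue[where f="\<lambda>_. 0" and f'="\<lambda>_. 0" and g="\<lambda>t. if t \<le> 1 then ?p t else 1"
          and g'="\<lambda>t. if t \<le> 1 then ?p' t else 0"]
        glue[where f="?p" and f'="?p'" and g="\<lambda>_. 1" and g'="\<lambda>_. 0"] p) auto
  moreover have "(\<lambda>t. if t \<le> 0 then 0 else if t \<le> 1 then ?p t else 1) = smoothstep"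
    by (auto simp: smoothstep_def fun_eq_iff)
  moreover have "(if t \<le> 0 then 0 else if t \<le> 1 then ?p' t else 0) = smoothstep' t"
    by (auto simp: smoothstep'_def)
  ultimately show ?thesis by simp
qed

lemma continuous_on_smoothstep [continuous_intros]:
  "continuous_on A f \<Longrightarrow> continuous_on A (\<lambda>x. smoothstep (f x))"
  unfolding smoothstep_alt by (intro continuous_intros)

section \<open>Test functions and fundamental lemmas on an interval\<close>

lemma ex_antiderivative:
  fixes \<theta> :: "real \<Rightarrow> real"
  assumes "continuous_on UNIV \<theta>"
  obtains \<Theta> where "\<And>x. (\<Theta> has_real_derivative \<theta> x) (at x)"
proof -
  have "\<exists>F. \<forall>x. (-\<infinity>::ereal) < ereal x \<longrightarrow> ereal x < \<infinity> \<longrightarrow> (F has_vector_derivative \<theta> x) (at x)"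
    by (rule einterval_antiderivative) (use assms in \<open>auto simp: continuous_on_eq_continuous_at\<close>)
  then show ?thesis using that by (auto simp: has_real_derivative_iff_has_vector_derivative)
qed

text \<open>A Lebesgue measurable function is almost everywhere a limit of continuous ones; clamping
  these to \<open>[-M, M]\<close> keeps the bound and leaves the limit unchanged. The uniform bound
  is what dominated convergence needs later.\<close>

lemma bounded_measurable_approx:
  fixes f :: "'a::euclidean_space \<Rightarrow> real"
  assumes f: "f \<in> borel_measurable lborel" and M: "\<And>x. \<bar>f x\<bar> \<le> M"
  obtains g where "\<And>n. continuous_on UNIV (g n)" "\<And>n x. \<bar>g n x\<bar> \<le> M"
    "AE x in lborel. (\<lambda>n::nat. g n x) \<longlonglongrightarrow> f x"
proof -
  have "f \<in> borel_measurable lebesgue" using f by (rule measurable_completion)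
  then have "f measurable_on UNIV" by (rule lebesgue_measurable_imp_measurable_on) simp
  then obtain N g where N: "negligible N" and c: "\<And>n::nat. continuous_on UNIV (g n)"
    and l: "\<And>x. x \<notin> N \<Longrightarrow> (\<lambda>n. g n x) \<longlonglongrightarrow> f x"
    unfolding measurable_on_def by auto
  have "AE x in lebesgue. x \<notin> N" using N unfolding eventually_ae_filter_negligible by auto
  then have N': "AE x in lborel. x \<notin> N" by (simp add: AE_completion_iff)
  have M0: "M \<ge> 0" using M[of undefined] by linarith
  show ?thesis
  proof
    show "continuous_on UNIV (\<lambda>x. max (-M) (min M (g n x)))" for n by (intro continuous_intros c)
    show "\<bar>max (-M) (min M (g n x))\<bar> \<le> M" for n x using M0 by (auto simp: abs_le_iff)
    show "AE x in lborel. (\<lambda>n. max (-M) (min M (g n x))) \<longlonglongrightarrow> f x"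
      using N'
    proof eventually_elim
      case (elim x)
      have "(\<lambda>n. max (-M) (min M (g n x))) \<longlonglongrightarrow> max (-M) (min M (f x))"
        by (intro tendsto_intros l elim)
      moreover have "max (-M) (min M (f x)) = f x" using M[of x] by (auto simp: abs_le_iff)
      ultimately show ?case by simp
    qed
  qed
qed

text \<open>The margin \<open>\<delta>\<close> expresses compact support in the open interval, and
  the derivative is an argument so that it never has to be recovered from
  \<open>\<psi>\<close>.\<close>

definition C1_test :: "real \<Rightarrow> real \<Rightarrow> (real \<Rightarrow> real) \<Rightarrow> (real \<Rightarrow> real) \<Rightarrow> bool" where
  "C1_test a b \<psi> \<psi>' \<longleftrightarrow> (\<forall>x. (\<psi> has_real_derivative \<psi>' x) (at x)) \<and> continuous_on UNIV \<psi>'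
     \<and> (\<exists>\<delta>>0. \<forall>x. x \<notin> {a+\<delta>..b-\<delta>} \<longrightarrow> \<psi> x = 0)"

text \<open>The ideal test function is \<open>sgn h\<close>. Bounded continuous functions converging
  to it almost everywhere, times cutoffs, are admissible, and dominated convergence turns the
  hypothesis into a vanishing integral of \<open>\<bar>h\<bar>\<close>.\<close>

lemma fundamental_lemma_continuous:
  fixes h :: "real \<Rightarrow> real"
  assumes h: "set_integrable lborel {a..b} h"
    and H: "\<And>\<theta> \<delta>. continuous_on UNIV \<theta> \<Longrightarrow> \<delta> > 0 \<Longrightarrow> (\<And>x. x \<notin> {a+\<delta>..b-\<delta>} \<Longrightarrow> \<theta> x = 0)
      \<Longrightarrow> (LINT t:{a..b}|lborel. h t * \<theta> t) = 0"
  shows "AE x in lborel. x \<in> {a..b} \<longrightarrow> h x = 0"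
proof -
  define h' where "h' x = indicator {a..b} x * h x" for x
  have h': "integrable lborel h'" using h unfolding h'_def set_integrable_def by simp
  have [measurable]: "h' \<in> borel_measurable borel" using h' by auto
  obtain g where g: "\<And>n. continuous_on UNIV (g n)" "\<And>n x. \<bar>g n x\<bar> \<le> 1"
    "AE x in lborel. (\<lambda>n::nat. g n x) \<longlonglongrightarrow> sgn (h' x)"
    by (rule bounded_measurable_approx[of "\<lambda>x. sgn (h' x)" 1]) (auto simp: sgn_if)
  \<comment> \<open>The shift by one makes \<open>\<zeta> n\<close> vanish up to distance
    \<open>1/n\<close> from the endpoints, which supplies the margin demanded by
    \<open>H\<close>.\<close>
  define \<zeta> where "\<zeta> n x = max 0 (min 1 (real n * min (x - a) (b - x) - 1))" for n x
  have \<zeta>: "\<bar>\<zeta> n x\<bar> \<le> 1" for n x by (auto simp: \<zeta>_def)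
  have \<zeta>1: "(\<lambda>n. \<zeta> n x) \<longlonglongrightarrow> 1" if "a < x" "x < b" for x
  proof (rule tendsto_eventually)
    have m: "0 < min (x-a) (b-x)" using that by simp
    obtain N :: nat where N: "2 / min (x-a) (b-x) \<le> real N" using real_arch_simple by blast
    have "\<zeta> n x = 1" if "n \<ge> N" for n
    proof -
      have "2 / min (x-a) (b-x) \<le> real n" using N that by (meson of_nat_le_iff order_trans)
      then have "2 \<le> real n * min (x-a) (b-x)" using m by (simp add: pos_divide_le_eq)
      then show ?thesis unfolding \<zeta>_def by auto
    qed
    then show "\<forall>\<^sub>F n in sequentially. \<zeta> n x = 1" by (auto simp: eventually_sequentially)
  qed
  have cchi: "continuous_on UNIV (\<zeta> n)" for n unfolding \<zeta>_def[abs_def] by (intro continuous_intros)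
  have [measurable]: "g n \<in> borel_measurable borel" "\<zeta> n \<in> borel_measurable borel" for n
    using g(1) cchi by (auto intro: borel_measurable_continuous_onI)
  have "(\<lambda>n. LINT x|lborel. h' x * (g n x * \<zeta> n x)) \<longlonglongrightarrow> (LINT x|lborel. \<bar>h' x\<bar>)"
  proof (rule integral_dominated_convergence[where w="\<lambda>x. \<bar>h' x\<bar>"])
    show "integrable lborel (\<lambda>x. \<bar>h' x\<bar>)" using h' by simp
    show "AE x in lborel. norm (h' x * (g n x * \<zeta> n x)) \<le> \<bar>h' x\<bar>" for n
    proof (rule AE_I2)
      fix x
      have "\<bar>g n x\<bar> * \<bar>\<zeta> n x\<bar> \<le> 1 * 1" using g(2) \<zeta> by (intro mult_mono) auto
      then have "\<bar>h' x\<bar> * (\<bar>g n x\<bar> * \<bar>\<zeta> n x\<bar>) \<le> \<bar>h' x\<bar> * 1" by (intro mult_left_mono) auto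
      then show "norm (h' x * (g n x * \<zeta> n x)) \<le> \<bar>h' x\<bar>" by (simp add: abs_mult)
    qed
    show "AE x in lborel. (\<lambda>n. h' x * (g n x * \<zeta> n x)) \<longlonglongrightarrow> \<bar>h' x\<bar>"
      using g(3) AE_lborel_singleton[of a] AE_lborel_singleton[of b]
    proof eventually_elim
      case (elim x)
      show ?case
      proof (cases "x \<in> {a..b}")
        case True
        then have "(\<lambda>n. h' x * (g n x * \<zeta> n x)) \<longlonglongrightarrow> h' x * (sgn (h' x) * 1)"
          using elim by (intro tendsto_intros \<zeta>1) auto
        then show ?thesis by (simp add: abs_sgn)
      qed (simp add: h'_def)
    qed
  qed auto
  moreover have "(LINT x|lborel. h' x * (g n x * \<zeta> n x)) = 0" for n
  proof (cases "n = 0")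
    case True
    then show ?thesis by (simp add: \<zeta>_def)
  next
    case False
    have "(LINT t:{a..b}|lborel. h t * (g n t * \<zeta> n t)) = 0"
    proof (rule H[of _ "1 / real n"])
      show "continuous_on UNIV (\<lambda>t. g n t * \<zeta> n t)" using g(1) cchi by (intro continuous_intros) auto
      show "1 / real n > 0" using False by simp
      fix x assume "x \<notin> {a + 1 / real n..b - 1 / real n}"
      then have "min (x - a) (b - x) \<le> 1 / real n" by auto
      then have "real n * min (x - a) (b - x) \<le> real n * (1 / real n)" by (rule mult_left_mono) simp
      then have "real n * min (x - a) (b - x) \<le> 1" using False by simp
      then have "\<zeta> n x = 0" unfolding \<zeta>_def by auto
      then show "g n x * \<zeta> n x = 0" by simp
    qed
    then show ?thesis by (simp add: set_lebesgue_integral_def h'_def mult.assoc)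
  qed
  ultimately have "(LINT x|lborel. \<bar>h' x\<bar>) = 0" by (simp add: LIMSEQ_const_iff)
  then have "AE x in lborel. \<bar>h' x\<bar> = 0" using integral_nonneg_eq_0_iff_AE[of lborel "\<lambda>x. \<bar>h' x\<bar>"] h' by simp
  then show ?thesis by eventually_elim (auto simp: h'_def)
qed

text \<open>The shift by one makes the function rise between the distances \<open>h\<close> and
  \<open>2*h\<close> from the endpoints. It vanishes near them, so compact support is kept, and its
  derivative is of size \<open>1/h\<close> and lives within distance \<open>2*h\<close>.\<close>

definition cutoff :: "real \<Rightarrow> real \<Rightarrow> real \<Rightarrow> real \<Rightarrow> real" where
  "cutoff a b h x = smoothstep ((x - a)/h - 1) * smoothstep ((b - x)/h - 1)"

definition cutoff' :: "real \<Rightarrow> real \<Rightarrow> real \<Rightarrow> real \<Rightarrow> real" where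
  "cutoff' a b h x = smoothstep' ((x - a)/h - 1) / h * smoothstep ((b - x)/h - 1)
     - smoothstep ((x - a)/h - 1) * (smoothstep' ((b - x)/h - 1) / h)"

lemma DERIV_cutoff: "h > 0 \<Longrightarrow> (cutoff a b h has_real_derivative cutoff' a b h x) (at x)"
  unfolding cutoff_def[abs_def] cutoff'_def
  by (auto intro!: derivative_eq_intros DERIV_chain2[OF DERIV_smoothstep, THEN DERIV_cong])

lemma continuous_on_cutoff': "h > 0 \<Longrightarrow> continuous_on A (cutoff' a b h)"
  unfolding cutoff'_def[abs_def] by (intro continuous_intros) auto

lemma cutoff_eq_0: "h > 0 \<Longrightarrow> x \<notin> {a+h..b-h} \<Longrightarrow> cutoff a b h x = 0"
proof -
  assume "h > 0" "x \<notin> {a+h..b-h}"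
  then have "(x - a)/h - 1 \<le> 0 \<or> (b - x)/h - 1 \<le> 0" by (auto simp: field_simps)
  then show ?thesis by (auto simp: cutoff_def smoothstep_0)
qed

lemma cutoff_eq_1: "h > 0 \<Longrightarrow> x \<in> {a+2*h..b-2*h} \<Longrightarrow> cutoff a b h x = 1"
  and cutoff'_eq_0: "h > 0 \<Longrightarrow> x \<in> {a+2*h..b-2*h} \<Longrightarrow> cutoff' a b h x = 0"
proof -
  assume "h > 0" "x \<in> {a+2*h..b-2*h}"
  then have "1 \<le> (x - a)/h - 1" "1 \<le> (b - x)/h - 1" by (auto simp: field_simps)
  then show "cutoff a b h x = 1" "cutoff' a b h x = 0"
    by (simp_all add: cutoff_def cutoff'_def smoothstep_1 smoothstep'_eq_0)
qed

lemma cutoff_bound: "\<bar>cutoff a b h x\<bar> \<le> 1"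
  unfolding cutoff_def abs_mult using smoothstep_bounds by (intro mult_le_one) auto

lemma cutoff'_bound:
  assumes "h > 0"
  shows "\<bar>cutoff' a b h x\<bar> \<le> 4 / h"
proof -
  have 1: "\<bar>smoothstep' s / h * smoothstep t\<bar> \<le> 2/h * 1" for s t
    unfolding abs_mult abs_divide using assms smoothstep_bounds[of t] smoothstep'_bound[of s]
    by (intro mult_mono) (auto intro: divide_right_mono)
  show ?thesis
    using 1[of "(x - a)/h - 1" "(b - x)/h - 1"] 1[of "(b - x)/h - 1" "(x - a)/h - 1"]
      abs_triangle_ineq4[of "smoothstep' ((x - a)/h - 1) / h * smoothstep ((b - x)/h - 1)"
        "smoothstep ((x - a)/h - 1) * (smoothstep' ((b - x)/h - 1) / h)"]
    unfolding cutoff'_def by (simp add: mult.commute)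
qed

lemma C1_test_cutoff: "h > 0 \<Longrightarrow> C1_test a b (cutoff a b h) (cutoff' a b h)"
  unfolding C1_test_def using DERIV_cutoff continuous_on_cutoff' cutoff_eq_0 by blast

text \<open>A continuous test function is uniformly close to a polynomial by Weierstrass, and a
  polynomial times a cutoff that equals one on the support is an admissible test function. The error
  is at most \<open>e\<close> times the integral of \<open>\<bar>h\<bar>\<close>.\<close>

lemma fundamental_lemma_C1:
  fixes h :: "real \<Rightarrow> real"
  assumes h: "set_integrable lborel {a..b} h"
    and H: "\<And>\<psi> \<psi>'. C1_test a b \<psi> \<psi>' \<Longrightarrow> (LINT t:{a..b}|lborel. h t * \<psi> t) = 0"
  shows "AE x in lborel. x \<in> {a..b} \<longrightarrow> h x = 0"
proof (rule fundamental_lemma_continuous[OF h])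
  fix \<theta> :: "real \<Rightarrow> real" and \<delta> :: real
  assume c: "continuous_on UNIV \<theta>" and \<delta>: "\<delta> > 0" and z: "\<And>x. x \<notin> {a+\<delta>..b-\<delta>} \<Longrightarrow> \<theta> x = 0"
  let ?N = "LINT t:{a..b}|lborel. \<bar>h t\<bar>"
  have N: "?N \<ge> 0" by (simp add: set_lebesgue_integral_def)
  \<comment> \<open>Half of \<open>\<delta>\<close>, since the cutoff reaches one only at twice its
    width.\<close>
  define \<zeta> where "\<zeta> = cutoff a b (\<delta>/2)"
  define \<zeta>' where "\<zeta>' = cutoff' a b (\<delta>/2)"
  have \<zeta>: "C1_test a b \<zeta> \<zeta>'" "\<And>x. x \<in> {a+\<delta>..b-\<delta>} \<Longrightarrow> \<zeta> x = 1" "\<And>x. \<bar>\<zeta> x\<bar> \<le> 1"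
    using \<delta> C1_test_cutoff[of "\<delta>/2" a b] cutoff_eq_1[of "\<delta>/2" _ a b] cutoff_bound
    by (auto simp: \<zeta>_def \<zeta>'_def)
  have d\<zeta>: "(\<zeta> has_real_derivative \<zeta>' x) (at x)" and c\<zeta>': "continuous_on UNIV \<zeta>'" for x
    using \<zeta>(1) by (auto simp: C1_test_def)
  have c\<zeta>: "continuous_on A \<zeta>" for A
    using d\<zeta> by (meson DERIV_isCont continuous_at_imp_continuous_on)
  have bound: "\<bar>LINT t:{a..b}|lborel. h t * \<theta> t\<bar> \<le> e * ?N" if e: "e > 0" for e
  proof -
    obtain P where P: "real_polynomial_function P" "\<And>x. x \<in> {a..b} \<Longrightarrow> \<bar>\<theta> x - P x\<bar> < e"
      using Stone_Weierstrass_real_polynomial_function[where S="{a..b}" and f=\<theta> and e=e]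
        continuous_on_subset[OF c subset_UNIV] e compact_Icc by metis
    obtain P' where P': "real_polynomial_function P'" "\<And>x. (P has_real_derivative P' x) (at x)"
      using has_real_derivative_polynomial_function[OF P(1)] by auto
    have cP: "continuous_on A P" "continuous_on A P'" for A
      using P(1) P'(1) by (auto simp: real_polynomial_function_eq continuous_on_polymonial_function)
    have "C1_test a b (\<lambda>x. \<zeta> x * P x) (\<lambda>x. \<zeta>' x * P x + \<zeta> x * P' x)"
      unfolding C1_test_def
    proof (intro conjI allI)
      show "((\<lambda>x. \<zeta> x * P x) has_real_derivative \<zeta>' x * P x + \<zeta> x * P' x) (at x)" for x
        by (auto intro!: derivative_eq_intros d\<zeta> P')
      show "continuous_on UNIV (\<lambda>x. \<zeta>' x * P x + \<zeta> x * P' x)"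
        by (intro continuous_intros c\<zeta> c\<zeta>' cP)
      show "\<exists>\<delta>>0. \<forall>x. x \<notin> {a + \<delta>..b - \<delta>} \<longrightarrow> \<zeta> x * P x = 0"
        using \<zeta>(1) unfolding C1_test_def by (metis mult_zero_left)
    qed
    from H[OF this] have 0: "(LINT t:{a..b}|lborel. h t * (\<zeta> t * P t)) = 0" .
    have i1: "set_integrable lborel {a..b} (\<lambda>t. h t * \<theta> t)"
      using set_integrable_continuous_mult[OF h continuous_on_subset[OF c]] by (simp add: mult.commute)
    have i2: "set_integrable lborel {a..b} (\<lambda>t. h t * (\<zeta> t * P t))"
      using set_integrable_continuous_mult[OF h continuous_on_mult[OF c\<zeta> cP(1)]] by (simp add: mult.commute)
    have "(LINT t:{a..b}|lborel. h t * \<theta> t) = (LINT t:{a..b}|lborel. h t * \<theta> t - h t * (\<zeta> t * P t))"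
      using set_integral_diff(2)[OF i1 i2] 0 by simp
    also have "\<bar>\<dots>\<bar> \<le> (LINT t:{a..b}|lborel. \<bar>h t * \<theta> t - h t * (\<zeta> t * P t)\<bar>)"
      using set_integral_norm_bound[OF set_integral_diff(1)[OF i1 i2]] by simp
    also have "\<dots> \<le> (LINT t:{a..b}|lborel. e * \<bar>h t\<bar>)"
    proof (rule set_integral_mono)
      show "set_integrable lborel {a..b} (\<lambda>t. \<bar>h t * \<theta> t - h t * (\<zeta> t * P t)\<bar>)"
        by (intro set_integrable_abs set_integral_diff i1 i2)
      show "set_integrable lborel {a..b} (\<lambda>t. e * \<bar>h t\<bar>)"
        by (intro set_integrable_mult_right set_integrable_abs h)
      fix t assume t: "t \<in> {a..b}"
      have "\<theta> t = \<zeta> t * \<theta> t" using \<zeta>(2)[of t] z[of t] by (cases "t \<in> {a+\<delta>..b-\<delta>}") auto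
      then have "h t * \<theta> t - h t * (\<zeta> t * P t) = h t * (\<zeta> t * (\<theta> t - P t))" by (auto simp: algebra_simps)
      also have "\<bar>\<dots>\<bar> = \<bar>h t\<bar> * (\<bar>\<zeta> t\<bar> * \<bar>\<theta> t - P t\<bar>)" by (simp add: abs_mult)
      also have "\<dots> \<le> \<bar>h t\<bar> * (1 * e)"
        using \<zeta>(3)[of t] P(2)[OF t] by (intro mult_left_mono mult_mono) auto
      finally show "\<bar>h t * \<theta> t - h t * (\<zeta> t * P t)\<bar> \<le> e * \<bar>h t\<bar>" by (simp add: mult.commute)
    qed
    finally show ?thesis by simp
  qed
  have "\<bar>LINT t:{a..b}|lborel. h t * \<theta> t\<bar> \<le> 0"
  proof (rule field_le_epsilon)
    fix e :: real assume e: "e > 0"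
    have "\<bar>LINT t:{a..b}|lborel. h t * \<theta> t\<bar> \<le> e/(?N+1) * ?N" using bound[of "e/(?N+1)"] e N by simp
    also have "\<dots> \<le> 0 + e" using e N by (simp add: field_simps)
    finally show "\<bar>LINT t:{a..b}|lborel. h t * \<theta> t\<bar> \<le> 0 + e" .
  qed
  then show "(LINT t:{a..b}|lborel. h t * \<theta> t) = 0" by simp
qed

lemma AC_density_test_parts:
  assumes ab: "a < b" and G: "AC_density a b G g" and \<psi>: "C1_test a b \<psi> \<psi>'"
  shows "(LINT t:{a..b}|lborel. G t * \<psi>' t) = - (LINT t:{a..b}|lborel. g t * \<psi> t)"
proof -
  have \<psi>AC: "AC_density a b \<psi> \<psi>'"
    by (rule AC_density_C1) (use ab \<psi> in \<open>auto simp: C1_test_def intro: continuous_on_subset\<close>)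
  have z: "\<psi> a = 0" "\<psi> b = 0" using \<psi> unfolding C1_test_def by force+
  have i1: "set_integrable lborel {a..b} (\<lambda>t. \<psi> t * g t)"
    by (intro set_integrable_continuous_mult AC_density_integrable[OF G] AC_density_continuous[OF \<psi>AC])
  have i2: "set_integrable lborel {a..b} (\<lambda>t. G t * \<psi>' t)"
    by (intro set_integrable_continuous_mult AC_density_integrable[OF \<psi>AC] AC_density_continuous[OF G])
  have "(LINT t:{a..b}|lborel. \<psi> t * g t + G t * \<psi>' t) = 0"
    using AC_density_eq[OF AC_density_mult[OF G \<psi>AC], of b] ab z by simp
  then show ?thesis unfolding set_integral_add(2)[OF i1 i2] by (simp add: mult.commute)
qed

text \<open>With \<open>G\<close> the indefinite integral of \<open>g\<close>, the difference
  \<open>D = f - G\<close> has weak derivative zero and must be a constant. The test functions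
  available are derivatives of admissible ones, that is, those of integral zero; an arbitrary
  \<open>\<theta>\<close> is reduced to this case by subtracting a multiple of a fixed bump.\<close>

lemma du_Bois_Reymond:
  fixes f g :: "real \<Rightarrow> real"
  assumes ab: "a < b" and f: "set_integrable lborel {a..b} f" and g: "set_integrable lborel {a..b} g"
    and H: "\<And>\<psi> \<psi>'. C1_test a b \<psi> \<psi>' \<Longrightarrow>
       (LINT t:{a..b}|lborel. f t * \<psi>' t) = - (LINT t:{a..b}|lborel. g t * \<psi> t)"
  obtains F where "AC_density a b F g" "AE x in lborel. x \<in> {a..b} \<longrightarrow> f x = F x"
proof -
  define G where "G z = 0 + (LINT t:{a..z}|lborel. g t)" for z
  have G: "AC_density a b G g" unfolding G_def by (rule AC_density_indefinite[OF g less_imp_le[OF ab]])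
  have iG: "set_integrable lborel {a..b} G" by (intro set_integrable_continuous AC_density_continuous[OF G])
  define D where "D t = f t - G t" for t
  have iD: "set_integrable lborel {a..b} D" unfolding D_def by (intro set_integral_diff f iG)
  have D0: "(LINT t:{a..b}|lborel. D t * \<psi>' t) = 0" if "C1_test a b \<psi> \<psi>'" for \<psi> \<psi>'
  proof -
    have c: "continuous_on {a..b} \<psi>'" using that by (auto simp: C1_test_def intro: continuous_on_subset)
    have i: "set_integrable lborel {a..b} (\<lambda>t. f t * \<psi>' t)" "set_integrable lborel {a..b} (\<lambda>t. G t * \<psi>' t)"
      using set_integrable_continuous_mult[OF f c] set_integrable_continuous_mult[OF iG c] by (simp_all add: mult.commute)
    have "(LINT t:{a..b}|lborel. D t * \<psi>' t) = (LINT t:{a..b}|lborel. f t * \<psi>' t - G t * \<psi>' t)"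
      by (simp add: D_def left_diff_distrib)
    then show ?thesis using H[OF that] AC_density_test_parts[OF ab G that] by (simp add: set_integral_diff(2)[OF i])
  qed
  define m where "m = (a+b)/2"
  define w where "w = (b-a)/4"
  have w: "w > 0" and mw: "a + w = m - w" "b - w = m + w" using ab by (auto simp: m_def w_def field_simps)
  \<comment> \<open>The bump is the derivative of a rescaled \<open>smoothstep\<close> that rises
    from 0 to 1 on the middle half of the interval, so its integral is one without
    computation.\<close>
  define \<theta>1 where "\<theta>1 x = smoothstep' ((x - m + w)/(2*w)) / (2*w)" for x
  have c1: "continuous_on A \<theta>1" for A unfolding \<theta>1_def[abs_def] using w
    by (intro continuous_intros) auto
  have z1: "\<theta>1 x = 0" if "x \<notin> {a+w..b-w}" for x
  proof -
    have "(x - m + w)/(2*w) \<le> 0 \<or> (x - m + w)/(2*w) \<ge> 1" using that w by (auto simp: mw divide_simps)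
    then show ?thesis unfolding \<theta>1_def by (simp add: smoothstep'_eq_0)
  qed
  have I1: "(LINT t:{a..b}|lborel. \<theta>1 t) = 1"
  proof -
    have "AC_density a b (\<lambda>x. smoothstep ((x - m + w)/(2*w))) \<theta>1"
    proof (rule AC_density_C1[OF less_imp_le[OF ab] _ c1])
      show "((\<lambda>x. smoothstep ((x - m + w)/(2*w))) has_real_derivative \<theta>1 x) (at x)" for x
        using w by (auto intro!: derivative_eq_intros DERIV_chain2[OF DERIV_smoothstep, THEN DERIV_cong] simp: \<theta>1_def)
    qed
    from AC_density_eq[OF this, of b]
    have "(LINT t:{a..b}|lborel. \<theta>1 t) = smoothstep ((b - m + w)/(2*w)) - smoothstep ((a - m + w)/(2*w))"
      using ab by simp
    moreover have "(b - m + w)/(2*w) \<ge> 1" "(a - m + w)/(2*w) \<le> 0" using w mw by (auto simp: field_simps)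
    ultimately show ?thesis by (simp add: smoothstep_0 smoothstep_1)
  qed
  \<comment> \<open>If \<open>D\<close> is constant, testing it with a bump of integral one returns
    that constant.\<close>
  define c where "c = (LINT t:{a..b}|lborel. D t * \<theta>1 t)"
  have "AE x in lborel. x \<in> {a..b} \<longrightarrow> D x - c = 0"
  proof (rule fundamental_lemma_continuous)
    show "set_integrable lborel {a..b} (\<lambda>x. D x - c)"
      by (intro set_integral_diff iD set_integrable_continuous continuous_intros)
    fix \<theta> :: "real \<Rightarrow> real" and \<delta> :: real
    assume c\<theta>: "continuous_on UNIV \<theta>" and \<delta>: "\<delta> > 0" and z: "\<And>x. x \<notin> {a+\<delta>..b-\<delta>} \<Longrightarrow> \<theta> x = 0"
    define k where "k = (LINT t:{a..b}|lborel. \<theta> t)"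
    define \<eta> where "\<eta> x = \<theta> x - k * \<theta>1 x" for x
    have c\<eta>: "continuous_on A \<eta>" for A unfolding \<eta>_def[abs_def]
      by (intro continuous_intros c1 continuous_on_subset[OF c\<theta>]) simp
    have i\<theta>: "set_integrable lborel {a..b} \<theta>" "set_integrable lborel {a..b} (\<lambda>x. k * \<theta>1 x)"
      by (intro set_integrable_continuous continuous_intros continuous_on_subset[OF c\<theta>] c1; simp)+
    have I\<eta>: "(LINT t:{a..b}|lborel. \<eta> t) = 0"
      unfolding \<eta>_def set_integral_diff(2)[OF i\<theta>] by (simp add: I1 k_def)
    \<comment> \<open>The antiderivative is constant near each end, and the two constants agree
      because \<open>\<eta>\<close> has integral zero. After subtraction of that constant it is an
      admissible test function.\<close>
    obtain \<Theta> where \<Theta>: "\<And>x. (\<Theta> has_real_derivative \<eta> x) (at x)" using ex_antiderivative[OF c\<eta>] by blast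
    define \<epsilon> where "\<epsilon> = min \<delta> w"
    have \<epsilon>: "\<epsilon> > 0" using \<delta> w by (simp add: \<epsilon>_def)
    have z\<eta>: "\<eta> x = 0" if "x \<notin> {a+\<epsilon>..b-\<epsilon>}" for x
    proof -
      have "x \<notin> {a+\<delta>..b-\<delta>}" "x \<notin> {a+w..b-w}" using that by (auto simp: \<epsilon>_def min_def split: if_splits)
      then show ?thesis using z z1 by (simp add: \<eta>_def)
    qed
    have l: "\<Theta> x = \<Theta> a" if "x < a + \<epsilon>" for x
    proof -
      have "\<exists>k. \<forall>x\<in>{..<a+\<epsilon>}. \<Theta> x = k"
      proof (rule has_field_derivative_zero_constant)
        fix x assume "x \<in> {..<a+\<epsilon>}"
        then have "\<eta> x = 0" by (intro z\<eta>) auto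
        then show "(\<Theta> has_real_derivative 0) (at x within {..<a+\<epsilon>})"
          using \<Theta>[of x] by (auto intro: has_field_derivative_at_within)
      qed auto
      then show ?thesis using that \<epsilon> by auto
    qed
    have r: "\<Theta> x = \<Theta> b" if "x > b - \<epsilon>" for x
    proof -
      have "\<exists>k. \<forall>x\<in>{b-\<epsilon><..}. \<Theta> x = k"
      proof (rule has_field_derivative_zero_constant)
        fix x assume "x \<in> {b-\<epsilon><..}"
        then have "\<eta> x = 0" by (intro z\<eta>) auto
        then show "(\<Theta> has_real_derivative 0) (at x within {b-\<epsilon><..})"
          using \<Theta>[of x] by (auto intro: has_field_derivative_at_within)
      qed auto
      then show ?thesis using that \<epsilon> by auto
    qed
    have "AC_density a b \<Theta> \<eta>" by (rule AC_density_C1) (use ab \<Theta> c\<eta> in auto)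
    from AC_density_eq[OF this, of b] have "\<Theta> b = \<Theta> a" using ab I\<eta> by simp
    then have "C1_test a b (\<lambda>x. \<Theta> x - \<Theta> a) \<eta>"
      unfolding C1_test_def
    proof (intro conjI allI exI[of _ \<epsilon>] impI)
      show "((\<lambda>x. \<Theta> x - \<Theta> a) has_real_derivative \<eta> x) (at x)" for x
        using DERIV_diff[OF \<Theta>[of x] DERIV_const[of "\<Theta> a"]] by simp
      show "continuous_on UNIV \<eta>" by (rule c\<eta>)
      show "\<epsilon> > 0" by (rule \<epsilon>)
      fix x assume "x \<notin> {a + \<epsilon>..b - \<epsilon>}"
      then consider "x < a + \<epsilon>" | "x > b - \<epsilon>" by fastforce
      then show "\<Theta> x - \<Theta> a = 0" using l[of x] r[of x] \<open>\<Theta> b = \<Theta> a\<close> by cases auto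
    qed
    from D0[OF this] have 0: "(LINT t:{a..b}|lborel. D t * \<eta> t) = 0" .
    have i: "set_integrable lborel {a..b} (\<lambda>t. D t * \<theta> t)" "set_integrable lborel {a..b} (\<lambda>t. k * (D t * \<theta>1 t))"
      "set_integrable lborel {a..b} (\<lambda>t. c * \<theta> t)"
      using set_integrable_continuous_mult[OF iD continuous_on_subset[OF c\<theta>]]
        set_integrable_continuous_mult[OF iD c1] i\<theta>(1)
      by (auto simp: mult.commute intro!: set_integrable_mult_right)
    have "(LINT t:{a..b}|lborel. D t * \<eta> t) = (LINT t:{a..b}|lborel. D t * \<theta> t - k * (D t * \<theta>1 t))"
      by (simp add: \<eta>_def algebra_simps)
    also have "\<dots> = (LINT t:{a..b}|lborel. D t * \<theta> t) - k * c"
      unfolding set_integral_diff(2)[OF i(1,2)] c_def by simp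
    also have "\<dots> = (LINT t:{a..b}|lborel. D t * \<theta> t) - (LINT t:{a..b}|lborel. c * \<theta> t)"
      by (simp add: k_def)
    also have "\<dots> = (LINT t:{a..b}|lborel. (D t - c) * \<theta> t)"
      unfolding set_integral_diff(2)[OF i(1,3), symmetric] by (simp add: left_diff_distrib)
    finally show "(LINT t:{a..b}|lborel. (D t - c) * \<theta> t) = 0" using 0 by simp
  qed
  then have "AE x in lborel. x \<in> {a..b} \<longrightarrow> f x = c + G x"
    by eventually_elim (auto simp: D_def)
  moreover have "AC_density a b (\<lambda>x. c + G x) g"
    using G by (simp add: AC_density_def)
  ultimately show ?thesis using that by blast
qed

subsection \<open>Trigonometric systems on the cube\<close>

text \<open>\<open>lborel\<close> on \<open>real^'m\<close> is the image of a product measure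
  indexed by the basis vectors, and \<open>axis\<close> reindexes these by the coordinates. This
  reduces integrals of separable functions over the cube to one variable.\<close>

lemma lborel_vec_prod:
  fixes f :: "'m::finite \<Rightarrow> real \<Rightarrow> real"
  assumes f: "\<And>j. integrable lborel (f j)"
  shows "integrable lborel (\<lambda>x::real^'m. \<Prod>j\<in>UNIV. f j (x $ j))"
    and "(LINT x|(lborel :: (real^'m) measure). (\<Prod>j\<in>UNIV. f j (x $ j))) = (\<Prod>j\<in>UNIV. (LINT t|lborel. f j t))"
proof -
  interpret product_sigma_finite "\<lambda>_::real^'m. lborel :: real measure" ..
  define ax where "ax j = (axis j 1 :: real^'m)" for j :: 'm
  have inj: "inj ax" by (auto simp: ax_def inj_on_def axis_eq_axis)
  have Basis: "Basis = range ax" by (auto simp: Basis_vec_def ax_def)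
  define F where "F b = f (inv ax b)" for b
  have inv[simp]: "inv ax (ax j) = j" for j using inj by simp
  have prodF: "(\<Prod>b\<in>Basis. G (inv ax b) (y b)) = (\<Prod>j\<in>UNIV. G j (y (ax j)))" for G :: "'m \<Rightarrow> real \<Rightarrow> real" and y
    unfolding Basis using inj by (simp add: prod.reindex)
  have [measurable]: "f j \<in> borel_measurable borel" for j using f[of j] by auto
  have coord: "(\<Sum>b\<in>Basis. y b *\<^sub>R b) $ j = y (ax j)" for y j
  proof -
    have "(\<Sum>b\<in>Basis. y b *\<^sub>R b) $ j = (\<Sum>b\<in>Basis. y b *\<^sub>R b) \<bullet> ax j"
      by (simp add: ax_def cart_eq_inner_axis)
    also have "\<dots> = y (ax j)" by (rule inner_sum_left_Basis) (simp add: Basis)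
    finally show ?thesis .
  qed
  have meas: "(\<lambda>x::real^'m. \<Prod>j\<in>UNIV. f j (x $ j)) \<in> borel_measurable borel"
    by measurable
  have L: "(lborel :: (real^'m) measure) = distr (\<Pi>\<^sub>M b\<in>Basis. lborel) borel (\<lambda>y. \<Sum>b\<in>Basis. y b *\<^sub>R b)"
    by (rule lborel_eq)
  have T: "(\<lambda>y. \<Sum>b\<in>Basis. y b *\<^sub>R (b::real^'m)) \<in> (\<Pi>\<^sub>M b\<in>Basis. lborel) \<rightarrow>\<^sub>M borel" by measurable
  have iP: "integrable (\<Pi>\<^sub>M b\<in>(Basis::(real^'m) set). lborel) (\<lambda>y. \<Prod>b\<in>Basis. f (inv ax b) (y b))"
    by (rule product_integrable_prod) (use f in auto)
  show "integrable lborel (\<lambda>x::real^'m. \<Prod>j\<in>UNIV. f j (x $ j))"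
    unfolding L using iP meas T by (simp add: integrable_distr_eq coord prodF del: sum_component)
  have "(LINT x|(lborel :: (real^'m) measure). (\<Prod>j\<in>UNIV. f j (x $ j)))
      = (LINT y|(\<Pi>\<^sub>M b\<in>(Basis::(real^'m) set). lborel). (\<Prod>b\<in>Basis. f (inv ax b) (y b)))"
    unfolding L using meas T by (simp add: integral_distr coord prodF del: sum_component)
  also have "\<dots> = (\<Prod>b\<in>(Basis::(real^'m) set). (LINT t|lborel. f (inv ax b) t))"
    by (rule product_integral_prod) (use f in auto)
  also have "\<dots> = (\<Prod>j\<in>UNIV. (LINT t|lborel. f j t))"
    unfolding Basis using inj by (simp add: prod.reindex)
  finally show "(LINT x|(lborel :: (real^'m) measure). (\<Prod>j\<in>UNIV. f j (x $ j))) = (\<Prod>j\<in>UNIV. (LINT t|lborel. f j t))" .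
qed

text \<open>The angle runs through \<open>[0, pi]\<close> on \<open>(-B, B)\<close>: the sines are
  the Dirichlet and the cosines the Neumann eigenfunctions of the interval.\<close>

definition trig :: "real \<Rightarrow> bool \<Rightarrow> nat \<Rightarrow> real \<Rightarrow> real" where
  "trig B s k t = (if s then sin else cos) (real k * (pi * (t + B) / (2 * B)))"

text \<open>\<open>S\<close> is the set of sine coordinates. \<open>S = UNIV\<close> gives the
  Dirichlet eigenfunctions of the cube; \<open>S = UNIV - {i}\<close> gives the system in which the
  derivative along \<open>i\<close> is expanded.\<close>

definition trig_prod :: "real \<Rightarrow> 'm::finite set \<Rightarrow> nat^'m \<Rightarrow> real^'m \<Rightarrow> real" where
  "trig_prod B S k x = (\<Prod>j\<in>UNIV. trig B (j \<in> S) (k $ j) (x $ j))"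

text \<open>The value is zero when a sine coordinate has frequency zero. Such indices are kept so
  that \<open>k\<close> ranges over a whole type; quotients by this norm are then zero by the
  convention \<open>x / 0 = 0\<close>.\<close>

definition trig_norm_sq :: "real \<Rightarrow> 'm::finite set \<Rightarrow> nat^'m \<Rightarrow> real" where
  "trig_norm_sq B S k = (\<Prod>j\<in>UNIV. (LINT t:{-B<..<B}|lborel. (trig B (j \<in> S) (k $ j) t)\<^sup>2))"

lemma trig_bound: "\<bar>trig B s k t\<bar> \<le> 1"
  by (auto simp: trig_def)

lemma trig_prod_bound: "\<bar>trig_prod B S k x\<bar> \<le> 1"
  unfolding trig_prod_def abs_prod by (intro prod_le_1) (auto simp: trig_bound)

lemma continuous_on_trig [continuous_intros]:
  fixes f :: "'a::t2_space \<Rightarrow> real"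
  shows "continuous_on A f \<Longrightarrow> continuous_on A (\<lambda>x. trig B s k (f x))"
proof -
  assume "continuous_on A f"
  then have c: "continuous_on A (\<lambda>x. real k * (pi * (f x + B) * inverse (2 * B)))"
    by (intro continuous_intros)
  show ?thesis
    using continuous_on_sin[OF c] continuous_on_cos[OF c] by (cases s) (simp_all only: trig_def divide_inverse if_True if_False)
qed

lemma continuous_on_trig_prod: "continuous_on A (trig_prod B S k)"
  unfolding trig_prod_def[abs_def] by (intro continuous_intros)

lemma measurable_trig_prod [measurable]: "trig_prod B S k \<in> borel_measurable borel"
  by (intro borel_measurable_continuous_onI continuous_on_trig_prod)

lemma measurable_trig [measurable]: "trig B s k \<in> borel_measurable borel"
  by (intro borel_measurable_continuous_onI continuous_intros)

text \<open>Product-to-sum formulas leave cosines of the integer frequencies \<open>k - l\<close>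
  and \<open>k + l\<close>, both nonzero for distinct naturals. Their antiderivatives are sines,
  which vanish at the angles 0 and \<open>pi\<close>.\<close>

lemma trig_orthogonal:
  assumes B: "B > 0" and kl: "k \<noteq> l"
  shows "(LINT t:{-B<..<B}|lborel. trig B s k t * trig B s l t) = 0"
proof -
  define \<theta> where "\<theta> t = pi * (t + B) / (2 * B)" for t
  have C: "AC_density (-B) B (\<lambda>t. sin (real_of_int n * \<theta> t) * (2*B/(pi * real_of_int n))) (\<lambda>t. cos (real_of_int n * \<theta> t))"
    if "n \<noteq> 0" for n :: int
    unfolding \<theta>_def using B that
    by (intro AC_density_C1) (auto intro!: derivative_eq_intros continuous_intros simp: field_simps)
  have zero: "(LINT t:{-B..B}|lborel. cos (real_of_int n * \<theta> t)) = 0" if "n \<noteq> 0" for n :: int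
  proof -
    have "\<theta> B = pi" "\<theta> (-B) = 0" using B by (auto simp: \<theta>_def)
    then show ?thesis using AC_density_eq[OF C[OF that], of B] B
      by (simp add: mult.commute[of _ pi] sin_npi_int)
  qed
  have i: "set_integrable lborel {-B..B} (\<lambda>t. c * cos (real_of_int n * \<theta> t))" for c n
    unfolding \<theta>_def by (intro set_integrable_continuous continuous_intros) (use B in auto)
  define \<sigma> where "\<sigma> = (if s then -1 else 1 :: real)"
  have "trig B s k t * trig B s l t = 1/2 * cos (real_of_int (int k - int l) * \<theta> t)
      + \<sigma>/2 * cos (real_of_int (int k + int l) * \<theta> t)" for t
    unfolding trig_def \<theta>_def[symmetric] \<sigma>_def
    by (auto simp: cos_times_cos sin_times_sin left_diff_distrib distrib_right field_simps)
  then have "(LINT t:{-B<..<B}|lborel. trig B s k t * trig B s l t)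
     = (LINT t:{-B<..<B}|lborel. 1/2 * cos (real_of_int (int k - int l) * \<theta> t)
        + \<sigma>/2 * cos (real_of_int (int k + int l) * \<theta> t))" by simp
  also have "\<dots> = (LINT t:{-B..B}|lborel. 1/2 * cos (real_of_int (int k - int l) * \<theta> t)
        + \<sigma>/2 * cos (real_of_int (int k + int l) * \<theta> t))"
    by (rule set_integral_discrete_difference[of "{-B, B}"]) auto
  also have "\<dots> = 0"
    unfolding set_integral_add(2)[OF i i] set_integral_mult_right
    using zero[of "int k - int l"] zero[of "int k + int l"] kl by simp
  finally show ?thesis .
qed

section \<open>Orthogonality and Bessel's inequality on the cube\<close>

lemma indicator_face: "indicator (face B) x = (\<Prod>j\<in>UNIV. indicator {-B<..<B} (x $ j) :: real)"
proof (cases "x \<in> face B")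
  case True
  then show ?thesis by (simp add: face_def)
next
  case False
  then obtain j where "x $ j \<notin> {-B<..<B}" by (auto simp: face_def)
  then have "(\<Prod>j\<in>UNIV. indicator {-B<..<B} (x $ j) :: real) = 0"
    by (intro prod_zero) (auto intro!: bexI[of _ j] exI[of _ j])
  then show ?thesis using False by simp
qed

lemma integrable_trig: "integrable lborel (\<lambda>t. indicator {-B<..<B} t * (trig B s k t * trig B s l t))"
proof -
  have "set_integrable lborel {-B..B} (\<lambda>t. trig B s k t * trig B s l t)"
    by (intro set_integrable_continuous continuous_intros)
  then have "set_integrable lborel {-B<..<B} (\<lambda>t. trig B s k t * trig B s l t)"
    by (rule set_integrable_subset) auto
  then show ?thesis by (simp add: set_integrable_def)
qed

lemma trig_prod_inner:
  fixes k l :: "nat^'m"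
  shows "integrable lborel (\<lambda>x::real^'m. indicator (face B) x * (trig_prod B S k x * trig_prod B S l x))"
    and "B > 0 \<Longrightarrow> (LINT x|lborel. indicator (face B) x * (trig_prod B S k x * trig_prod B S l x))
      = (if k = l then trig_norm_sq B S k else 0)"
proof -
  have e: "indicator (face B) x * (trig_prod B S k x * trig_prod B S l x)
      = (\<Prod>j\<in>UNIV. indicator {-B<..<B} (x $ j) * (trig B (j \<in> S) (k $ j) (x $ j) * trig B (j \<in> S) (l $ j) (x $ j)))"
    for x :: "real^'m" by (simp add: indicator_face trig_prod_def prod.distrib)
  show "integrable lborel (\<lambda>x::real^'m. indicator (face B) x * (trig_prod B S k x * trig_prod B S l x))"
    unfolding e by (rule lborel_vec_prod) (rule integrable_trig)
  assume B: "B > 0"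
  have "(LINT x|lborel. indicator (face B) x * (trig_prod B S k x * trig_prod B S l x))
    = (\<Prod>j\<in>UNIV. (LINT t|lborel. indicator {-B<..<B} t * (trig B (j \<in> S) (k $ j) t * trig B (j \<in> S) (l $ j) t)))"
    unfolding e by (rule lborel_vec_prod) (rule integrable_trig)
  also have "\<dots> = (if k = l then trig_norm_sq B S k else 0)"
  proof (cases "k = l")
    case True
    then show ?thesis by (simp add: trig_norm_sq_def set_lebesgue_integral_def power2_eq_square)
  next
    case False
    then obtain j where "k $ j \<noteq> l $ j" by (auto simp: vec_eq_iff)
    then show ?thesis using False trig_orthogonal[OF B, of "k $ j" "l $ j" "j \<in> S"]
      by (auto intro!: prod_zero bexI[of _ j] simp: set_lebesgue_integral_def)
  qed
  finally show "(LINT x|lborel. indicator (face B) x * (trig_prod B S k x * trig_prod B S l x))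
      = (if k = l then trig_norm_sq B S k else 0)" .
qed

lemma trig_norm_sq_nonneg: "trig_norm_sq B S k \<ge> 0"
  unfolding trig_norm_sq_def by (intro prod_nonneg) (simp add: set_lebesgue_integral_def)

text \<open>\<^term>\<open>face_L2 B f\<close> is the space \<open>L\<^sup>2\<close> of the open cube, its elements being extended by zero.\<close>
definition face_L2 :: "real \<Rightarrow> (real^'m \<Rightarrow> real) \<Rightarrow> bool" where
  "face_L2 B f \<longleftrightarrow> f \<in> borel_measurable lborel \<and> integrable lborel (\<lambda>x. (f x)\<^sup>2) \<and> (\<forall>x. x \<notin> face B \<longrightarrow> f x = 0)"

definition fcoef :: "real \<Rightarrow> 'm::finite set \<Rightarrow> nat^'m \<Rightarrow> (real^'m \<Rightarrow> real) \<Rightarrow> real" where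
  "fcoef B S k f = (LINT x|lborel. f x * trig_prod B S k x)"

lemma open_face: "open (face B :: (real^'m) set)"
proof -
  have "face B = (\<Inter>i\<in>UNIV. {x::real^'m. -B < x$i} \<inter> {x. x$i < B})" by (auto simp: face_def)
  then show ?thesis
    by (simp only:) (intro open_INT ballI open_Int open_Collect_less continuous_intros finite)
qed

lemma face_sets [measurable]: "face B \<in> sets borel"
  by (intro borel_open open_face)

lemma face_subset_cbox: "face B \<subseteq> cbox (vec (-B)) (vec B :: real^'m)"
  by (auto simp: face_def mem_box_cart less_imp_le)

lemma integrable_indicator_face: "integrable lborel (indicator (face B) :: real^'m \<Rightarrow> real)"
proof -
  have "emeasure lborel (face B :: (real^'m) set) \<le> emeasure lborel (cbox (vec (-B)) (vec B :: real^'m))"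
    by (rule emeasure_mono[OF face_subset_cbox]) simp
  also have "\<dots> < \<infinity>" using emeasure_lborel_cbox_finite by blast
  finally show ?thesis by (intro integrable_real_indicator) auto
qed

lemma integrable_mult_of_squares:
  fixes f g :: "'a \<Rightarrow> real"
  assumes [measurable]: "f \<in> borel_measurable M" "g \<in> borel_measurable M"
    and "integrable M (\<lambda>x. (f x)\<^sup>2)" "integrable M (\<lambda>x. (g x)\<^sup>2)"
  shows "integrable M (\<lambda>x. f x * g x)"
proof (rule Bochner_Integration.integrable_bound)
  show "integrable M (\<lambda>x. (f x)\<^sup>2 + (g x)\<^sup>2)" using assms by simp
  have "\<bar>u * v\<bar> \<le> \<bar>u\<^sup>2 + v\<^sup>2\<bar>" for u v :: real
  proof -
    have "2 * (\<bar>u\<bar> * \<bar>v\<bar>) \<le> u\<^sup>2 + v\<^sup>2" using sum_squares_bound[of "\<bar>u\<bar>" "\<bar>v\<bar>"] by simp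
    moreover have "0 \<le> \<bar>u\<bar> * \<bar>v\<bar>" by simp
    ultimately show ?thesis unfolding abs_mult by linarith
  qed
  then show "AE x in M. norm (f x * g x) \<le> norm ((f x)\<^sup>2 + (g x)\<^sup>2)" by simp
qed simp

lemma face_L2_mult_bounded:
  assumes f: "face_L2 B f" and g: "g \<in> borel_measurable lborel" "\<And>x. \<bar>g x\<bar> \<le> c"
  shows "integrable lborel (\<lambda>x. f x * g x)"
proof -
  have [measurable]: "f \<in> borel_measurable borel" "g \<in> borel_measurable borel" using f g by (auto simp: face_L2_def)
  have c: "c \<ge> 0" using g(2)[of undefined] by linarith
  have "integrable lborel (\<lambda>x. (indicator (face B) x * g x)\<^sup>2)"
  proof (rule Bochner_Integration.integrable_bound)
    show "integrable lborel (\<lambda>x. c\<^sup>2 * indicator (face B) x)" by (intro integrable_mult_right integrable_indicator_face)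
    show "AE x in lborel. norm ((indicator (face B) x * g x)\<^sup>2) \<le> norm (c\<^sup>2 * indicator (face B) x)"
      using power_mono[OF g(2), of _ 2] by (auto simp: indicator_def)
  qed measurable
  then have "integrable lborel (\<lambda>x. f x * (indicator (face B) x * g x))"
    using f by (intro integrable_mult_of_squares) (auto simp: face_L2_def)
  moreover have "f x * (indicator (face B) x * g x) = f x * g x" for x
    using f by (cases "x \<in> face B") (auto simp: face_L2_def)
  ultimately show ?thesis by simp
qed

text \<open>The least squares functional with arbitrary coefficients. Its nonnegativity at the
  optimal coefficients is Bessel's inequality, its smallness for an approximating sum is the
  converse half of Parseval, and its dependence on a single coefficient settles the degenerate
  indices.\<close>

lemma integral_trig_sum_diff:
  fixes f :: "real^'m \<Rightarrow> real"
  assumes B: "B > 0" and f: "face_L2 B f" and K: "finite K"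
  shows "(LINT x|lborel. (f x - indicator (face B) x * (\<Sum>k\<in>K. a k * trig_prod B S k x))\<^sup>2)
     = (LINT x|lborel. (f x)\<^sup>2) - 2 * (\<Sum>k\<in>K. a k * fcoef B S k f) + (\<Sum>k\<in>K. (a k)\<^sup>2 * trig_norm_sq B S k)"
proof -
  have f0: "f x * indicator (face B) x = f x" for x using f by (cases "x \<in> face B") (auto simp: face_L2_def)
  have i2: "indicator (face B) x * indicator (face B) x = (indicator (face B) x :: real)" for x :: "real^'m"
    by (simp add: indicator_def)
  have if2: "integrable lborel (\<lambda>x. (f x)\<^sup>2)" using f by (simp add: face_L2_def)
  have ie: "integrable lborel (\<lambda>x. f x * trig_prod B S k x)" for k
    by (rule face_L2_mult_bounded[OF f _ trig_prod_bound]) simp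
  have "(f x - indicator (face B) x * (\<Sum>k\<in>K. a k * trig_prod B S k x))\<^sup>2
     = (f x)\<^sup>2 - 2 * (\<Sum>k\<in>K. a k * (f x * trig_prod B S k x))
       + (\<Sum>k\<in>K. \<Sum>l\<in>K. a k * a l * (indicator (face B) x * (trig_prod B S k x * trig_prod B S l x)))" for x
  proof -
    have "(f x - indicator (face B) x * (\<Sum>k\<in>K. a k * trig_prod B S k x))\<^sup>2
      = (f x)\<^sup>2 - 2 * ((f x * indicator (face B) x) * (\<Sum>k\<in>K. a k * trig_prod B S k x))
        + (indicator (face B) x * indicator (face B) x)
          * ((\<Sum>k\<in>K. a k * trig_prod B S k x) * (\<Sum>l\<in>K. a l * trig_prod B S l x))"
      by (simp add: power2_eq_square algebra_simps)
    also have "\<dots> = (f x)\<^sup>2 - 2 * (\<Sum>k\<in>K. a k * (f x * trig_prod B S k x))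
       + (\<Sum>k\<in>K. \<Sum>l\<in>K. a k * a l * (indicator (face B) x * (trig_prod B S k x * trig_prod B S l x)))"
      unfolding f0 i2 sum_product by (simp add: sum_distrib_left ac_simps)
    finally show ?thesis .
  qed
  then have "(LINT x|lborel. (f x - indicator (face B) x * (\<Sum>k\<in>K. a k * trig_prod B S k x))\<^sup>2)
    = (LINT x|lborel. (f x)\<^sup>2) - 2 * (\<Sum>k\<in>K. a k * fcoef B S k f)
     + (\<Sum>k\<in>K. \<Sum>l\<in>K. a k * a l * (if k = l then trig_norm_sq B S k else 0))"
    using if2 ie trig_prod_inner(1)[of B S] trig_prod_inner(2)[OF B, of S]
    by (simp add: fcoef_def)
  also have "(\<Sum>k\<in>K. \<Sum>l\<in>K. a k * a l * (if k = l then trig_norm_sq B S k else 0)) = (\<Sum>k\<in>K. (a k)\<^sup>2 * trig_norm_sq B S k)"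
    using K by (simp add: if_distrib[of "\<lambda>z. _ * z"] sum.delta power2_eq_square cong: if_cong)
  finally show ?thesis .
qed

lemma bessel:
  fixes f :: "real^'m \<Rightarrow> real"
  assumes B: "B > 0" and f: "face_L2 B f" and K: "finite K"
  shows "(\<Sum>k\<in>K. (fcoef B S k f)\<^sup>2 / trig_norm_sq B S k) \<le> (LINT x|lborel. (f x)\<^sup>2)"
proof -
  let ?c = "\<lambda>k. fcoef B S k f" and ?N = "trig_norm_sq B S"
  have "0 \<le> (LINT x|lborel. (f x - indicator (face B) x * (\<Sum>k\<in>K. ?c k / ?N k * trig_prod B S k x))\<^sup>2)"
    by simp
  also have "\<dots> = (LINT x|lborel. (f x)\<^sup>2) - (\<Sum>k\<in>K. 2 * (?c k / ?N k * ?c k) - (?c k / ?N k)\<^sup>2 * ?N k)"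
    unfolding integral_trig_sum_diff[OF B f K] by (simp add: sum_subtractf sum_distrib_left)
  also have "(\<Sum>k\<in>K. 2 * (?c k / ?N k * ?c k) - (?c k / ?N k)\<^sup>2 * ?N k) = (\<Sum>k\<in>K. (?c k)\<^sup>2 / ?N k)"
    by (rule sum.cong) (auto simp: power2_eq_square)
  finally show ?thesis by simp
qed

text \<open>If the norm is zero, Bessel says nothing, because the quotient is zero by convention.
  The least squares functional is then affine in the coefficient and bounded below, which forces the
  Fourier coefficient to vanish.\<close>

lemma fcoef_sq_le:
  fixes f :: "real^'m \<Rightarrow> real"
  assumes B: "B > 0" and f: "face_L2 B f"
  shows "(fcoef B S k f)\<^sup>2 \<le> trig_norm_sq B S k * (LINT x|lborel. (f x)\<^sup>2)"
proof (cases "trig_norm_sq B S k = 0")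
  case True
  have "c = 0" if "\<And>a. 0 \<le> q - 2 * (a * c)" for c q :: real
  proof (rule ccontr)
    assume "c \<noteq> 0"
    then show False using that[of "(q+1)/(2*c)"] by (simp add: field_simps)
  qed
  moreover have "0 \<le> (LINT x|lborel. (f x)\<^sup>2) - 2 * (a * fcoef B S k f)" for a
    using integral_trig_sum_diff[OF B f, of "{k}" "\<lambda>_. a" S, symmetric] True by simp
  ultimately have "fcoef B S k f = 0" by blast
  then show ?thesis using True by simp
next
  case False
  then have "trig_norm_sq B S k > 0" using trig_norm_sq_nonneg[of B S k] by linarith
  then show ?thesis using bessel[OF B f, of "{k}" S] by (simp add: field_simps)
qed

subsection \<open>Completeness and Parseval's identity\<close>

definition trig_span :: "real \<Rightarrow> 'm::finite set \<Rightarrow> (real^'m \<Rightarrow> real) set" where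
  "trig_span B S = {g. \<exists>K a. finite K \<and> g = (\<lambda>x. \<Sum>k\<in>K. a k * trig_prod B S k x)}"

lemma trig_span_basis: "trig_prod B S k \<in> trig_span B S"
  unfolding trig_span_def by (intro CollectI exI[of _ "{k}"] exI[of _ "\<lambda>_. 1"]) auto

lemma trig_span_scale: "g \<in> trig_span B S \<Longrightarrow> (\<lambda>x. c * g x) \<in> trig_span B S"
proof -
  assume "g \<in> trig_span B S"
  then obtain K a where K: "finite K" "g = (\<lambda>x. \<Sum>k\<in>K. a k * trig_prod B S k x)"
    by (auto simp: trig_span_def)
  then show ?thesis
    unfolding trig_span_def by (intro CollectI exI[of _ K] exI[of _ "\<lambda>k. c * a k"]) (auto simp: sum_distrib_left mult.assoc)
qed

lemma trig_span_add:
  assumes "g \<in> trig_span B S" "h \<in> trig_span B S"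
  shows "(\<lambda>x. g x + h x) \<in> trig_span B S"
proof -
  obtain K a where K: "finite K" "g = (\<lambda>x. \<Sum>k\<in>K. a k * trig_prod B S k x)"
    using assms(1) by (auto simp: trig_span_def)
  obtain L b where L: "finite L" "h = (\<lambda>x. \<Sum>k\<in>L. b k * trig_prod B S k x)"
    using assms(2) by (auto simp: trig_span_def)
  define c where "c k = (if k \<in> K then a k else 0) + (if k \<in> L then b k else 0)" for k
  have "g x + h x = (\<Sum>k\<in>K \<union> L. c k * trig_prod B S k x)" for x
  proof -
    have "g x = (\<Sum>k\<in>K \<union> L. (if k \<in> K then a k else 0) * trig_prod B S k x)"
      unfolding K(2) using K(1) L(1) by (intro sum.mono_neutral_cong_left) auto
    moreover have "h x = (\<Sum>k\<in>K \<union> L. (if k \<in> L then b k else 0) * trig_prod B S k x)"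
      unfolding L(2) using K(1) L(1) by (intro sum.mono_neutral_cong_left) auto
    ultimately show ?thesis by (simp add: c_def distrib_right sum.distrib)
  qed
  then show ?thesis unfolding trig_span_def using K(1) L(1) by (intro CollectI exI[of _ "K \<union> L"] exI[of _ c]) auto
qed

lemma trig_span_sum:
  assumes "finite K" "\<And>k. k \<in> K \<Longrightarrow> g k \<in> trig_span B S"
  shows "(\<lambda>x. \<Sum>k\<in>K. g k x) \<in> trig_span B S"
  using assms
proof (induction K rule: finite_induct)
  case empty
  then show ?case unfolding trig_span_def by (intro CollectI exI[of _ "{}"]) auto
next
  case (insert k K)
  then show ?case by (simp add: trig_span_add)
qed

text \<open>The three-term relation \<open>2 cos x cos kx = cos (k+1)x + cos (k-1)x\<close> and its
  sine analogue. The case \<open>k = 0\<close> is separate because \<open>k - 1\<close> is truncated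
  on the naturals.\<close>

lemma cos_mult_trig:
  "\<exists>c1 c2 k1 k2. \<forall>t. trig B False 1 t * trig B s k t = c1 * trig B s k1 t + c2 * trig B s k2 t"
proof (cases "k = 0")
  case True
  then show ?thesis
    by (intro exI[of _ "if s then 0 else 1"] exI[of _ 0] exI[of _ 1]) (auto simp: trig_def)
next
  case False
  then have k: "real (k - 1) = real k - 1" by simp
  show ?thesis
  proof (intro exI allI)
    fix t
    define \<theta> where "\<theta> = pi * (t + B) / (2 * B)"
    show "trig B False 1 t * trig B s k t = 1/2 * trig B s (k+1) t + 1/2 * trig B s (k-1) t"
      unfolding trig_def \<theta>_def[symmetric] of_nat_add k
      by (auto simp: distrib_right left_diff_distrib sin_add sin_diff cos_add cos_diff field_simps)
  qed
qed

lemma trig_prod_update: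
  fixes k :: "nat^'m"
  shows "trig_prod B S (\<chi> i. if i = j then n else k $ i) x
    = trig B (j \<in> S) n (x $ j) * (\<Prod>i\<in>UNIV - {j}. trig B (i \<in> S) (k $ i) (x $ i))"
  unfolding trig_prod_def by (subst prod.remove[of UNIV j]) (auto intro!: prod.cong)

lemma trig_span_cos_mult:
  assumes "g \<in> trig_span B S"
  shows "(\<lambda>x. trig B False 1 (x $ j) * g x) \<in> trig_span B S"
proof -
  have basis: "(\<lambda>x. trig B False 1 (x $ j) * trig_prod B S k x) \<in> trig_span B S" for k
  proof -
    obtain c1 c2 k1 k2 where c: "\<And>t. trig B False 1 t * trig B (j \<in> S) (k $ j) t
        = c1 * trig B (j \<in> S) k1 t + c2 * trig B (j \<in> S) k2 t"
      using cos_mult_trig by blast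
    have "trig B False 1 (x $ j) * trig_prod B S k x
       = c1 * trig_prod B S (\<chi> i. if i = j then k1 else k $ i) x + c2 * trig_prod B S (\<chi> i. if i = j then k2 else k $ i) x" for x
    proof -
      have "trig_prod B S k x = trig B (j \<in> S) (k $ j) (x $ j) * (\<Prod>i\<in>UNIV - {j}. trig B (i \<in> S) (k $ i) (x $ i))"
        unfolding trig_prod_def by (subst prod.remove[of UNIV j]) auto
      then have "trig B False 1 (x $ j) * trig_prod B S k x = (trig B False 1 (x $ j) * trig B (j \<in> S) (k $ j) (x $ j))
           * (\<Prod>i\<in>UNIV - {j}. trig B (i \<in> S) (k $ i) (x $ i))"
        by simp
      then show ?thesis unfolding c trig_prod_update by (simp add: distrib_right)
    qed
    then show ?thesis
      by (simp add: trig_span_add trig_span_scale trig_span_basis)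
  qed
  obtain K a where K: "finite K" "g = (\<lambda>x. \<Sum>k\<in>K. a k * trig_prod B S k x)"
    using assms by (auto simp: trig_span_def)
  have "(\<lambda>x. \<Sum>k\<in>K. a k * (trig B False 1 (x $ j) * trig_prod B S k x)) \<in> trig_span B S"
    by (intro trig_span_sum K(1) trig_span_scale basis)
  then show ?thesis unfolding K(2) by (simp add: sum_distrib_left mult.left_commute)
qed

text \<open>The sine systems are not algebras, so Stone-Weierstrass is applied to the algebra of
  multipliers that map \<open>trig_span\<close> into itself. It contains the first cosine of each
  coordinate, and these separate points because \<open>cos\<close> is injective on
  \<open>[0, pi]\<close>.\<close>

lemma cos_algebra_dense:
  fixes g :: "real^'m \<Rightarrow> real"
  assumes B: "B > 0" and g: "continuous_on UNIV g" and e: "e > 0"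
  obtains P where "continuous_on UNIV P" "\<And>h. h \<in> trig_span B S \<Longrightarrow> (\<lambda>x. P x * h x) \<in> trig_span B S"
    "\<And>x. x \<in> face B \<Longrightarrow> \<bar>g x - P x\<bar> < e"
proof -
  define Q where "Q P \<longleftrightarrow> continuous_on UNIV P \<and> (\<forall>h\<in>trig_span B S. (\<lambda>x. P x * h x) \<in> trig_span B S)"
    for P :: "real^'m \<Rightarrow> real"
  have "\<exists>P. Q P \<and> (\<forall>x\<in>cbox (vec (-B)) (vec B :: real^'m). \<bar>g x - P x\<bar> < e)"
  proof (rule Stone_Weierstrass_HOL)
    show "Q (\<lambda>x. c)" for c by (auto simp: Q_def trig_span_scale)
    show "continuous_on (cbox (vec (-B)) (vec B)) f" if "Q f" for f
      using that unfolding Q_def by (auto intro: continuous_on_subset)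
    show "Q (\<lambda>x. f x + h x)" if "Q f \<and> Q h" for f h
      using that unfolding Q_def by (auto intro!: continuous_intros trig_span_add simp: distrib_right)
    show "Q (\<lambda>x. f x * h x)" if "Q f \<and> Q h" for f h
      using that unfolding Q_def by (auto intro!: continuous_intros simp: mult.assoc)
    show "\<exists>f. Q f \<and> f x \<noteq> f y"
      if xy: "x \<in> cbox (vec (-B)) (vec B) \<and> y \<in> cbox (vec (-B)) (vec B) \<and> x \<noteq> y" for x y :: "real^'m"
    proof -
      obtain j where j: "x $ j \<noteq> y $ j" using xy by (auto simp: vec_eq_iff)
      have xj: "-B \<le> x $ j" "x $ j \<le> B" "-B \<le> y $ j" "y $ j \<le> B" using xy by (auto simp: mem_box_cart)
      have "Q (\<lambda>x. trig B False 1 (x $ j))"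
        unfolding Q_def by (intro conjI ballI trig_span_cos_mult continuous_intros)
      moreover have "trig B False 1 (x $ j) \<noteq> trig B False 1 (y $ j)"
      proof
        assume "trig B False 1 (x $ j) = trig B False 1 (y $ j)"
        then have c: "cos (pi * (x $ j + B) / (2 * B)) = cos (pi * (y $ j + B) / (2 * B))"
          by (simp add: trig_def)
        have r: "0 \<le> pi * (t + B) / (2 * B)" "pi * (t + B) / (2 * B) \<le> pi" if "-B \<le> t" "t \<le> B" for t
          using that B mult_left_mono[of "t + B" "2 * B" pi] by (auto simp: pos_divide_le_eq)
        have "pi * (x $ j + B) / (2 * B) = pi * (y $ j + B) / (2 * B)"
          by (rule cos_inj_pi[OF r[OF xj(1,2)] r[OF xj(3,4)] c])
        then have "pi * (x $ j + B) = pi * (y $ j + B)" using B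
          by (metis divide_cancel_right mult_eq_0_iff order_less_irrefl zero_neq_numeral)
        then have "x $ j + B = y $ j + B" using pi_neq_zero mult_left_cancel by blast
        then show False using j by simp
      qed
      ultimately show ?thesis by blast
    qed
  qed (use g e in \<open>auto intro: continuous_on_subset compact_cbox\<close>)
  then show ?thesis using that face_subset_cbox unfolding Q_def by blast
qed

text \<open>A fixed element \<open>s\<close> of the span is positive on the open cube, so
  \<open>f\<close> is nearly \<open>s\<close> times a bounded function. That function is
  approximated by a continuous one, and this by a multiplier \<open>P\<close>; then \<open>P\<close>
  times \<open>s\<close> lies in the span.\<close>

lemma face_L2_approx:
  fixes f :: "real^'m \<Rightarrow> real"
  assumes B: "B > 0" and f: "face_L2 B f" and e: "e > 0"
  obtains g where "g \<in> trig_span B S" "(LINT x|lborel. (f x - indicator (face B) x * g x)\<^sup>2) < e"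
proof -
  have [measurable]: "f \<in> borel_measurable borel" using f by (simp add: face_L2_def)
  have f2: "integrable lborel (\<lambda>x. (f x)\<^sup>2)" and f0: "\<And>x. x \<notin> face B \<Longrightarrow> f x = 0"
    using f by (auto simp: face_L2_def)
  \<comment> \<open>The lowest member of the system: frequency one in sine coordinates, zero in
    cosine coordinates.\<close>
  define s where "s = trig_prod B S (\<chi> j. if j \<in> S then 1 else 0)"
  have s_span: "s \<in> trig_span B S" by (simp add: s_def trig_span_basis)
  have s1: "\<bar>s x\<bar> \<le> 1" for x by (simp add: s_def trig_prod_bound)
  have [measurable]: "s \<in> borel_measurable borel" by (simp add: s_def)
  have spos: "s x > 0" if "x \<in> face B" for x
    unfolding s_def trig_prod_def
  proof (intro prod_pos ballI)
    fix j
    have "-B < x $ j" "x $ j < B" using that by (auto simp: face_def)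
    then have x: "0 < x $ j + B" "x $ j + B < 2 * B" by linarith+
    have "0 < pi * (x $ j + B) / (2 * B)" using x B by simp
    moreover have "pi * (x $ j + B) / (2 * B) < pi"
      using x B mult_strict_left_mono[OF x(2) pi_gt_zero] by (simp add: pos_divide_less_eq)
    ultimately show "0 < trig B (j \<in> S) ((\<chi> j. if j \<in> S then 1 else 0) $ j) (x $ j)"
      by (auto simp: trig_def sin_gt_zero)
  qed
  \<comment> \<open>Both the values of \<open>f\<close> and the region where \<open>s\<close> is
    small are truncated, so \<open>F n / s\<close> is bounded by \<open>n * (n+1)\<close>.\<close>
  define F where "F n x = (if s x \<ge> 1 / real (Suc n) then indicator (face B) x * max (- real n) (min (real n) (f x)) else 0)" for n x
  have [measurable]: "F n \<in> borel_measurable borel" for n unfolding F_def[abs_def] by measurable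
  have Ff: "\<bar>f x - F n x\<bar> \<le> \<bar>f x\<bar>" for n x using f0[of x] by (auto simp: F_def indicator_def)
  have "(\<lambda>n. LINT x|lborel. (f x - F n x)\<^sup>2) \<longlonglongrightarrow> (LINT x|(lborel::(real^'m) measure). 0)"
  proof (rule integral_dominated_convergence[where w="\<lambda>x. (f x)\<^sup>2"])
    show "AE x in lborel. norm ((f x - F n x)\<^sup>2) \<le> (f x)\<^sup>2" for n
      using Ff by (auto simp: abs_le_square_iff[symmetric])
    show "AE x in lborel. (\<lambda>n. (f x - F n x)\<^sup>2) \<longlonglongrightarrow> 0"
    proof (rule AE_I2)
      fix x
      show "(\<lambda>n. (f x - F n x)\<^sup>2) \<longlonglongrightarrow> 0"
      proof (rule tendsto_eventually)
        show "\<forall>\<^sub>F n in sequentially. (f x - F n x)\<^sup>2 = 0"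
        proof (cases "x \<in> face B")
          case False
          then show ?thesis using f0[OF False] by (auto simp: F_def)
        next
          case True
          obtain n1 :: nat where n1: "1 / real (Suc n1) < s x" using nat_approx_posE[OF spos[OF True]] by auto
          obtain n2 :: nat where n2: "\<bar>f x\<bar> \<le> real n2" using real_arch_simple by blast
          have "(f x - F n x)\<^sup>2 = 0" if "n \<ge> max n1 n2" for n
          proof -
            have "1 / real (Suc n) \<le> 1 / real (Suc n1)" using that by (intro divide_left_mono) auto
            then have "1 / real (Suc n) \<le> s x" using n1 by linarith
            moreover have "\<bar>f x\<bar> \<le> real n" using n2 that by linarith
            ultimately show ?thesis using True by (auto simp: F_def abs_le_iff)
          qed
          then show ?thesis unfolding eventually_sequentially by blast
        qed
      qed
    qed
  qed (use f2 in auto)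
  \<comment> \<open>The square of a sum of three errors costs a factor 3 for each of them, so three
    errors of \<open>e/12\<close> sum to less than \<open>e\<close>.\<close>
  then have "\<forall>\<^sub>F n in sequentially. (LINT x|lborel. (f x - F n x)\<^sup>2) < e/12"
    using e by (intro order_tendstoD(2)) auto
  then obtain n where n: "(LINT x|lborel. (f x - F n x)\<^sup>2) < e/12"
    by (auto simp: eventually_sequentially)
  define M where "M = real n * real (Suc n)"
  define h where "h x = F n x / s x" for x
  have [measurable]: "h \<in> borel_measurable borel" unfolding h_def[abs_def] by measurable
  have Fn: "F n x = s x * h x" for x
    by (cases "s x = 0") (auto simp: h_def F_def)
  have hM: "\<bar>h x\<bar> \<le> M" for x
  proof (cases "s x \<ge> 1 / real (Suc n)")
    case True
    have sp: "s x > 0" using True by (smt (verit) divide_pos_pos of_nat_0_less_iff zero_less_Suc)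
    have "\<bar>F n x\<bar> \<le> real n" by (auto simp: F_def indicator_def)
    moreover have "1 / s x \<le> real (Suc n)" using True sp by (simp add: field_simps)
    ultimately have "\<bar>F n x\<bar> * (1 / s x) \<le> real n * real (Suc n)" using sp by (intro mult_mono) auto
    then show ?thesis using sp by (simp add: h_def M_def)
  qed (simp add: h_def F_def M_def)
  obtain G where G: "\<And>m. continuous_on UNIV (G m)" "\<And>m x. \<bar>G m x\<bar> \<le> M"
    "AE x in lborel. (\<lambda>m::nat. G m x) \<longlonglongrightarrow> h x"
    by (rule bounded_measurable_approx[of h M]) (auto simp: hM)
  have [measurable]: "G m \<in> borel_measurable borel" for m using G(1) by (auto intro: borel_measurable_continuous_onI)
  have bound: "(h x - G m x)\<^sup>2 \<le> (2*M)\<^sup>2" for m x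
    unfolding abs_le_square_iff[symmetric] using hM[of x] G(2)[of m x] by auto
  have "(\<lambda>m. LINT x|lborel. indicator (face B) x * (h x - G m x)\<^sup>2) \<longlonglongrightarrow> (LINT x|(lborel::(real^'m) measure). 0)"
  proof (rule integral_dominated_convergence[where w="\<lambda>x. (2*M)\<^sup>2 * indicator (face B) x"])
    show "integrable lborel (\<lambda>x::real^'m. (2*M)\<^sup>2 * indicator (face B) x)"
      by (intro integrable_mult_right integrable_indicator_face)
    show "AE x in lborel. norm (indicator (face B) x * (h x - G m x)\<^sup>2) \<le> (2*M)\<^sup>2 * indicator (face B) x" for m
      using bound[of _ m] by (auto simp: indicator_def)
    show "AE x in lborel. (\<lambda>m. indicator (face B) x * (h x - G m x)\<^sup>2) \<longlonglongrightarrow> 0"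
      using G(3)
    proof eventually_elim
      case (elim x)
      have "(\<lambda>m. indicator (face B) x * (h x - G m x)\<^sup>2) \<longlonglongrightarrow> indicator (face B) x * (h x - h x)\<^sup>2"
        by (intro tendsto_intros elim)
      then show ?case by simp
    qed
  qed auto
  then have "\<forall>\<^sub>F m in sequentially. (LINT x|lborel. indicator (face B) x * (h x - G m x)\<^sup>2) < e/12"
    using e by (intro order_tendstoD(2)) auto
  then obtain m where m: "(LINT x|lborel. indicator (face B) x * (h x - G m x)\<^sup>2) < e/12"
    by (auto simp: eventually_sequentially)
  define V :: real where "V = (LINT x|(lborel::(real^'m) measure). indicator (face B) x)"
  have V: "V \<ge> 0" unfolding V_def by simp
  define d where "d = sqrt (e / (12 * (V + 1)))"
  have d: "d > 0" "d\<^sup>2 = e / (12 * (V + 1))" using e V by (auto simp: d_def)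
  obtain P where P: "continuous_on UNIV P" "\<And>h. h \<in> trig_span B S \<Longrightarrow> (\<lambda>x. P x * h x) \<in> trig_span B S"
    "\<And>x. x \<in> face B \<Longrightarrow> \<bar>G m x - P x\<bar> < d"
    using cos_algebra_dense[OF B G(1) d(1)] by metis
  have [measurable]: "P \<in> borel_measurable borel" using P(1) by (rule borel_measurable_continuous_onI)
  have i1: "integrable lborel (\<lambda>x. (f x - F n x)\<^sup>2)"
    by (rule Bochner_Integration.integrable_bound[OF f2]) (use Ff in \<open>auto simp: abs_le_square_iff[symmetric]\<close>)
  have i2: "integrable lborel (\<lambda>x. indicator (face B) x * (h x - G m x)\<^sup>2)"
  proof (rule Bochner_Integration.integrable_bound)
    show "integrable lborel (\<lambda>x::real^'m. (2*M)\<^sup>2 * indicator (face B) x)"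
      by (intro integrable_mult_right integrable_indicator_face)
    show "AE x in lborel. norm (indicator (face B) x * (h x - G m x)\<^sup>2) \<le> norm ((2*M)\<^sup>2 * indicator (face B) x)"
      using bound[of _ m] by (auto simp: indicator_def)
  qed measurable
  let ?W = "\<lambda>x. 3 * (f x - F n x)\<^sup>2 + 3 * (indicator (face B) x * (h x - G m x)\<^sup>2) + 3 * (d\<^sup>2 * indicator (face B) x)"
  have iW: "integrable lborel ?W"
    by (intro Bochner_Integration.integrable_add integrable_mult_right i1 i2 integrable_indicator_face)
  have pw: "(f x - indicator (face B) x * (P x * s x))\<^sup>2 \<le> ?W x" for x
  proof (cases "x \<in> face B")
    case True
    have sq3: "(u + v + w)\<^sup>2 \<le> 3 * u\<^sup>2 + 3 * v\<^sup>2 + 3 * w\<^sup>2" for u v w :: real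
      using sum_squares_bound[of u v] sum_squares_bound[of u w] sum_squares_bound[of v w]
      by (simp add: power2_eq_square algebra_simps)
    have ss: "(s x * u)\<^sup>2 \<le> u\<^sup>2" for u
    proof -
      have "(s x)\<^sup>2 \<le> 1" using power_mono[OF s1[of x], of 2] by simp
      then have "(s x)\<^sup>2 * u\<^sup>2 \<le> 1 * u\<^sup>2" by (intro mult_right_mono) auto
      then show ?thesis by (simp add: power_mult_distrib)
    qed
    have "(f x - P x * s x)\<^sup>2 = ((f x - F n x) + s x * (h x - G m x) + s x * (G m x - P x))\<^sup>2"
      by (simp add: Fn algebra_simps)
    also have "\<dots> \<le> 3*(f x - F n x)\<^sup>2 + 3*(s x * (h x - G m x))\<^sup>2 + 3*(s x * (G m x - P x))\<^sup>2"
      by (rule sq3)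
    also have "\<dots> \<le> 3*(f x - F n x)\<^sup>2 + 3*(h x - G m x)\<^sup>2 + 3*d\<^sup>2"
    proof -
      have "(s x * (G m x - P x))\<^sup>2 \<le> (G m x - P x)\<^sup>2" by (rule ss)
      also have "\<dots> \<le> d\<^sup>2" using P(3)[OF True] d(1) by (intro power2_le_iff_abs_le[THEN iffD2]) auto
      finally show ?thesis using ss[of "h x - G m x"] by simp
    qed
    finally show ?thesis using True by simp
  next
    case False
    then show ?thesis using f0[OF False] by (simp add: F_def)
  qed
  have "(LINT x|lborel. (f x - indicator (face B) x * (P x * s x))\<^sup>2) \<le> (LINT x|lborel. ?W x)"
  proof (rule integral_mono[OF _ iW pw])
    show "integrable lborel (\<lambda>x. (f x - indicator (face B) x * (P x * s x))\<^sup>2)"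
      by (rule Bochner_Integration.integrable_bound[OF iW])
        (use pw in \<open>auto intro!: order_trans[OF pw]\<close>)
  qed
  also have "\<dots> = 3 * (LINT x|lborel. (f x - F n x)\<^sup>2) + 3 * (LINT x|lborel. indicator (face B) x * (h x - G m x)\<^sup>2) + 3 * (d\<^sup>2 * V)"
  proof -
    have iI: "integrable lborel (\<lambda>x::real^'m. 3 * (d\<^sup>2 * indicator (face B) x))"
      by (intro integrable_mult_right integrable_indicator_face)
    have i12: "integrable lborel (\<lambda>x. 3 * (f x - F n x)\<^sup>2)"
      "integrable lborel (\<lambda>x. 3 * (indicator (face B) x * (h x - G m x)\<^sup>2))"
      using i1 i2 by auto
    show ?thesis
      unfolding Bochner_Integration.integral_add[OF Bochner_Integration.integrable_add[OF i12] iI]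
        Bochner_Integration.integral_add[OF i12] V_def by simp
  qed
  also have "\<dots> < 3 * (e/12) + 3 * (e/12) + 3 * (e/12)"
  proof -
    have "d\<^sup>2 * V \<le> e/12" unfolding d(2) using V e by (simp add: field_simps)
    then show ?thesis using n m by linarith
  qed
  also have "\<dots> \<le> e" using e by simp
  finally show ?thesis using that P(2)[OF s_span] by blast
qed

text \<open>Bessel and monotone convergence over finite index sets give one inequality. The other
  combines density of the span with \<open>2*a*c - a^2*N <= c^2/N\<close>. The sum is a
  counting-measure integral in \<open>ennreal\<close>, so that it can later be exchanged with the
  integral over \<open>z\<close> by Tonelli.\<close>

lemma parseval:
  fixes f :: "real^'m \<Rightarrow> real"
  assumes B: "B > 0" and f: "face_L2 B f"
  shows "ennreal (LINT x|lborel. (f x)\<^sup>2)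
    = (\<integral>\<^sup>+k. ennreal ((fcoef B S k f)\<^sup>2 / trig_norm_sq B S k) \<partial>count_space UNIV)"
proof (rule antisym)
  let ?c = "\<lambda>k. fcoef B S k f" and ?N = "trig_norm_sq B S"
  let ?t = "\<lambda>k. (?c k)\<^sup>2 / ?N k"
  have t0: "?t k \<ge> 0" for k by (simp add: trig_norm_sq_nonneg)
  have fin: "(\<integral>\<^sup>+k. ennreal (?t k) * indicator K k \<partial>count_space UNIV) = ennreal (\<Sum>k\<in>K. ?t k)" if "finite K" for K
  proof -
    have "(\<integral>\<^sup>+k. ennreal (?t k) * indicator K k \<partial>count_space UNIV) = (\<integral>\<^sup>+k. ennreal (?t k) \<partial>count_space K)"
      by (simp add: nn_integral_count_space_indicator)
    then show ?thesis using that t0 by (simp add: nn_integral_count_space_finite sum_ennreal)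
  qed
  show "ennreal (LINT x|lborel. (f x)\<^sup>2) \<le> (\<integral>\<^sup>+k. ennreal (?t k) \<partial>count_space UNIV)"
  proof (rule ennreal_le_epsilon)
    fix e :: real assume e: "0 < e"
    obtain g where g: "g \<in> trig_span B S" "(LINT x|lborel. (f x - indicator (face B) x * g x)\<^sup>2) < e"
      by (rule face_L2_approx[OF B f e])
    then obtain K a where K: "finite K" "g = (\<lambda>x. \<Sum>k\<in>K. a k * trig_prod B S k x)"
      by (auto simp: trig_span_def)
    have "(LINT x|lborel. (f x)\<^sup>2) - (\<Sum>k\<in>K. 2 * (a k * ?c k) - (a k)\<^sup>2 * ?N k) < e"
      using g(2) unfolding K(2) integral_trig_sum_diff[OF B f K(1)] by (simp add: sum_subtractf sum_distrib_left)
    moreover have "(\<Sum>k\<in>K. 2 * (a k * ?c k) - (a k)\<^sup>2 * ?N k) \<le> (\<Sum>k\<in>K. ?t k)"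
    proof (rule sum_mono)
      fix k
      show "2 * (a k * ?c k) - (a k)\<^sup>2 * ?N k \<le> ?t k"
      proof (cases "?N k = 0")
        \<comment> \<open>A degenerate index contributes nothing: its coefficient vanishes together
          with the norm.\<close>
        case True
        then have "?c k = 0" using fcoef_sq_le[OF B f, of S k] by simp
        then show ?thesis using True by simp
      next
        case False
        then have N: "?N k > 0" using trig_norm_sq_nonneg[of B S k] by linarith
        have "0 \<le> (a k * ?N k - ?c k)\<^sup>2" by simp
        then have "(2 * (a k * ?c k) - (a k)\<^sup>2 * ?N k) * ?N k \<le> (?c k)\<^sup>2"
          by (simp add: power2_eq_square algebra_simps)
        then show ?thesis using N by (simp add: pos_le_divide_eq)
      qed
    qed
    ultimately have "(LINT x|lborel. (f x)\<^sup>2) \<le> (\<Sum>k\<in>K. ?t k) + e" by linarith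
    then have "ennreal (LINT x|lborel. (f x)\<^sup>2) \<le> ennreal ((\<Sum>k\<in>K. ?t k) + e)" by (rule ennreal_leI)
    also have "\<dots> = ennreal (\<Sum>k\<in>K. ?t k) + ennreal e"
      using e t0 by (intro ennreal_plus sum_nonneg) auto
    also have "ennreal (\<Sum>k\<in>K. ?t k) \<le> (\<integral>\<^sup>+k. ennreal (?t k) \<partial>count_space UNIV)"
      unfolding fin[OF K(1), symmetric] by (intro nn_integral_mono) (auto simp: indicator_def)
    finally show "ennreal (LINT x|lborel. (f x)\<^sup>2) \<le> (\<integral>\<^sup>+k. ennreal (?t k) \<partial>count_space UNIV) + ennreal e"
      by (simp add: add_mono)
  qed
  show "(\<integral>\<^sup>+k. ennreal (?t k) \<partial>count_space UNIV) \<le> ennreal (LINT x|lborel. (f x)\<^sup>2)"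
  proof -
    define K where "K n = {k :: nat^'m. to_nat k < n}" for n
    have K: "finite (K n)" for n
      unfolding K_def by (rule finite_subset[OF _ finite_imageI[of "{..<n}" from_nat]]) (auto intro!: image_eqI[of _ _ "to_nat _"])
    have SUP: "(SUP n. ennreal (?t k) * indicator (K n) k) = ennreal (?t k)" for k
    proof (rule antisym)
      show "(SUP n. ennreal (?t k) * indicator (K n) k) \<le> ennreal (?t k)"
        by (intro SUP_least) (auto simp: indicator_def)
      have "ennreal (?t k) = ennreal (?t k) * indicator (K (Suc (to_nat k))) k" by (simp add: K_def)
      also have "\<dots> \<le> (SUP n. ennreal (?t k) * indicator (K n) k)" by (rule SUP_upper) simp
      finally show "ennreal (?t k) \<le> (SUP n. ennreal (?t k) * indicator (K n) k)" .
    qed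
    have "(\<integral>\<^sup>+k. ennreal (?t k) \<partial>count_space UNIV) = (\<integral>\<^sup>+k. (SUP n. ennreal (?t k) * indicator (K n) k) \<partial>count_space UNIV)"
      unfolding SUP ..
    also have "\<dots> = (SUP n. \<integral>\<^sup>+k. ennreal (?t k) * indicator (K n) k \<partial>count_space UNIV)"
      by (rule nn_integral_monotone_convergence_SUP)
        (auto simp: incseq_def le_fun_def K_def indicator_def intro: mult_left_mono)
    also have "\<dots> \<le> ennreal (LINT x|lborel. (f x)\<^sup>2)"
      unfolding fin[OF K] by (intro SUP_least ennreal_leI bessel[OF B f K])
    finally show ?thesis .
  qed
qed

subsection \<open>Fourier modes of functions on the prism\<close>

text \<open>Membership in \<open>L2_on\<close> says nothing about values outside the prism.
  Multiplication by the indicator gives a Borel function on the whole space, to which Fubini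
  applies.\<close>

definition zero_ext :: "real \<Rightarrow> real \<Rightarrow> real \<Rightarrow> ((real^'m) \<times> real \<Rightarrow> real) \<Rightarrow> (real^'m) \<times> real \<Rightarrow> real" where
  "zero_ext B a b f p = indicator (prism B a b) p * f p"

definition coef :: "real \<Rightarrow> real \<Rightarrow> real \<Rightarrow> 'm::finite set \<Rightarrow> nat^'m \<Rightarrow> ((real^'m) \<times> real \<Rightarrow> real) \<Rightarrow> real \<Rightarrow> real" where
  "coef B a b S k f z = fcoef B S k (\<lambda>x. zero_ext B a b f (x, z))"

lemma prism_Times: "prism B a b = face B \<times> {a<..<b}"
  by (auto simp: prism_def)

lemma prism_sets [measurable]: "prism B a b \<in> sets borel"
  unfolding prism_Times by (intro borel_open open_Times open_face) auto

lemma integrable_indicator_prism: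
  "integrable lborel (indicator (prism B a b) :: (real^'m) \<times> real \<Rightarrow> real)"
proof -
  have "(prism B a b :: ((real^'m) \<times> real) set) \<subseteq> cbox (vec (-B), a) (vec B, b)"
    using face_subset_cbox[of B] unfolding prism_Times cbox_Pair_eq by (auto simp: cbox_interval)
  then have "emeasure lborel (prism B a b :: ((real^'m) \<times> real) set) \<le> emeasure lborel (cbox (vec (-B), a) (vec B :: real^'m, b))"
    by (rule emeasure_mono) simp
  also have "\<dots> < \<infinity>" using emeasure_lborel_cbox_finite by blast
  finally show ?thesis by (intro integrable_real_indicator) auto
qed

lemma zero_ext_L2:
  assumes "L2_on (prism B a b) f"
  shows zero_ext_measurable: "zero_ext B a b f \<in> borel_measurable borel"
    and zero_ext_integrable: "integrable lborel (\<lambda>p. (zero_ext B a b f p)\<^sup>2)"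
proof -
  have e: "zero_ext B a b f = (\<lambda>p. indicator (prism B a b) p *\<^sub>R f p)" by (auto simp: zero_ext_def)
  show "zero_ext B a b f \<in> borel_measurable borel"
    using assms unfolding e L2_on_def set_borel_measurable_def by simp
  have "(\<lambda>p. (zero_ext B a b f p)\<^sup>2) = (\<lambda>p. indicator (prism B a b) p *\<^sub>R (f p)\<^sup>2)"
    by (auto simp: zero_ext_def indicator_def)
  then show "integrable lborel (\<lambda>p. (zero_ext B a b f p)\<^sup>2)"
    using assms unfolding L2_on_def set_integrable_def by simp
qed

lemma zero_ext_mult_bounded:
  assumes f: "L2_on (prism B a b) f" and g: "g \<in> borel_measurable borel" "\<And>x. \<bar>g x\<bar> \<le> c"
  shows "integrable lborel (\<lambda>x. zero_ext B a b f x * g x)"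
proof -
  have [measurable]: "zero_ext B a b f \<in> borel_measurable borel" "g \<in> borel_measurable borel"
    using zero_ext_measurable[OF f] g by auto
  have "integrable lborel (\<lambda>x. (indicator (prism B a b) x * g x)\<^sup>2)"
  proof (rule Bochner_Integration.integrable_bound)
    show "integrable lborel (\<lambda>x. c\<^sup>2 * indicator (prism B a b) x)"
      by (intro integrable_mult_right integrable_indicator_prism)
    show "AE x in lborel. norm ((indicator (prism B a b) x * g x)\<^sup>2) \<le> norm (c\<^sup>2 * indicator (prism B a b) x)"
      using power_mono[OF g(2), of _ 2] by (auto simp: indicator_def)
  qed measurable
  then have "integrable lborel (\<lambda>x. zero_ext B a b f x * (indicator (prism B a b) x * g x))"
    using zero_ext_integrable[OF f] by (intro integrable_mult_of_squares) auto
  moreover have "zero_ext B a b f x * (indicator (prism B a b) x * g x) = zero_ext B a b f x * g x" for x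
    by (auto simp: zero_ext_def indicator_def)
  ultimately show ?thesis by simp
qed

lemma LINT_prism_zero_ext: "(LINT p:prism B a b|lborel. f p * h p) = (LINT p|lborel. zero_ext B a b f p * h p)"
  by (simp add: set_lebesgue_integral_def zero_ext_def mult.assoc)

lemma AE_slice_L2:
  assumes f: "L2_on (prism B a b) f"
  shows "AE z in lborel. face_L2 B (\<lambda>x. zero_ext B a b f (x, z))"
proof -
  have m: "zero_ext B a b f \<in> borel_measurable borel" by (rule zero_ext_measurable[OF f])
  have "integrable (lborel \<Otimes>\<^sub>M lborel) (\<lambda>(x, z). (zero_ext B a b f (x, z))\<^sup>2)"
    using zero_ext_integrable[OF f] by (simp add: lborel_prod case_prod_beta')
  then have "AE z in lborel. integrable lborel (\<lambda>x. (zero_ext B a b f (x, z))\<^sup>2)"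
    by (rule lborel_pair.AE_integrable_snd)
  then show ?thesis
  proof eventually_elim
    case (elim z)
    have "(\<lambda>x. zero_ext B a b f (x, z)) \<in> borel_measurable borel"
      by (rule measurable_compose[OF _ m]) (intro borel_measurable_continuous_onI continuous_intros)
    moreover have "zero_ext B a b f (x, z) = 0" if "x \<notin> face B" for x
      using that by (simp add: zero_ext_def prism_def)
    ultimately show ?case using elim unfolding face_L2_def by simp
  qed
qed

lemma coef_eq_0: "z \<notin> {a<..<b} \<Longrightarrow> coef B a b S k f z = 0"
proof -
  assume "z \<notin> {a<..<b}"
  then have "zero_ext B a b f (x, z) = 0" for x by (auto simp: zero_ext_def prism_def)
  then show ?thesis by (simp add: coef_def fcoef_def)
qed

lemma coef_measurable:
  assumes f: "L2_on (prism B a b) f"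
  shows "coef B a b S k f \<in> borel_measurable borel"
proof -
  have [measurable]: "zero_ext B a b f \<in> borel_measurable (borel \<Otimes>\<^sub>M borel)"
    unfolding borel_prod by (rule zero_ext_measurable[OF f])
  have "(\<lambda>z. LINT x|lborel. zero_ext B a b f (x, z) * trig_prod B S k x) \<in> borel_measurable borel"
    by measurable
  then show ?thesis by (simp add: coef_def[abs_def] fcoef_def)
qed

lemma coef_sq_le:
  assumes B: "B > 0" and f: "L2_on (prism B a b) f"
  shows "AE z in lborel. (coef B a b S k f z)\<^sup>2 \<le> trig_norm_sq B S k * (LINT x|lborel. (zero_ext B a b f (x, z))\<^sup>2)"
  using AE_slice_L2[OF f] by eventually_elim (simp add: coef_def fcoef_sq_le[OF B])

lemma slice_norm_integrable:
  assumes f: "L2_on (prism B a b) f"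
  shows "integrable lborel (\<lambda>z. LINT x|lborel. (zero_ext B a b f (x, z))\<^sup>2)"
proof -
  have "integrable (lborel \<Otimes>\<^sub>M lborel) (\<lambda>(x, z). (zero_ext B a b f (x, z))\<^sup>2)"
    using zero_ext_integrable[OF f] by (simp add: lborel_prod case_prod_beta')
  then show ?thesis by (rule lborel_pair.integrable_snd)
qed

lemma coef_sq_integrable:
  assumes B: "B > 0" and f: "L2_on (prism B a b) f"
  shows "integrable lborel (\<lambda>z. (coef B a b S k f z)\<^sup>2)"
proof (rule Bochner_Integration.integrable_bound)
  show "integrable lborel (\<lambda>z. trig_norm_sq B S k * (LINT x|lborel. (zero_ext B a b f (x, z))\<^sup>2))"
    by (intro integrable_mult_right slice_norm_integrable f)
  show "(\<lambda>z. (coef B a b S k f z)\<^sup>2) \<in> borel_measurable lborel"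
    using coef_measurable[OF f, of S k] by simp
  show "AE z in lborel. norm ((coef B a b S k f z)\<^sup>2) \<le> norm (trig_norm_sq B S k * (LINT x|lborel. (zero_ext B a b f (x, z))\<^sup>2))"
    using coef_sq_le[OF B f, of S k] by eventually_elim (simp add: trig_norm_sq_nonneg)
qed

lemma coef_set_integrable:
  assumes B: "B > 0" and f: "L2_on (prism B a b) f"
  shows "set_integrable lborel {a..b} (coef B a b S k f)"
    and "set_integrable lborel {a..b} (\<lambda>z. (coef B a b S k f z)\<^sup>2)"
proof -
  have m: "coef B a b S k f \<in> borel_measurable borel" by (rule coef_measurable[OF f])
  have "integrable lborel (\<lambda>z. coef B a b S k f z * indicator {a..b} z)"
  proof (rule integrable_mult_of_squares)
    have "set_integrable lborel {a..b} (\<lambda>z. 1 :: real)" by (intro set_integrable_continuous continuous_intros)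
    then show "integrable lborel (\<lambda>z. (indicator {a..b} z :: real)\<^sup>2)"
      unfolding set_integrable_def by (simp add: power2_eq_square indicator_inter_arith[symmetric])
  qed (use m coef_sq_integrable[OF B f] in auto)
  then show "set_integrable lborel {a..b} (coef B a b S k f)"
    unfolding set_integrable_def by (simp add: mult.commute)
  show "set_integrable lborel {a..b} (\<lambda>z. (coef B a b S k f z)\<^sup>2)"
    unfolding set_integrable_def using integrable_mult_indicator[OF _ coef_sq_integrable[OF B f]] by simp
qed

lemma coef_fubini:
  assumes f: "L2_on (prism B a b) f" and \<psi>: "\<psi> \<in> borel_measurable borel" "\<And>z. \<bar>\<psi> z\<bar> \<le> c"
  shows "(LINT p|lborel. zero_ext B a b f p * (trig_prod B S k (fst p) * \<psi> (snd p)))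
    = (LINT z:{a..b}|lborel. coef B a b S k f z * \<psi> z)"
proof -
  have c: "c \<ge> 0" using \<psi>(2)[of 0] by linarith
  have [measurable]: "fst \<in> borel_measurable (borel :: ((real^'a) \<times> real) measure)"
      "snd \<in> borel_measurable (borel :: ((real^'a) \<times> real) measure)"
    by (auto intro!: borel_measurable_continuous_onI continuous_intros)
  have "integrable lborel (\<lambda>p. zero_ext B a b f p * (trig_prod B S k (fst p) * \<psi> (snd p)))"
  proof (rule zero_ext_mult_bounded[OF f])
    show "(\<lambda>p. trig_prod B S k (fst p) * \<psi> (snd p)) \<in> borel_measurable borel"
      using \<psi>(1) by measurable
    show "\<bar>trig_prod B S k (fst p) * \<psi> (snd p)\<bar> \<le> c" for p
      unfolding abs_mult using mult_mono[OF trig_prod_bound[of B S k "fst p"] \<psi>(2)[of "snd p"]] by simp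
  qed
  then have i: "integrable (lborel \<Otimes>\<^sub>M lborel) (\<lambda>(x, z). zero_ext B a b f (x, z) * (trig_prod B S k x * \<psi> z))"
    by (simp add: lborel_prod case_prod_beta')
  have "(LINT p|lborel. zero_ext B a b f p * (trig_prod B S k (fst p) * \<psi> (snd p)))
     = (LINT p|(lborel \<Otimes>\<^sub>M lborel). (\<lambda>(x, z). zero_ext B a b f (x, z) * (trig_prod B S k x * \<psi> z)) p)"
    by (simp add: lborel_prod case_prod_beta')
  also have "\<dots> = (LINT z|lborel. LINT x|lborel. zero_ext B a b f (x, z) * (trig_prod B S k x * \<psi> z))"
    using lborel_pair.integral_snd[OF i] by simp
  also have "\<dots> = (LINT z|lborel. coef B a b S k f z * \<psi> z)"
    by (simp add: coef_def fcoef_def flip: mult.assoc)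
  also have "\<dots> = (LINT z:{a..b}|lborel. coef B a b S k f z * \<psi> z)"
    unfolding set_lebesgue_integral_def
  proof (rule Bochner_Integration.integral_cong[OF refl])
    fix z
    show "coef B a b S k f z * \<psi> z = indicator {a..b} z *\<^sub>R (coef B a b S k f z * \<psi> z)"
      by (cases "z \<in> {a<..<b}") (auto simp: coef_eq_0)
  qed
  finally show ?thesis .
qed

text \<open>Separable functions reduce the admissibility of a test function and its derivatives
  along the axes to one variable. The common margin \<open>h\<close> of the factors, together with
  that of \<open>\<psi>\<close>, gives a compact box inside the prism.\<close>

lemma product_test_function:
  fixes \<theta> \<theta>' :: "'m::finite \<Rightarrow> real \<Rightarrow> real"
  assumes h: "h > 0" and d: "\<And>j x. (\<theta> j has_real_derivative \<theta>' j x) (at x)"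
    and c': "\<And>j. continuous_on UNIV (\<theta>' j)" and z: "\<And>j x. x \<notin> {-B+h..B-h} \<Longrightarrow> \<theta> j x = 0"
    and \<psi>: "C1_test a b \<psi> \<psi>'"
  defines "\<Phi> \<equiv> \<lambda>p :: (real^'m) \<times> real. (\<Prod>j\<in>UNIV. \<theta> j (fst p $ j)) * \<psi> (snd p)"
  shows "test_function (prism B a b) \<Phi>"
    and "frechet_derivative \<Phi> (at p) (axis i 1, 0) = \<theta>' i (fst p $ i) * (\<Prod>l\<in>UNIV-{i}. \<theta> l (fst p $ l)) * \<psi> (snd p)"
    and "frechet_derivative \<Phi> (at p) (0, 1) = (\<Prod>j\<in>UNIV. \<theta> j (fst p $ j)) * \<psi>' (snd p)"
proof -
  define D where "D p v = (\<Sum>i\<in>UNIV. (\<theta>' i (fst p $ i) * (fst v $ i)) * (\<Prod>l\<in>UNIV-{i}. \<theta> l (fst p $ l))) * \<psi> (snd p)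
     + (\<Prod>j\<in>UNIV. \<theta> j (fst p $ j)) * (\<psi>' (snd p) * snd v)" for p v :: "(real^'m) \<times> real"
  have dt: "((\<lambda>p. \<theta> j (fst p $ j)) has_derivative (\<lambda>v. \<theta>' j (fst p $ j) * (fst v $ j))) (at p)" for j and p :: "(real^'m) \<times> real"
  proof -
    have "(\<theta> j has_derivative (*) (\<theta>' j (fst p $ j))) (at (fst p $ j))"
      using d[of j] by (simp add: has_field_derivative_def)
    moreover have "((\<lambda>p::(real^'m) \<times> real. fst p $ j) has_derivative (\<lambda>v. fst v $ j)) (at p)"
      by (intro bounded_linear_imp_has_derivative bounded_linear_compose[OF bounded_linear_vec_nth bounded_linear_fst])
    ultimately show ?thesis using diff_chain_at[of "\<lambda>p. fst p $ j" "\<lambda>v. fst v $ j" p "\<theta> j"] by (simp add: o_def)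
  qed
  have dp: "((\<lambda>p. \<psi> (snd p)) has_derivative (\<lambda>v. \<psi>' (snd p) * snd v)) (at p)" for p :: "(real^'m) \<times> real"
  proof -
    have "(\<psi> has_derivative (*) (\<psi>' (snd p))) (at (snd p))"
      using \<psi> by (simp add: C1_test_def has_field_derivative_def)
    moreover have "((\<lambda>p::(real^'m) \<times> real. snd p) has_derivative (\<lambda>v. snd v)) (at p)"
      by (intro bounded_linear_imp_has_derivative bounded_linear_snd)
    ultimately show ?thesis using diff_chain_at[of snd snd p \<psi>] by (simp add: o_def)
  qed
  have D: "(\<Phi> has_derivative D p) (at p)" for p
    unfolding \<Phi>_def D_def[abs_def]
    by (rule has_derivative_eq_rhs[OF has_derivative_mult[OF has_derivative_prod[OF dt] dp]])
      (auto simp: algebra_simps)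
  have fd: "frechet_derivative \<Phi> (at p) = D p" for p using frechet_derivative_at[OF D] by simp
  have c\<theta>: "continuous_on A (\<theta> j)" for j A
    using d by (meson DERIV_isCont continuous_at_imp_continuous_on)
  have c\<psi>: "continuous_on A \<psi>" for A
    using \<psi> unfolding C1_test_def by (meson DERIV_isCont continuous_at_imp_continuous_on)
  have c\<psi>': "continuous_on UNIV \<psi>'" using \<psi> by (simp add: C1_test_def)
  have cD: "continuous_on UNIV (\<lambda>p. D p v)" for v
    unfolding D_def
    by (intro continuous_intros continuous_on_compose2[OF c\<theta>, of UNIV] continuous_on_compose2[OF c']
        continuous_on_compose2[OF c\<psi>, of UNIV] continuous_on_compose2[OF c\<psi>']) auto
  obtain \<delta> where \<delta>: "\<delta> > 0" "\<And>x. x \<notin> {a+\<delta>..b-\<delta>} \<Longrightarrow> \<psi> x = 0" using \<psi> unfolding C1_test_def by blast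
  define K where "K = cbox (vec (-B+h) :: real^'m, a+\<delta>) (vec (B-h), b-\<delta>)"
  have K: "compact K" unfolding K_def by (rule compact_cbox)
  have sub: "{p. \<Phi> p \<noteq> 0} \<subseteq> K"
  proof
    fix p assume "p \<in> {p. \<Phi> p \<noteq> 0}"
    then have "\<theta> j (fst p $ j) \<noteq> 0" "\<psi> (snd p) \<noteq> 0" for j by (auto simp: \<Phi>_def)
    then have "fst p $ j \<in> {-B+h..B-h}" "snd p \<in> {a+\<delta>..b-\<delta>}" for j using z \<delta>(2) by blast+
    then show "p \<in> K" unfolding K_def cbox_Pair_eq by (cases p) (auto simp: mem_box_cart)
  qed
  have cl: "closure {p. \<Phi> p \<noteq> 0} \<subseteq> K"
    using sub compact_imp_closed[OF K] by (rule closure_minimal)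
  have KU: "K \<subseteq> prism B a b"
  proof
    fix p assume "p \<in> K"
    then have "-B + h \<le> fst p $ j" "fst p $ j \<le> B - h" "a + \<delta> \<le> snd p" "snd p \<le> b - \<delta>" for j
      unfolding K_def cbox_Pair_eq by (cases p; auto simp: mem_box_cart)+
    then have "-B < fst p $ j" "fst p $ j < B" "a < snd p" "snd p < b" for j
      using h \<delta>(1) by (smt (verit))+
    then show "p \<in> prism B a b" by (simp add: prism_def face_def)
  qed
  have "compact (closure {p. \<Phi> p \<noteq> 0})"
    using compact_Int_closed[OF K closed_closure] cl by (metis Int_absorb1)
  then show "test_function (prism B a b) \<Phi>"
    unfolding test_function_def using D cD cl KU by blast
  show "frechet_derivative \<Phi> (at p) (axis i 1, 0) = \<theta>' i (fst p $ i) * (\<Prod>l\<in>UNIV-{i}. \<theta> l (fst p $ l)) * \<psi> (snd p)"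
  proof -
    have "(\<Sum>j\<in>UNIV. (\<theta>' j (fst p $ j) * (axis i 1 $ j)) * (\<Prod>l\<in>UNIV-{j}. \<theta> l (fst p $ l)))
      = (\<Sum>j\<in>UNIV. if j = i then \<theta>' i (fst p $ i) * (\<Prod>l\<in>UNIV-{i}. \<theta> l (fst p $ l)) else 0)"
      by (rule sum.cong) (auto simp: axis_def)
    then show ?thesis by (simp add: fd D_def)
  qed
  show "frechet_derivative \<Phi> (at p) (0, 1) = (\<Prod>j\<in>UNIV. \<theta> j (fst p $ j)) * \<psi>' (snd p)"
    by (simp add: fd D_def)
qed

subsection \<open>Weak derivatives of the modes\<close>

definition freq :: "real \<Rightarrow> nat \<Rightarrow> real" where
  "freq B k = real k * pi / (2 * B)"

lemma DERIV_trig: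
  assumes "B > 0"
  shows "(trig B s k has_real_derivative (if s then freq B k else - freq B k) * trig B (\<not> s) k t) (at t)"
  unfolding trig_def[abs_def] using assms
  by (cases s) (auto intro!: derivative_eq_intros simp: freq_def)

text \<open>The sine factor vanishes linearly at both lateral faces, which compensates the
  \<open>1/h\<close> of a differentiated cutoff. The second face follows by reflection, as the angle
  there is an integer multiple of \<open>pi\<close>.\<close>

lemma sin_trig_bound:
  assumes "B > 0" "-B \<le> t" "t \<le> B"
  shows "\<bar>trig B True k t\<bar> \<le> freq B k * (t + B)" "\<bar>trig B True k t\<bar> \<le> freq B k * (B - t)"
proof -
  have f: "freq B k \<ge> 0" using assms by (simp add: freq_def)
  have e: "real k * (pi * (t + B) / (2 * B)) = freq B k * (t + B)" by (simp add: freq_def)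
  show "\<bar>trig B True k t\<bar> \<le> freq B k * (t + B)"
    unfolding trig_def e using abs_sin_x_le_abs_x[of "freq B k * (t + B)"] f assms by (simp add: abs_mult)
  have e2: "freq B k * (t + B) = real k * pi - freq B k * (B - t)"
    using assms by (simp add: freq_def field_simps)
  have "\<bar>sin (real k * pi - freq B k * (B - t))\<bar> \<le> \<bar>sin (freq B k * (B - t))\<bar>"
    unfolding sin_diff by (simp add: abs_mult mult_left_le_one_le)
  also have "\<dots> \<le> freq B k * (B - t)"
    using abs_sin_x_le_abs_x[of "freq B k * (B - t)"] f assms by (simp add: abs_mult)
  finally show "\<bar>trig B True k t\<bar> \<le> freq B k * (B - t)"
    unfolding trig_def e e2 by simp
qed

text \<open>A sequence of widths tending to zero; \<open>Suc\<close> keeps every member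
  positive.\<close>

abbreviation layer_width :: "nat \<Rightarrow> real" where "layer_width n \<equiv> 1 / real (Suc n)"

section \<open>Cutting off at the lateral faces\<close>

lemma eventually_layer_width_interior:
  assumes "-B < x" "x < (B::real)"
  shows "\<forall>\<^sub>F n in sequentially. x \<in> {-B + 2 * layer_width n..B - 2 * layer_width n}"
proof -
  have "(\<lambda>n. 2 * layer_width n) \<longlonglongrightarrow> 2 * 0" by (intro tendsto_intros LIMSEQ_Suc[OF lim_1_over_n])
  then have "\<forall>\<^sub>F n in sequentially. 2 * layer_width n < min (x + B) (B - x)"
    by (rule order_tendstoD(2)) (use assms in auto)
  then show ?thesis by eventually_elim auto
qed

definition cutoff_prod :: "real \<Rightarrow> nat \<Rightarrow> real^'m \<Rightarrow> real" where
  "cutoff_prod B n x = (\<Prod>j\<in>UNIV. cutoff (-B) B (layer_width n) (x $ j))"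

lemma cutoff_prod_bound: "\<bar>cutoff_prod B n x\<bar> \<le> 1"
  unfolding cutoff_prod_def abs_prod by (intro prod_le_1) (auto simp: cutoff_bound)

lemma measurable_cutoff [measurable]: "cutoff a b (layer_width n) \<in> borel_measurable borel"
  "cutoff' a b (layer_width n) \<in> borel_measurable borel"
proof -
  have "continuous_on UNIV (cutoff a b (layer_width n))"
    using DERIV_cutoff[of "layer_width n" a b] by (meson DERIV_isCont continuous_at_imp_continuous_on divide_pos_pos of_nat_0_less_iff zero_less_Suc zero_less_one)
  then show "cutoff a b (layer_width n) \<in> borel_measurable borel" by (rule borel_measurable_continuous_onI)
  show "cutoff' a b (layer_width n) \<in> borel_measurable borel"
    by (intro borel_measurable_continuous_onI continuous_on_cutoff') simp
qed

lemma measurable_fst_snd [measurable]: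
  "fst \<in> borel_measurable (borel :: ((real^'m) \<times> real) measure)"
  "snd \<in> borel_measurable (borel :: ((real^'m) \<times> real) measure)"
  by (auto intro!: borel_measurable_continuous_onI continuous_intros)

lemma measurable_fst_nth [measurable]:
  "(\<lambda>p :: (real^'m) \<times> real. fst p $ j) \<in> borel_measurable borel"
  by (intro borel_measurable_continuous_onI continuous_intros)

lemma cutoff_prod_limit:
  assumes f: "L2_on (prism B a b) f" and g: "g \<in> borel_measurable borel" "\<And>x. \<bar>g x\<bar> \<le> c"
  shows "(\<lambda>n. LINT p|lborel. zero_ext B a b f p * (cutoff_prod B n (fst p) * g p))
    \<longlonglongrightarrow> (LINT p|lborel. zero_ext B a b f p * g p)"
proof (rule integral_dominated_convergence[where w="\<lambda>p. \<bar>zero_ext B a b f p * g p\<bar>"])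
  have [measurable]: "zero_ext B a b f \<in> borel_measurable borel" by (rule zero_ext_measurable[OF f])
  have [measurable]: "g \<in> borel_measurable borel" by (rule g(1))
  show "(\<lambda>p. zero_ext B a b f p * g p) \<in> borel_measurable lborel" by measurable
  show "(\<lambda>p. zero_ext B a b f p * (cutoff_prod B n (fst p) * g p)) \<in> borel_measurable lborel" for n
    unfolding cutoff_prod_def by measurable
  show "integrable lborel (\<lambda>p. \<bar>zero_ext B a b f p * g p\<bar>)"
    using zero_ext_mult_bounded[OF f g] by simp
  show "AE p in lborel. norm (zero_ext B a b f p * (cutoff_prod B n (fst p) * g p)) \<le> \<bar>zero_ext B a b f p * g p\<bar>" for n
  proof (rule AE_I2)
    fix p
    have "\<bar>cutoff_prod B n (fst p)\<bar> * \<bar>zero_ext B a b f p * g p\<bar> \<le> 1 * \<bar>zero_ext B a b f p * g p\<bar>"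
      by (intro mult_right_mono cutoff_prod_bound) simp
    then show "norm (zero_ext B a b f p * (cutoff_prod B n (fst p) * g p)) \<le> \<bar>zero_ext B a b f p * g p\<bar>"
      by (simp add: abs_mult ac_simps)
  qed
  show "AE p in lborel. (\<lambda>n. zero_ext B a b f p * (cutoff_prod B n (fst p) * g p)) \<longlonglongrightarrow> zero_ext B a b f p * g p"
  proof (rule AE_I2)
    fix p :: "(real^'a) \<times> real"
    show "(\<lambda>n. zero_ext B a b f p * (cutoff_prod B n (fst p) * g p)) \<longlonglongrightarrow> zero_ext B a b f p * g p"
    proof (cases "p \<in> prism B a b")
      case True
      have "\<forall>\<^sub>F n in sequentially. \<forall>j\<in>UNIV. fst p $ j \<in> {-B + 2 * layer_width n..B - 2 * layer_width n}"
        using True by (intro eventually_ball_finite ballI eventually_layer_width_interior) (auto simp: prism_def face_def)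
      then have "\<forall>\<^sub>F n in sequentially. zero_ext B a b f p * (cutoff_prod B n (fst p) * g p) = zero_ext B a b f p * g p"
      proof eventually_elim
        case (elim n)
        then have "cutoff_prod B n (fst p) = 1"
          unfolding cutoff_prod_def by (intro prod.neutral ballI cutoff_eq_1) auto
        then show ?case by simp
      qed
      then show ?thesis by (rule tendsto_eventually)
    qed (simp add: zero_ext_def)
  qed
qed

lemma C1_test_bounded:
  assumes "C1_test a b \<psi> \<psi>'"
  shows "\<psi> \<in> borel_measurable borel" "\<psi>' \<in> borel_measurable borel"
    and "\<exists>c. \<forall>x. \<bar>\<psi> x\<bar> \<le> c" "\<exists>c. \<forall>x. \<bar>\<psi>' x\<bar> \<le> c"
proof -
  have d: "(\<psi> has_real_derivative \<psi>' x) (at x)" and c': "continuous_on UNIV \<psi>'" for x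
    using assms by (auto simp: C1_test_def)
  obtain \<delta> where \<delta>: "\<delta> > 0" "\<And>x. x \<notin> {a+\<delta>..b-\<delta>} \<Longrightarrow> \<psi> x = 0" using assms unfolding C1_test_def by blast
  have c: "continuous_on A \<psi>" for A using d by (meson DERIV_isCont continuous_at_imp_continuous_on)
  show "\<psi> \<in> borel_measurable borel" "\<psi>' \<in> borel_measurable borel"
    using c c' by (auto intro: borel_measurable_continuous_onI)
  have z': "\<psi>' x = 0" if "x \<notin> {a+\<delta>..b-\<delta>}" for x
  proof -
    have "open (- {a+\<delta>..b-\<delta>})" by (intro open_Compl closed_atLeastAtMost)
    then have "(\<psi> has_real_derivative 0) (at x)"
      using that \<delta>(2) by (intro has_field_derivative_transform_within_open[of "\<lambda>_. 0" 0 x "- {a+\<delta>..b-\<delta>}" \<psi>]) auto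
    then show ?thesis using d DERIV_unique by blast
  qed
  have bd: "\<exists>c. \<forall>x. \<bar>g x\<bar> \<le> c" if "continuous_on {a+\<delta>..b-\<delta>} g" "\<And>x. x \<notin> {a+\<delta>..b-\<delta>} \<Longrightarrow> g x = 0" for g :: "real \<Rightarrow> real"
  proof -
    have "bounded (g ` {a+\<delta>..b-\<delta>})" using that(1) by (intro compact_imp_bounded compact_continuous_image) auto
    then obtain c where c: "\<And>x. x \<in> {a+\<delta>..b-\<delta>} \<Longrightarrow> \<bar>g x\<bar> \<le> c" unfolding bounded_iff by (metis imageI real_norm_def)
    have "\<bar>g x\<bar> \<le> max c 0" for x using c[of x] that(2)[of x] by (cases "x \<in> {a+\<delta>..b-\<delta>}") auto
    then show ?thesis by blast
  qed
  show "\<exists>c. \<forall>x. \<bar>\<psi> x\<bar> \<le> c" using c \<delta>(2) by (rule bd)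
  show "\<exists>c. \<forall>x. \<bar>\<psi>' x\<bar> \<le> c" using continuous_on_subset[OF c'] z' by (intro bd) auto
qed

text \<open>Differentiation along \<open>i\<close> splits in two. One part has the derivative on the
  cutoff and must be shown to disappear as the layer shrinks; in the other, sine and cosine are
  exchanged in coordinate \<open>i\<close>, which toggles \<open>i\<close> in \<open>S\<close> and
  produces the frequency.\<close>

lemma trig_test_function:
  fixes k :: "nat^'m" and S :: "'m set" and n :: nat
  assumes B: "B > 0" and \<psi>: "C1_test a b \<psi> \<psi>'"
  defines "\<Phi> \<equiv> \<lambda>p. (\<Prod>j\<in>UNIV. cutoff (-B) B (layer_width n) (fst p $ j) * trig B (j \<in> S) (k $ j) (fst p $ j)) * \<psi> (snd p)"
  shows "test_function (prism B a b) \<Phi>"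
    and "\<Phi> p = cutoff_prod B n (fst p) * (trig_prod B S k (fst p) * \<psi> (snd p))"
    and "frechet_derivative \<Phi> (at p) (0, 1) = cutoff_prod B n (fst p) * (trig_prod B S k (fst p) * \<psi>' (snd p))"
    and "frechet_derivative \<Phi> (at p) (axis i 1, 0)
      = cutoff' (-B) B (layer_width n) (fst p $ i) * trig B (i \<in> S) (k $ i) (fst p $ i)
          * (\<Prod>l\<in>UNIV-{i}. cutoff (-B) B (layer_width n) (fst p $ l) * trig B (l \<in> S) (k $ l) (fst p $ l)) * \<psi> (snd p)
        + (if i \<in> S then freq B (k $ i) else - freq B (k $ i))
          * (cutoff_prod B n (fst p) * (trig_prod B (if i \<in> S then S - {i} else insert i S) k (fst p) * \<psi> (snd p)))"
proof -
  let ?\<theta> = "\<lambda>j x. cutoff (-B) B (layer_width n) x * trig B (j \<in> S) (k $ j) x"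
  let ?\<theta>' = "\<lambda>j x. cutoff' (-B) B (layer_width n) x * trig B (j \<in> S) (k $ j) x
      + ((if j \<in> S then freq B (k $ j) else - freq B (k $ j)) * trig B (j \<notin> S) (k $ j) x) * cutoff (-B) B (layer_width n) x"
  have hp: "layer_width n > 0" by simp
  have d: "(?\<theta> j has_real_derivative ?\<theta>' j x) (at x)" for j x
    by (rule DERIV_mult'[OF DERIV_cutoff[OF hp] DERIV_trig[OF B], THEN DERIV_cong]) (simp add: ac_simps)
  have cc: "continuous_on A (cutoff (-B) B (layer_width n))" for A
    using DERIV_cutoff[OF hp] by (meson DERIV_isCont continuous_at_imp_continuous_on)
  have c': "continuous_on UNIV (?\<theta>' j)" for j
    by (intro continuous_intros continuous_on_cutoff' cc hp)
  have z: "?\<theta> j x = 0" if "x \<notin> {-B + layer_width n..B - layer_width n}" for j x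
    using cutoff_eq_0[OF hp, of x "-B" B] that by simp
  note * = product_test_function[where \<theta>="?\<theta>" and \<theta>'="?\<theta>'", OF hp d c' z \<psi>]
  show "test_function (prism B a b) \<Phi>" unfolding \<Phi>_def by (rule *(1))
  show "\<Phi> p = cutoff_prod B n (fst p) * (trig_prod B S k (fst p) * \<psi> (snd p))"
    by (simp add: \<Phi>_def cutoff_prod_def trig_prod_def prod.distrib)
  show "frechet_derivative \<Phi> (at p) (0, 1) = cutoff_prod B n (fst p) * (trig_prod B S k (fst p) * \<psi>' (snd p))"
  proof -
    have "frechet_derivative \<Phi> (at p) (0, 1)
        = (\<Prod>j\<in>UNIV. cutoff (-B) B (layer_width n) (fst p $ j) * trig B (j \<in> S) (k $ j) (fst p $ j)) * \<psi>' (snd p)"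
      unfolding \<Phi>_def by (rule *(3))
    then show ?thesis unfolding cutoff_prod_def trig_prod_def prod.distrib mult.assoc .
  qed
  define R where "R = (\<Prod>l\<in>UNIV-{i}. ?\<theta> l (fst p $ l))"
  have R: "R = (\<Prod>l\<in>UNIV-{i}. cutoff (-B) B (layer_width n) (fst p $ l))
      * (\<Prod>l\<in>UNIV-{i}. trig B (l \<in> (if i \<in> S then S - {i} else insert i S)) (k $ l) (fst p $ l))"
    unfolding R_def prod.distrib[symmetric] by (rule prod.cong) auto
  have "cutoff_prod B n (fst p) = cutoff (-B) B (layer_width n) (fst p $ i) * (\<Prod>l\<in>UNIV-{i}. cutoff (-B) B (layer_width n) (fst p $ l))"
    unfolding cutoff_prod_def by (subst prod.remove[of UNIV i]) auto
  moreover have "trig_prod B (if i \<in> S then S - {i} else insert i S) k (fst p)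
      = trig B (i \<notin> S) (k $ i) (fst p $ i)
        * (\<Prod>l\<in>UNIV-{i}. trig B (l \<in> (if i \<in> S then S - {i} else insert i S)) (k $ l) (fst p $ l))"
    unfolding trig_prod_def by (subst prod.remove[of UNIV i]) auto
  ultimately have T: "trig B (i \<notin> S) (k $ i) (fst p $ i) * cutoff (-B) B (layer_width n) (fst p $ i) * R
      = cutoff_prod B n (fst p) * trig_prod B (if i \<in> S then S - {i} else insert i S) k (fst p)"
    unfolding R by simp
  have gen: "(A + (w*t)*c)*R*q = A*R*q + w*(C*(P*q))" if "t*c*R = C*P" for A w t c q C P :: real
  proof -
    have "(A + (w*t)*c)*R*q = A*R*q + w*(t*c*R)*q" by (simp add: algebra_simps)
    then show ?thesis unfolding that by simp
  qed
  have F: "frechet_derivative \<Phi> (at p) (axis i 1, 0) = ?\<theta>' i (fst p $ i) * R * \<psi> (snd p)"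
    unfolding \<Phi>_def R_def by (rule *(2))
  show "frechet_derivative \<Phi> (at p) (axis i 1, 0)
      = cutoff' (-B) B (layer_width n) (fst p $ i) * trig B (i \<in> S) (k $ i) (fst p $ i)
          * (\<Prod>l\<in>UNIV-{i}. cutoff (-B) B (layer_width n) (fst p $ l) * trig B (l \<in> S) (k $ l) (fst p $ l)) * \<psi> (snd p)
        + (if i \<in> S then freq B (k $ i) else - freq B (k $ i))
          * (cutoff_prod B n (fst p) * (trig_prod B (if i \<in> S then S - {i} else insert i S) k (fst p) * \<psi> (snd p)))"
    unfolding F R_def[symmetric] by (rule gen[OF T])
qed

text \<open>The lateral cutoffs do not depend on \<open>z\<close>, so differentiation in
  \<open>z\<close> creates no remainder and the cutoff is removed by dominated convergence.\<close>

lemma coef_weak_z: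
  assumes B: "B > 0" and f: "L2_on (prism B a b) f" and g: "L2_on (prism B a b) g"
    and w: "weak_deriv (prism B a b) f (0, 1) g" and \<psi>: "C1_test a b \<psi> \<psi>'"
  shows "(LINT z:{a..b}|lborel. coef B a b S k f z * \<psi>' z) = - (LINT z:{a..b}|lborel. coef B a b S k g z * \<psi> z)"
proof -
  obtain c c' where c: "\<And>x. \<bar>\<psi> x\<bar> \<le> c" "\<And>x. \<bar>\<psi>' x\<bar> \<le> c'" using C1_test_bounded(3,4)[OF \<psi>] by blast
  note [measurable] = C1_test_bounded(1,2)[OF \<psi>]
  have bd: "\<bar>trig_prod B S k x * u\<bar> \<le> d" if "\<bar>u\<bar> \<le> d" for x u d
    unfolding abs_mult using mult_mono[OF trig_prod_bound[of B S k x] that] by simp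
  have "(LINT p|lborel. zero_ext B a b f p * (cutoff_prod B n (fst p) * (trig_prod B S k (fst p) * \<psi>' (snd p))))
      = - (LINT p|lborel. zero_ext B a b g p * (cutoff_prod B n (fst p) * (trig_prod B S k (fst p) * \<psi> (snd p))))" for n
    using w trig_test_function(1)[OF B \<psi>, of n S k]
    unfolding weak_deriv_def LINT_prism_zero_ext trig_test_function(2-3)[OF B \<psi>, symmetric] by blast
  moreover have "(\<lambda>n. LINT p|lborel. zero_ext B a b f p * (cutoff_prod B n (fst p) * (trig_prod B S k (fst p) * \<psi>' (snd p))))
      \<longlonglongrightarrow> (LINT p|lborel. zero_ext B a b f p * (trig_prod B S k (fst p) * \<psi>' (snd p)))"
    by (rule cutoff_prod_limit[OF f _ bd[OF c(2)]]) measurable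
  moreover have "(\<lambda>n. - (LINT p|lborel. zero_ext B a b g p * (cutoff_prod B n (fst p) * (trig_prod B S k (fst p) * \<psi> (snd p)))))
      \<longlonglongrightarrow> - (LINT p|lborel. zero_ext B a b g p * (trig_prod B S k (fst p) * \<psi> (snd p)))"
    by (intro tendsto_minus cutoff_prod_limit[OF g _ bd[OF c(1)]]) measurable
  ultimately have "(LINT p|lborel. zero_ext B a b f p * (trig_prod B S k (fst p) * \<psi>' (snd p)))
      = - (LINT p|lborel. zero_ext B a b g p * (trig_prod B S k (fst p) * \<psi> (snd p)))"
    by (simp add: LIMSEQ_unique)
  then show ?thesis
    using coef_fubini[where \<psi>=\<psi>', OF f C1_test_bounded(2)[OF \<psi>] c(2), of S k]
      coef_fubini[where \<psi>=\<psi>, OF g C1_test_bounded(1)[OF \<psi>] c(1), of S k] by simp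
qed


text \<open>The cutoff derivative is at most \<open>4/h\<close> and lives within \<open>2*h\<close>
  of the faces, where the sine is at most \<open>freq B k * 2*h\<close>. The product is bounded by
  \<open>8 * freq B k\<close> and eventually zero at every interior point, so dominated convergence
  applies.\<close>

lemma lateral_remainder_sin:
  assumes B: "B > 0" and f: "L2_on (prism B a b) f"
    and R: "\<And>n. R n \<in> borel_measurable borel" "\<And>n p. \<bar>R n p\<bar> \<le> c"
  shows "(\<lambda>n. LINT p|lborel. zero_ext B a b f p * (cutoff' (-B) B (layer_width n) (fst p $ i) * trig B True k (fst p $ i) * R n p)) \<longlonglongrightarrow> 0"
proof -
  have [measurable]: "zero_ext B a b f \<in> borel_measurable borel" by (rule zero_ext_measurable[OF f])
  note R(1)[measurable]
  define K where "K = 8 * freq B k"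
  have K: "K \<ge> 0" using B by (simp add: K_def freq_def)
  have c: "c \<ge> 0" using R(2)[of 0 undefined] by linarith
  have bd: "\<bar>cutoff' (-B) B (layer_width n) t * trig B True k t\<bar> \<le> K" if t: "-B \<le> t" "t \<le> B" for n t
  proof (cases "t \<in> {-B + 2 * layer_width n..B - 2 * layer_width n}")
    case True
    then have "cutoff' (-B) B (layer_width n) t = 0" by (intro cutoff'_eq_0) auto
    then show ?thesis using K by simp
  next
    case False
    have fr: "freq B k \<ge> 0" using B by (simp add: freq_def)
    have "t + B \<le> 2 * layer_width n \<or> B - t \<le> 2 * layer_width n" using False by auto
    then have "freq B k * (t + B) \<le> freq B k * (2 * layer_width n) \<or> freq B k * (B - t) \<le> freq B k * (2 * layer_width n)"
      using mult_left_mono[OF _ fr] by blast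
    then have "\<bar>trig B True k t\<bar> \<le> freq B k * (2 * layer_width n)"
      using sin_trig_bound[OF B t, of k] by linarith
    then have "\<bar>cutoff' (-B) B (layer_width n) t\<bar> * \<bar>trig B True k t\<bar> \<le> (4 / layer_width n) * (freq B k * (2 * layer_width n))"
      using cutoff'_bound[of "layer_width n" "-B" B t] by (intro mult_mono) auto
    also have "\<dots> = 8 * freq B k"
    proof -
      have "(4 / h) * (u * (2 * h)) = 8 * u" if "h > 0" for h u :: real using that by simp
      then show ?thesis by (simp only: zero_less_divide_1_iff of_nat_0_less_iff zero_less_Suc)
    qed
    finally show ?thesis unfolding abs_mult K_def .
  qed
  have "(\<lambda>n. LINT p|lborel. zero_ext B a b f p * (cutoff' (-B) B (layer_width n) (fst p $ i) * trig B True k (fst p $ i) * R n p))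
      \<longlonglongrightarrow> (LINT p|(lborel :: ((real^'a) \<times> real) measure). 0)"
  proof (rule integral_dominated_convergence[where w="\<lambda>p. \<bar>zero_ext B a b f p * (K * c)\<bar>"])
    show "integrable lborel (\<lambda>p. \<bar>zero_ext B a b f p * (K * c)\<bar>)"
      using zero_ext_mult_bounded[OF f, of "\<lambda>_. K * c" "\<bar>K * c\<bar>"] by simp
    show "(\<lambda>p. zero_ext B a b f p * (cutoff' (-B) B (layer_width n) (fst p $ i) * trig B True k (fst p $ i) * R n p)) \<in> borel_measurable lborel" for n
      by measurable
    show "AE p in lborel. norm (zero_ext B a b f p * (cutoff' (-B) B (layer_width n) (fst p $ i) * trig B True k (fst p $ i) * R n p))
        \<le> \<bar>zero_ext B a b f p * (K * c)\<bar>" for n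
    proof (rule AE_I2)
      fix p :: "(real^'a) \<times> real"
      show "norm (zero_ext B a b f p * (cutoff' (-B) B (layer_width n) (fst p $ i) * trig B True k (fst p $ i) * R n p)) \<le> \<bar>zero_ext B a b f p * (K * c)\<bar>"
      proof (cases "p \<in> prism B a b")
        case True
        then have "-B < fst p $ i" "fst p $ i < B" by (auto simp: prism_def face_def)
        then have "\<bar>cutoff' (-B) B (layer_width n) (fst p $ i) * trig B True k (fst p $ i)\<bar> * \<bar>R n p\<bar> \<le> K * c"
          using R(2) c K by (intro mult_mono bd) auto
        then have "\<bar>zero_ext B a b f p\<bar> * (\<bar>cutoff' (-B) B (layer_width n) (fst p $ i) * trig B True k (fst p $ i)\<bar> * \<bar>R n p\<bar>)
            \<le> \<bar>zero_ext B a b f p\<bar> * (K * c)"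
          by (intro mult_left_mono) auto
        then show ?thesis using K c by (simp add: abs_mult)
      qed (simp add: zero_ext_def)
    qed
    show "AE p in lborel. (\<lambda>n. zero_ext B a b f p * (cutoff' (-B) B (layer_width n) (fst p $ i) * trig B True k (fst p $ i) * R n p)) \<longlonglongrightarrow> 0"
    proof (rule AE_I2)
      fix p :: "(real^'a) \<times> real"
      show "(\<lambda>n. zero_ext B a b f p * (cutoff' (-B) B (layer_width n) (fst p $ i) * trig B True k (fst p $ i) * R n p)) \<longlonglongrightarrow> 0"
      proof (cases "p \<in> prism B a b")
        case True
        then have "-B < fst p $ i" "fst p $ i < B" by (auto simp: prism_def face_def)
        from eventually_layer_width_interior[OF this]
        have "\<forall>\<^sub>F n in sequentially. zero_ext B a b f p * (cutoff' (-B) B (layer_width n) (fst p $ i) * trig B True k (fst p $ i) * R n p) = 0"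
        proof eventually_elim
          case (elim n)
          then have "cutoff' (-B) B (layer_width n) (fst p $ i) = 0" by (intro cutoff'_eq_0) auto
          then show ?case by simp
        qed
        then show ?thesis by (rule tendsto_eventually)
      qed (simp add: zero_ext_def)
    qed
  qed simp
  then show ?thesis by simp
qed

definition lateral_layer :: "real \<Rightarrow> 'm \<Rightarrow> real \<Rightarrow> ((real^'m) \<times> real) set" where
  "lateral_layer B i h = {p. fst p $ i < -B + h} \<union> {p. B - h < fst p $ i}"

lemma lateral_layer_sets [measurable]: "lateral_layer B i h \<in> sets borel"
  unfolding lateral_layer_def
  by (intro borel_open open_Un open_Collect_less continuous_intros)

text \<open>The layer is covered by two boxes with one side of length \<open>h\<close>. A volume of
  order \<open>h\<close> balances one half of the factor \<open>1/h\<close> of the cutoff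
  derivative; the mean squares over the layer balance the other half.\<close>

lemma lateral_layer_volume:
  fixes i :: "'m::finite"
  assumes B: "B > 0" and ab: "a < b"
  obtains V where "V \<ge> 0" "\<And>h. h > 0 \<Longrightarrow>
    (LINT p|lborel. indicator (prism B a b \<inter> lateral_layer B i h) p) \<le> V * h"
proof -
  define V where "V = 2 * (2*B) ^ (CARD('m) - 1) * (b - a)"
  have V: "V \<ge> 0" using B ab by (simp add: V_def)
  have "(LINT p|lborel. indicator (prism B a b \<inter> lateral_layer B i h) p) \<le> V * h" if h: "h > 0" for h
  proof -
    have strip: "integrable lborel (\<lambda>p::(real^'m) \<times> real. indicator {x. \<forall>j. x $ j \<in> I j} (fst p) * indicator {a<..<b} (snd p) :: real)"
      "(LINT p|lborel. indicator {x::real^'m. \<forall>j. x $ j \<in> I j} (fst p) * indicator {a<..<b} (snd p))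
        = h * (2*B) ^ (CARD('m) - 1) * (b - a)"
      if I: "\<And>j. I j = (if j = i then {c<..<c+h} else {-B<..<B})" for I c
    proof -
      have ind: "indicator {x::real^'m. \<forall>j. x $ j \<in> I j} x = (\<Prod>j\<in>UNIV. indicator (I j) (x $ j) :: real)" for x
      proof (cases "\<forall>j. x $ j \<in> I j")
        case False
        then obtain j where "x $ j \<notin> I j" by auto
        then have "(\<Prod>j\<in>UNIV. indicator (I j) (x $ j) :: real) = 0"
          by (intro prod_zero) (auto intro!: bexI[of _ j] exI[of _ j])
        then show ?thesis using False by simp
      qed simp
      have iI: "integrable lborel (indicator (I j) :: real \<Rightarrow> real)" for j
        unfolding I using h B by (intro integrable_real_indicator) auto
      have mI: "(LINT t|lborel. indicator (I j) t) = (if j = i then h else 2*B)" for j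
        unfolding I using h B by simp
      have i1: "integrable lborel (\<lambda>x::real^'m. indicator {x. \<forall>j. x $ j \<in> I j} x :: real)"
        unfolding ind by (rule lborel_vec_prod(1)[OF iI])
      have "(LINT x|(lborel :: (real^'m) measure). indicator {x. \<forall>j. x $ j \<in> I j} x) = (\<Prod>j\<in>UNIV. if j = i then h else 2*B)"
        unfolding ind lborel_vec_prod(2)[OF iI] mI ..
      also have "\<dots> = h * (2*B) ^ (CARD('m) - 1)"
        by (subst prod.remove[of UNIV i]) (auto simp: card_Diff_singleton)
      finally have v: "(LINT x|(lborel :: (real^'m) measure). indicator {x. \<forall>j. x $ j \<in> I j} x) = h * (2*B) ^ (CARD('m) - 1)" .
      have i2: "integrable lborel (indicator {a<..<b} :: real \<Rightarrow> real)"
        using ab by (intro integrable_real_indicator) auto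
      have "integrable (lborel \<Otimes>\<^sub>M lborel) (\<lambda>(x::real^'m, z). indicator {x. \<forall>j. x $ j \<in> I j} x * indicator {a<..<b} z :: real)"
        using i1 i2 by (intro lborel_pair.Fubini_integrable) (auto simp: abs_mult)
      note P = this
      show "integrable lborel (\<lambda>p::(real^'m) \<times> real. indicator {x. \<forall>j. x $ j \<in> I j} (fst p) * indicator {a<..<b} (snd p) :: real)"
        using P by (simp add: lborel_prod case_prod_beta')
      have "(LINT p|lborel. indicator {x::real^'m. \<forall>j. x $ j \<in> I j} (fst p) * indicator {a<..<b} (snd p))
        = (LINT x|lborel. LINT z|lborel. indicator {x::real^'m. \<forall>j. x $ j \<in> I j} x * indicator {a<..<b} z :: real)"
        using lborel_pair.integral_fst'[OF P] by (simp add: lborel_prod case_prod_beta')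
      also have "\<dots> = (LINT x|lborel. indicator {x::real^'m. \<forall>j. x $ j \<in> I j} x * (b - a))"
        using ab by simp
      also have "\<dots> = h * (2*B) ^ (CARD('m) - 1) * (b - a)"
        unfolding integral_mult_left_zero v ..
      finally show "(LINT p|lborel. indicator {x::real^'m. \<forall>j. x $ j \<in> I j} (fst p) * indicator {a<..<b} (snd p))
        = h * (2*B) ^ (CARD('m) - 1) * (b - a)" .
    qed
    define I1 where "I1 j = (if j = i then {-B<..<-B+h} else {-B<..<B})" for j
    define I2 where "I2 j = (if j = i then {B-h<..<(B-h)+h} else {-B<..<B})" for j
    note s1 = strip[of I1 "-B", OF I1_def] and s2 = strip[of I2 "B-h", OF I2_def]
    let ?J = "\<lambda>I p. indicator {x::real^'m. \<forall>j. x $ j \<in> I j} (fst p) * indicator {a<..<b} (snd p) :: real"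
    have "(LINT p|lborel. indicator (prism B a b \<inter> lateral_layer B i h) p) \<le> (LINT p|lborel. ?J I1 p + ?J I2 p)"
    proof (rule integral_mono)
      have "integrable lborel (\<lambda>p. indicator (prism B a b) p * indicator (lateral_layer B i h) p :: real)"
        by (rule Bochner_Integration.integrable_bound[OF integrable_indicator_prism[of B a b]])
          (auto simp: indicator_def)
      then show "integrable lborel (indicator (prism B a b \<inter> lateral_layer B i h) :: (real^'m) \<times> real \<Rightarrow> real)"
        unfolding indicator_inter_arith[symmetric] .
      show "integrable lborel (\<lambda>p. ?J I1 p + ?J I2 p)" using s1(1) s2(1) by (rule Bochner_Integration.integrable_add)
      fix p :: "(real^'m) \<times> real"
      show "indicator (prism B a b \<inter> lateral_layer B i h) p \<le> ?J I1 p + ?J I2 p"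
      proof (cases "p \<in> prism B a b \<inter> lateral_layer B i h")
        case True
        then have p: "\<And>j. -B < fst p $ j \<and> fst p $ j < B" "a < snd p" "snd p < b"
          and "fst p $ i < -B + h \<or> B - h < fst p $ i"
          by (auto simp: prism_def face_def lateral_layer_def)
        then have "(\<forall>j. fst p $ j \<in> I1 j) \<or> (\<forall>j. fst p $ j \<in> I2 j)"
          by (auto simp: I1_def I2_def)
        then have "?J I1 p = 1 \<or> ?J I2 p = 1" using p by auto
        moreover have "?J I1 p \<ge> 0" "?J I2 p \<ge> 0" by auto
        ultimately have "1 \<le> ?J I1 p + ?J I2 p" by linarith
        then show ?thesis using True by simp
      qed simp
    qed
    also have "\<dots> = V * h"
      unfolding Bochner_Integration.integral_add[OF s1(1) s2(1)] s1(2) s2(2) V_def by simp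
    finally show ?thesis .
  qed
  with V show ?thesis by (rule that)
qed

lemma LINT_prism_layer:
  "(LINT p:(prism B a b \<inter> L)|lborel. (f p)\<^sup>2) = (LINT p|lborel. (zero_ext B a b f p)\<^sup>2 * indicator L p)"
  unfolding set_lebesgue_integral_def
  by (rule Bochner_Integration.integral_cong) (auto simp: zero_ext_def indicator_def)

text \<open>A cosine does not vanish at the faces, so the decay has to come from \<open>f\<close>. A
  weighted inequality \<open>\<bar>f\<bar> <= t/2 * f^2 + 1/(2*t)\<close> replaces Cauchy-Schwarz:
  the first part is \<open>4*c*t\<close> times the mean square over the layer and tends to zero for
  fixed \<open>t\<close>, the second is \<open>4*c*V/t\<close> by the volume of the layer.\<close>

lemma lateral_remainder_layer:
  assumes B: "B > 0" and ab: "a < b" and f: "L2_on (prism B a b) f"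
    and R: "\<And>n. R n \<in> borel_measurable borel" "\<And>n p. \<bar>R n p\<bar> \<le> c"
    and layer: "(\<lambda>n. (1 / (2 * layer_width n)) * (LINT p|lborel. (zero_ext B a b f p)\<^sup>2 * indicator (lateral_layer B i (2 * layer_width n)) p)) \<longlonglongrightarrow> 0"
  shows "(\<lambda>n. LINT p|lborel. zero_ext B a b f p * (cutoff' (-B) B (layer_width n) (fst p $ i) * trig B s k (fst p $ i) * R n p)) \<longlonglongrightarrow> 0"
proof -
  have mf[measurable]: "zero_ext B a b f \<in> borel_measurable borel" by (rule zero_ext_measurable[OF f])
  note R(1)[measurable]
  have c: "c \<ge> 0" using R(2)[of 0 undefined] by linarith
  obtain V where V: "V \<ge> 0" and vol: "\<And>h. h > 0 \<Longrightarrow>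
    (LINT p|lborel. indicator (prism B a b \<inter> lateral_layer B i h) p) \<le> V * h"
    using lateral_layer_volume[OF B ab] by blast
  let ?L = "\<lambda>n. lateral_layer B i (2 * layer_width n)"
  let ?A = "\<lambda>n. (1 / (2 * layer_width n)) * (LINT p|lborel. (zero_ext B a b f p)\<^sup>2 * indicator (?L n) p)"
  let ?T = "\<lambda>n. LINT p|lborel. zero_ext B a b f p * (cutoff' (-B) B (layer_width n) (fst p $ i) * trig B s k (fst p $ i) * R n p)"
  have i1: "integrable lborel (\<lambda>p. (zero_ext B a b f p)\<^sup>2 * indicator (?L n) p)" for n
    by (rule Bochner_Integration.integrable_bound[OF zero_ext_integrable[OF f]]) (auto simp: indicator_def)
  have i2: "integrable lborel (indicator (prism B a b \<inter> ?L n) :: (real^'a) \<times> real \<Rightarrow> real)" for n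
    unfolding indicator_inter_arith
    by (rule Bochner_Integration.integrable_bound[OF integrable_indicator_prism[of B a b]]) (auto simp: indicator_def)
  have bound: "\<bar>?T n\<bar> \<le> 4 * c * t * ?A n + 4 * c * V / t" if t: "t > 0" for t n
  proof -
    define h where "h = layer_width n"
    have h: "h > 0" by (simp add: h_def)
    let ?q = "\<lambda>p. cutoff' (-B) B h (fst p $ i) * trig B s k (fst p $ i) * R n p"
    let ?w = "\<lambda>p. (4 * c / h) * (t / 2) * ((zero_ext B a b f p)\<^sup>2 * indicator (?L n) p)
       + (4 * c / h) * (1 / (2 * t)) * indicator (prism B a b \<inter> ?L n) p"
    have iw: "integrable lborel ?w"
      by (intro Bochner_Integration.integrable_add integrable_mult_right i1 i2)
    have pw: "\<bar>zero_ext B a b f p * ?q p\<bar> \<le> ?w p" for p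
    proof (cases "p \<in> prism B a b \<and> p \<in> ?L n")
      case True
      have "\<bar>?q p\<bar> \<le> (4 / h) * 1 * c"
        unfolding abs_mult using cutoff'_bound[OF h] trig_bound R(2) c h
        by (intro mult_mono) auto
      then have "\<bar>zero_ext B a b f p\<bar> * \<bar>?q p\<bar> \<le> \<bar>zero_ext B a b f p\<bar> * (4 * c / h)"
        by (intro mult_left_mono) auto
      also have "\<dots> \<le> (t / 2 * (zero_ext B a b f p)\<^sup>2 + 1 / (2 * t)) * (4 * c / h)"
      proof (rule mult_right_mono)
        have "2 * (t * \<bar>zero_ext B a b f p\<bar>) * 1 \<le> (t * \<bar>zero_ext B a b f p\<bar>)\<^sup>2 + 1\<^sup>2" by (rule sum_squares_bound)
        then have "(2 * t) * \<bar>zero_ext B a b f p\<bar> \<le> t\<^sup>2 * (zero_ext B a b f p)\<^sup>2 + 1" by (simp add: power_mult_distrib)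
        then have "\<bar>zero_ext B a b f p\<bar> \<le> (t\<^sup>2 * (zero_ext B a b f p)\<^sup>2 + 1) / (2 * t)"
          using t by (simp add: pos_le_divide_eq mult.commute)
        also have "\<dots> = t / 2 * (zero_ext B a b f p)\<^sup>2 + 1 / (2 * t)"
          using t by (simp add: add_divide_distrib power2_eq_square)
        finally show "\<bar>zero_ext B a b f p\<bar> \<le> t / 2 * (zero_ext B a b f p)\<^sup>2 + 1 / (2 * t)" .
        show "0 \<le> 4 * c / h" using c h by simp
      qed
      also have "\<dots> = ?w p" using True by (simp add: algebra_simps)
      finally show ?thesis by (simp add: abs_mult)
    next
      case False
      have "zero_ext B a b f p * ?q p = 0"
      proof (cases "p \<in> prism B a b")
        case True
        then have "fst p $ i \<in> {-B + 2 * h..B - 2 * h}" using False by (auto simp: lateral_layer_def h_def)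
        then show ?thesis using cutoff'_eq_0[OF h, of "fst p $ i" "-B" B] by simp
      qed (simp add: zero_ext_def)
      moreover have "0 \<le> ?w p" using c h t by (intro add_nonneg_nonneg mult_nonneg_nonneg) auto
      ultimately show ?thesis by (simp only: abs_zero)
    qed
    have mq: "(\<lambda>p. zero_ext B a b f p * ?q p) \<in> borel_measurable lborel" unfolding h_def by measurable
    have iq: "integrable lborel (\<lambda>p. zero_ext B a b f p * ?q p)"
    proof (rule Bochner_Integration.integrable_bound[OF iw mq], rule AE_I2)
      show "norm (zero_ext B a b f p * ?q p) \<le> norm (?w p)" for p
        unfolding real_norm_def by (rule order_trans[OF pw abs_ge_self])
    qed
    have "\<bar>?T n\<bar> \<le> (LINT p|lborel. \<bar>zero_ext B a b f p * ?q p\<bar>)"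
      unfolding h_def[symmetric] using integral_norm_bound[of lborel "\<lambda>p. zero_ext B a b f p * ?q p"] by simp
    also have "\<dots> \<le> (LINT p|lborel. ?w p)" by (rule integral_mono[OF _ iw pw]) (use iq in simp)
    also have "\<dots> = (4 * c / h) * (t / 2) * (LINT p|lborel. (zero_ext B a b f p)\<^sup>2 * indicator (?L n) p)
       + (4 * c / h) * (1 / (2 * t)) * (LINT p|lborel. indicator (prism B a b \<inter> ?L n) p)"
      unfolding Bochner_Integration.integral_add[OF integrable_mult_right[OF i1] integrable_mult_right[OF i2]]
        integral_mult_right_zero ..
    also have "\<dots> \<le> (4 * c / h) * (t / 2) * (LINT p|lborel. (zero_ext B a b f p)\<^sup>2 * indicator (?L n) p)
       + (4 * c / h) * (1 / (2 * t)) * (V * (2 * h))"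
      using vol[of "2 * layer_width n"] c h t by (intro add_left_mono mult_left_mono) (auto simp: h_def)
    also have "\<dots> = 4 * c * t * ?A n + 4 * c * V / t"
      unfolding h_def[symmetric] using h t by (simp add: field_simps)
    finally show ?thesis .
  qed
  show ?thesis
  proof (rule LIMSEQ_I)
    fix e :: real assume e: "e > 0"
    \<comment> \<open>Large enough that the volume part \<open>4*c*V/t\<close> is below
      \<open>e/2\<close>; the summand 1 keeps \<open>t\<close> positive.\<close>
    define t where "t = 8 * c * V / e + 1"
    have t: "t > 0" using c V e by (simp add: t_def add_nonneg_pos)
    have "8 * c * V < t * e" using e by (simp add: t_def field_simps)
    then have 1: "4 * c * V / t < e / 2" using t by (simp add: field_simps)
    have "(\<lambda>n. 4 * c * t * ?A n) \<longlonglongrightarrow> 4 * c * t * 0" by (intro tendsto_intros layer)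
    then have "\<forall>\<^sub>F n in sequentially. 4 * c * t * ?A n < e / 2"
      by (rule order_tendstoD(2)) (use e in auto)
    then have "\<forall>\<^sub>F n in sequentially. norm (?T n - 0) < e"
    proof eventually_elim
      case (elim n)
      then show ?case using bound[OF t, of n] 1 by simp
    qed
    then show "\<exists>N. \<forall>n\<ge>N. norm (?T n - 0) < e" by (simp add: eventually_sequentially)
  qed
qed

text \<open>The remainder of the cutoff disappears for one of two reasons: the test function has a
  sine in \<open>x_i\<close>, or the mean squares of \<open>f\<close> over the lateral layers tend
  to zero. The first alternative is what allows a second differentiation with no boundary
  information on the first derivative.\<close>

lemma coef_weak_lateral:
  fixes f g :: "(real^'m) \<times> real \<Rightarrow> real"
  assumes B: "B > 0" and ab: "a < b" and f: "L2_on (prism B a b) f" and g: "L2_on (prism B a b) g"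
    and w: "weak_deriv (prism B a b) f (axis i 1, 0) g"
    and layer: "i \<in> S \<or> (\<lambda>n. (1 / (2 * layer_width n)) *
      (LINT p|lborel. (zero_ext B a b f p)\<^sup>2 * indicator (lateral_layer B i (2 * layer_width n)) p)) \<longlonglongrightarrow> 0"
  shows "AE z in lborel. z \<in> {a..b} \<longrightarrow> coef B a b S k g z
     = - (if i \<in> S then freq B (k $ i) else - freq B (k $ i)) * coef B a b (if i \<in> S then S - {i} else insert i S) k f z"
proof -
  define \<omega> where "\<omega> = (if i \<in> S then freq B (k $ i) else - freq B (k $ i))"
  define S' where "S' = (if i \<in> S then S - {i} else insert i S)"
  note cf = coef_set_integrable(1)[OF B f, of S' k] and cg = coef_set_integrable(1)[OF B g, of S k]
  have "AE z in lborel. z \<in> {a..b} \<longrightarrow> coef B a b S k g z + \<omega> * coef B a b S' k f z = 0"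
  proof (rule fundamental_lemma_C1)
    show "set_integrable lborel {a..b} (\<lambda>z. coef B a b S k g z + \<omega> * coef B a b S' k f z)"
      by (intro set_integral_add(1) set_integrable_mult_right cf cg)
    fix \<psi> \<psi>' assume \<psi>: "C1_test a b \<psi> \<psi>'"
    obtain c where c: "\<And>x. \<bar>\<psi> x\<bar> \<le> c" using C1_test_bounded(3)[OF \<psi>] by blast
    have c0: "c \<ge> 0" using c[of 0] by linarith
    have [measurable]: "\<psi> \<in> borel_measurable borel" by (rule C1_test_bounded(1)[OF \<psi>])
    have c\<psi>: "continuous_on A \<psi>" for A
      using \<psi> unfolding C1_test_def by (meson DERIV_isCont continuous_at_imp_continuous_on)
    have bd: "\<bar>trig_prod B T k x * u\<bar> \<le> d" if "\<bar>u\<bar> \<le> d" for x u d T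
      unfolding abs_mult using mult_mono[OF trig_prod_bound[of B T k x] that] by simp
    \<comment> \<open>The factors in the other coordinates and in \<open>z\<close>, bounded
      uniformly in \<open>n\<close>; only the factor in coordinate \<open>i\<close> carries the
      singular derivative.\<close>
    define R where "R n p = (\<Prod>l\<in>UNIV-{i}. cutoff (-B) B (layer_width n) (fst p $ l) * trig B (l \<in> S) (k $ l) (fst p $ l)) * \<psi> (snd p)"
      for n and p :: "(real^'m) \<times> real"
    have Rm: "R n \<in> borel_measurable borel" for n unfolding R_def[abs_def] by measurable
    have Rb: "\<bar>R n p\<bar> \<le> c" for n p
    proof -
      have "\<bar>\<Prod>l\<in>UNIV-{i}. cutoff (-B) B (layer_width n) (fst p $ l) * trig B (l \<in> S) (k $ l) (fst p $ l)\<bar> \<le> 1"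
        unfolding abs_prod by (intro prod_le_1) (auto simp: abs_mult intro!: mult_le_one cutoff_bound trig_bound)
      then have "\<bar>\<Prod>l\<in>UNIV-{i}. cutoff (-B) B (layer_width n) (fst p $ l) * trig B (l \<in> S) (k $ l) (fst p $ l)\<bar> * \<bar>\<psi> (snd p)\<bar> \<le> 1 * c"
        using c by (intro mult_mono) auto
      then show ?thesis unfolding R_def abs_mult by simp
    qed
    let ?Q = "\<lambda>n p. cutoff' (-B) B (layer_width n) (fst p $ i) * trig B (i \<in> S) (k $ i) (fst p $ i) * R n p"
    let ?T = "\<lambda>n. LINT p|lborel. zero_ext B a b f p * ?Q n p"
    have T0: "?T \<longlonglongrightarrow> 0"
    proof (cases "i \<in> S")
      case True
      then show ?thesis using lateral_remainder_sin[OF B f Rm Rb, of i "k $ i"] by simp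
    next
      case False
      then show ?thesis using layer by (intro lateral_remainder_layer[OF B ab f Rm Rb]) auto
    qed
    have iQ: "integrable lborel (\<lambda>p. zero_ext B a b f p * ?Q n p)" for n
    proof (rule zero_ext_mult_bounded[OF f])
      show "?Q n \<in> borel_measurable borel" using Rm by measurable
      show "\<bar>?Q n p\<bar> \<le> (4 / layer_width n) * 1 * c" for p
        unfolding abs_mult using cutoff'_bound[of "layer_width n" "-B" B "fst p $ i"] trig_bound Rb c0
        by (intro mult_mono) auto
    qed
    have iE: "integrable lborel (\<lambda>p. zero_ext B a b f p * (cutoff_prod B n (fst p) * (trig_prod B S' k (fst p) * \<psi> (snd p))))" for n
    proof (rule zero_ext_mult_bounded[OF f])
      show "(\<lambda>p. cutoff_prod B n (fst p) * (trig_prod B S' k (fst p) * \<psi> (snd p))) \<in> borel_measurable borel"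
        unfolding cutoff_prod_def by measurable
      show "\<bar>cutoff_prod B n (fst p) * (trig_prod B S' k (fst p) * \<psi> (snd p))\<bar> \<le> c" for p
        unfolding abs_mult[of "cutoff_prod B n (fst p)"]
        using mult_mono[OF cutoff_prod_bound[of B n "fst p"] bd[OF c, of S' "fst p" "snd p"]] by simp
    qed
    have "?T n + \<omega> * (LINT p|lborel. zero_ext B a b f p * (cutoff_prod B n (fst p) * (trig_prod B S' k (fst p) * \<psi> (snd p))))
        = - (LINT p|lborel. zero_ext B a b g p * (cutoff_prod B n (fst p) * (trig_prod B S k (fst p) * \<psi> (snd p))))" for n
    proof -
      let ?\<Phi> = "\<lambda>p. (\<Prod>j\<in>UNIV. cutoff (-B) B (layer_width n) (fst p $ j) * trig B (j \<in> S) (k $ j) (fst p $ j)) * \<psi> (snd p)"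
      have F: "frechet_derivative ?\<Phi> (at p) (axis i 1, 0)
          = ?Q n p + \<omega> * (cutoff_prod B n (fst p) * (trig_prod B S' k (fst p) * \<psi> (snd p)))" for p
        unfolding trig_test_function(4)[OF B \<psi>] by (simp add: R_def \<omega>_def S'_def mult.assoc)
      have "(LINT p|lborel. zero_ext B a b f p * frechet_derivative ?\<Phi> (at p) (axis i 1, 0)) = - (LINT p|lborel. zero_ext B a b g p * ?\<Phi> p)"
        using w trig_test_function(1)[OF B \<psi>, of n S k] unfolding weak_deriv_def LINT_prism_zero_ext by blast
      moreover have "(LINT p|lborel. zero_ext B a b g p * ?\<Phi> p)
          = (LINT p|lborel. zero_ext B a b g p * (cutoff_prod B n (fst p) * (trig_prod B S k (fst p) * \<psi> (snd p))))"
        unfolding trig_test_function(2)[OF B \<psi>] ..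
      moreover have "(LINT p|lborel. zero_ext B a b f p * frechet_derivative ?\<Phi> (at p) (axis i 1, 0))
         = (LINT p|lborel. zero_ext B a b f p * ?Q n p
            + \<omega> * (zero_ext B a b f p * (cutoff_prod B n (fst p) * (trig_prod B S' k (fst p) * \<psi> (snd p)))))"
        unfolding F by (intro Bochner_Integration.integral_cong refl) (simp only: ring_distribs mult.left_commute)
      ultimately show ?thesis
        using iQ[of n] iE[of n] by simp
    qed
    moreover have "(\<lambda>n. ?T n + \<omega> * (LINT p|lborel. zero_ext B a b f p * (cutoff_prod B n (fst p) * (trig_prod B S' k (fst p) * \<psi> (snd p)))))
        \<longlonglongrightarrow> 0 + \<omega> * (LINT p|lborel. zero_ext B a b f p * (trig_prod B S' k (fst p) * \<psi> (snd p)))"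
      by (intro tendsto_add T0 tendsto_mult tendsto_const cutoff_prod_limit[OF f _ bd[OF c]]) measurable
    moreover have "(\<lambda>n. - (LINT p|lborel. zero_ext B a b g p * (cutoff_prod B n (fst p) * (trig_prod B S k (fst p) * \<psi> (snd p)))))
        \<longlonglongrightarrow> - (LINT p|lborel. zero_ext B a b g p * (trig_prod B S k (fst p) * \<psi> (snd p)))"
      by (intro tendsto_minus cutoff_prod_limit[OF g _ bd[OF c]]) measurable
    ultimately have "\<omega> * (LINT p|lborel. zero_ext B a b f p * (trig_prod B S' k (fst p) * \<psi> (snd p)))
        = - (LINT p|lborel. zero_ext B a b g p * (trig_prod B S k (fst p) * \<psi> (snd p)))"
      by (simp add: LIMSEQ_unique)
    then have E: "\<omega> * (LINT z:{a..b}|lborel. coef B a b S' k f z * \<psi> z) = - (LINT z:{a..b}|lborel. coef B a b S k g z * \<psi> z)"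
      unfolding coef_fubini[where \<psi>=\<psi>, OF f C1_test_bounded(1)[OF \<psi>] c]
        coef_fubini[where \<psi>=\<psi>, OF g C1_test_bounded(1)[OF \<psi>] c] .
    have ig: "set_integrable lborel {a..b} (\<lambda>z. coef B a b S k g z * \<psi> z)"
      using set_integrable_continuous_mult[OF cg c\<psi>] by (simp add: mult.commute)
    have i_f: "set_integrable lborel {a..b} (\<lambda>z. \<omega> * (coef B a b S' k f z * \<psi> z))"
      using set_integrable_continuous_mult[OF cf c\<psi>] by (simp add: mult.commute)
    have "(LINT z:{a..b}|lborel. (coef B a b S k g z + \<omega> * coef B a b S' k f z) * \<psi> z)
       = (LINT z:{a..b}|lborel. coef B a b S k g z * \<psi> z + \<omega> * (coef B a b S' k f z * \<psi> z))"
      by (simp add: distrib_right mult.assoc)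
    then show "(LINT z:{a..b}|lborel. (coef B a b S k g z + \<omega> * coef B a b S' k f z) * \<psi> z) = 0"
      unfolding set_integral_add(2)[OF ig i_f] using E by simp
  qed
  then show ?thesis unfolding \<omega>_def[symmetric] S'_def[symmetric]
    by eventually_elim (auto simp: algebra_simps eq_neg_iff_add_eq_0)
qed

text \<open>A nonzero value of a continuous function keeps its mean squares near that point bounded
  below. The left ends \<open>l n\<close> are free so that the lemma serves both ends of
  \<open>[a, b]\<close>.\<close>

lemma zero_of_mean_squares:
  fixes c :: "real \<Rightarrow> real"
  assumes c: "continuous_on {a..b} c" and x0: "x0 \<in> {a..b}" and ab: "a < b"
    and I: "\<And>n z. layer_width n < b - a \<Longrightarrow> z \<in> {l n..l n + layer_width n} \<Longrightarrow> z \<in> {a..b} \<and> \<bar>z - x0\<bar> \<le> layer_width n"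
    and lim: "(\<lambda>n. (1 / layer_width n) * (LINT z:{l n..l n + layer_width n}|lborel. (c z)\<^sup>2)) \<longlonglongrightarrow> 0"
  shows "c x0 = 0"
proof (rule ccontr)
  assume "c x0 \<noteq> 0"
  define e where "e = (c x0)\<^sup>2 / 2"
  have e: "e > 0" using \<open>c x0 \<noteq> 0\<close> by (simp add: e_def)
  have c2: "continuous_on {a..b} (\<lambda>z. (c z)\<^sup>2)" by (intro continuous_intros c)
  obtain d where d: "d > 0" "\<And>z. z \<in> {a..b} \<Longrightarrow> dist z x0 < d \<Longrightarrow> dist ((c z)\<^sup>2) ((c x0)\<^sup>2) < e"
    using c2 x0 e unfolding continuous_on_iff by blast
  have "(\<lambda>n. layer_width n) \<longlonglongrightarrow> 0" by (rule LIMSEQ_Suc[OF lim_1_over_n])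
  then have "\<forall>\<^sub>F n in sequentially. layer_width n < min d (b - a)"
    by (rule order_tendstoD(2)) (use d ab in auto)
  then have "\<forall>\<^sub>F n in sequentially. e \<le> (1 / layer_width n) * (LINT z:{l n..l n + layer_width n}|lborel. (c z)\<^sup>2)"
  proof eventually_elim
    case (elim n)
    then have h: "layer_width n < d" "layer_width n < b - a" by auto
    have sub: "{l n..l n + layer_width n} \<subseteq> {a..b}" using I[OF h(2)] by blast
    have "e * layer_width n = (LINT z:{l n..l n + layer_width n}|lborel. e)"
      by (simp add: set_lebesgue_integral_def mult.commute)
    also have "\<dots> \<le> (LINT z:{l n..l n + layer_width n}|lborel. (c z)\<^sup>2)"
    proof (rule set_integral_mono)
      show "set_integrable lborel {l n..l n + layer_width n} (\<lambda>z. e)" by (intro set_integrable_continuous continuous_intros)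
      show "set_integrable lborel {l n..l n + layer_width n} (\<lambda>z. (c z)\<^sup>2)"
        by (intro set_integrable_continuous continuous_on_subset[OF c2 sub])
      fix z assume z: "z \<in> {l n..l n + layer_width n}"
      have "dist ((c z)\<^sup>2) ((c x0)\<^sup>2) < e"
        using I[OF h(2) z] h(1) by (intro d) (auto simp: dist_real_def)
      then show "e \<le> (c z)\<^sup>2" unfolding dist_real_def e_def by linarith
    qed
    finally have "e * layer_width n * (1 / layer_width n) \<le> (LINT z:{l n..l n + layer_width n}|lborel. (c z)\<^sup>2) * (1 / layer_width n)"
      by (rule mult_right_mono) simp
    then show ?case by (simp add: mult.commute)
  qed
  then have "e \<le> 0" by (rule tendsto_lowerbound[OF lim]) simp
  then show False using e by simp
qed

text \<open>On almost every slice the squared coefficient is at most the norm of the basis function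
  times the slice integral, so mean squares of a mode are dominated by mean squares over the slab.
  \<open>Z n\<close> is the half-line describing that slab; it has to contain only the open
  interval, the endpoints being null.\<close>

lemma coef_endpoint_zero:
  assumes B: "B > 0" and ab: "a < b" and f: "L2_on (prism B a b) f"
    and c: "continuous_on {a..b} c" and x0: "x0 \<in> {a..b}"
    and eq: "AE z in lborel. z \<in> {a..b} \<longrightarrow> coef B a b S k f z = c z"
    and I: "\<And>n z. layer_width n < b - a \<Longrightarrow> z \<in> {l n..l n + layer_width n} \<Longrightarrow> z \<in> {a..b} \<and> \<bar>z - x0\<bar> \<le> layer_width n"
    and Z: "\<And>n z. layer_width n < b - a \<Longrightarrow> z \<in> {l n<..<l n + layer_width n} \<Longrightarrow> z \<in> Z n"
    and Zm: "\<And>n. Z n \<in> sets borel"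
    and lim: "(\<lambda>n. (1 / layer_width n) * (LINT p:(prism B a b \<inter> {p. snd p \<in> Z n})|lborel. (f p)\<^sup>2)) \<longlonglongrightarrow> 0"
  shows "c x0 = 0"
proof (rule zero_of_mean_squares[OF c x0 ab I])
  define N where "N = trig_norm_sq B S k"
  have N: "N \<ge> 0" by (simp add: N_def trig_norm_sq_nonneg)
  have [measurable]: "zero_ext B a b f \<in> borel_measurable borel" by (rule zero_ext_measurable[OF f])
  note Zm[measurable]
  have le: "(1 / layer_width n) * (LINT z:{l n..l n + layer_width n}|lborel. (c z)\<^sup>2)
      \<le> N * ((1 / layer_width n) * (LINT p:(prism B a b \<inter> {p. snd p \<in> Z n})|lborel. (f p)\<^sup>2))" if h: "layer_width n < b - a" for n
  proof -
    have sub: "{l n..l n + layer_width n} \<subseteq> {a..b}" using I[OF h] by blast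
    have mZ: "{p :: (real^'a) \<times> real. snd p \<in> Z n} \<in> sets borel"
      using measurable_sets[OF measurable_fst_snd(2) Zm[of n]] by (simp add: vimage_def)
    have "integrable lborel (\<lambda>p. (zero_ext B a b f p)\<^sup>2 * indicator {p. snd p \<in> Z n} p)"
    proof (rule Bochner_Integration.integrable_bound[OF zero_ext_integrable[OF f]])
      show "(\<lambda>p. (zero_ext B a b f p)\<^sup>2 * indicator {p. snd p \<in> Z n} p) \<in> borel_measurable lborel"
        using mZ by measurable
    qed (auto simp: indicator_def)
    then have i: "integrable (lborel \<Otimes>\<^sub>M lborel) (\<lambda>(x, z). (zero_ext B a b f (x, z))\<^sup>2 * indicator (Z n) z)"
      by (simp add: lborel_prod case_prod_beta' indicator_def)
    have "(LINT z:{l n..l n + layer_width n}|lborel. (c z)\<^sup>2) \<le> (LINT z|lborel. N * (LINT x|lborel. (zero_ext B a b f (x, z))\<^sup>2 * indicator (Z n) z))"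
      unfolding set_lebesgue_integral_def
    proof (rule integral_mono_AE)
      show "integrable lborel (\<lambda>z. indicator {l n..l n + layer_width n} z *\<^sub>R (c z)\<^sup>2)"
        using set_integrable_continuous[OF continuous_on_subset[OF _ sub], of "\<lambda>z. (c z)\<^sup>2"] c
        by (auto simp: set_integrable_def intro!: continuous_intros)
      show "integrable lborel (\<lambda>z. N * (LINT x|lborel. (zero_ext B a b f (x, z))\<^sup>2 * indicator (Z n) z))"
        using lborel_pair.integrable_snd[OF i] by (rule integrable_mult_right)
      show "AE z in lborel. indicator {l n..l n + layer_width n} z *\<^sub>R (c z)\<^sup>2
          \<le> N * (LINT x|lborel. (zero_ext B a b f (x, z))\<^sup>2 * indicator (Z n) z)"
        using eq coef_sq_le[OF B f, of S k] AE_lborel_singleton[of "l n"] AE_lborel_singleton[of "l n + layer_width n"]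
      proof eventually_elim
        case (elim z)
        show ?case
        proof (cases "z \<in> {l n..l n + layer_width n}")
          case True
          then have "z \<in> Z n" using elim by (intro Z[OF h]) auto
          then show ?thesis using True elim sub by (auto simp: N_def)
        next
          case False
          then show ?thesis using N by simp
        qed
      qed
    qed
    also have "\<dots> = N * (LINT z|lborel. LINT x|lborel. (zero_ext B a b f (x, z))\<^sup>2 * indicator (Z n) z)"
      by (rule integral_mult_right_zero)
    also have "(LINT z|lborel. LINT x|lborel. (zero_ext B a b f (x, z))\<^sup>2 * indicator (Z n) z)
        = (LINT p|lborel. (zero_ext B a b f p)\<^sup>2 * indicator {p. snd p \<in> Z n} p)"
      using lborel_pair.integral_snd[OF i] by (simp add: lborel_prod case_prod_beta' indicator_def)
    also have "\<dots> = (LINT p:(prism B a b \<inter> {p. snd p \<in> Z n})|lborel. (f p)\<^sup>2)"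
      by (rule LINT_prism_layer[symmetric])
    finally have "(1 / layer_width n) * (LINT z:{l n..l n + layer_width n}|lborel. (c z)\<^sup>2)
      \<le> (1 / layer_width n) * (N * (LINT p:(prism B a b \<inter> {p. snd p \<in> Z n})|lborel. (f p)\<^sup>2))"
      by (rule mult_left_mono) simp
    then show ?thesis by (simp only: mult.left_commute)
  qed
  have "(\<lambda>n. layer_width n) \<longlonglongrightarrow> 0" by (rule LIMSEQ_Suc[OF lim_1_over_n])
  then have ev: "\<forall>\<^sub>F n in sequentially. layer_width n < b - a"
    by (rule order_tendstoD(2)) (use ab in auto)
  show "(\<lambda>n. (1 / layer_width n) * (LINT z:{l n..l n + layer_width n}|lborel. (c z)\<^sup>2)) \<longlonglongrightarrow> 0"
  proof (rule tendsto_sandwich[OF _ _ tendsto_const])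
    show "\<forall>\<^sub>F n in sequentially. 0 \<le> (1 / layer_width n) * (LINT z:{l n..l n + layer_width n}|lborel. (c z)\<^sup>2)"
      by (intro always_eventually allI mult_nonneg_nonneg) (auto simp: set_lebesgue_integral_def)
    show "\<forall>\<^sub>F n in sequentially. (1 / layer_width n) * (LINT z:{l n..l n + layer_width n}|lborel. (c z)\<^sup>2)
        \<le> N * ((1 / layer_width n) * (LINT p:(prism B a b \<inter> {p. snd p \<in> Z n})|lborel. (f p)\<^sup>2))"
      using ev by eventually_elim (rule le)
    show "(\<lambda>n. N * ((1 / layer_width n) * (LINT p:(prism B a b \<inter> {p. snd p \<in> Z n})|lborel. (f p)\<^sup>2))) \<longlonglongrightarrow> 0"
      using tendsto_mult[OF tendsto_const lim, of N] by simp
  qed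
qed

subsection \<open>Boundary values and equations of the modes\<close>

lemma AC_density_cong_AE:
  assumes F: "AC_density a b F f" and g: "set_integrable lborel {a..b} g"
    and eq: "AE x in lborel. x \<in> {a..b} \<longrightarrow> f x = g x"
  shows "AC_density a b F g"
  unfolding AC_density_def
proof (intro conjI g ballI)
  fix z assume z: "z \<in> {a..b}"
  have "set_integrable lborel {a..z} f" "set_integrable lborel {a..z} g"
    using z AC_density_integrable[OF F] g by (auto intro: set_integrable_subset)
  then have "(LINT t:{a..z}|lborel. f t) = (LINT t:{a..z}|lborel. g t)"
    unfolding set_lebesgue_integral_def set_integrable_def
    by (intro integral_cong_AE) (use eq z in \<open>auto elim!: eventually_mono simp: indicator_def\<close>)
  then show "(LINT t:{a..z}|lborel. g t) = F z - F a" using AC_density_eq[OF F, of z] z by simp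
qed

text \<open>Passes from the one-sided limits of the trace conditions to sequences; the doubled width
  is that of the layer carrying the cutoff derivative.\<close>

lemma layer_width_at_right: "filterlim (\<lambda>n. layer_width n) (at_right 0) sequentially" "filterlim (\<lambda>n. 2 * layer_width n) (at_right 0) sequentially"
proof -
  have h: "(\<lambda>n. layer_width n) \<longlonglongrightarrow> 0" by (rule LIMSEQ_Suc[OF lim_1_over_n])
  then show "filterlim (\<lambda>n. layer_width n) (at_right 0) sequentially"
    by (rule tendsto_imp_filterlim_at_right) auto
  have "(\<lambda>n. 2 * layer_width n) \<longlonglongrightarrow> 2 * 0" by (intro tendsto_intros h)
  then have "(\<lambda>n. 2 * layer_width n) \<longlonglongrightarrow> 0" by simp
  then show "filterlim (\<lambda>n. 2 * layer_width n) (at_right 0) sequentially"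
    by (rule tendsto_imp_filterlim_at_right) auto
qed

lemma sum_Basis_vec_real:
  "(\<Sum>i\<in>(Basis :: ((real^'m) \<times> real) set). f i) = (\<Sum>j\<in>UNIV. f (axis j 1, 0)) + f (0, 1)"
proof -
  define ax where "ax j = (axis j 1 :: real^'m, 0 :: real)" for j :: 'm
  have inj: "inj ax" by (auto simp: inj_on_def ax_def axis_eq_axis)
  have "(Basis :: ((real^'m) \<times> real) set) = insert (0, 1) (range ax)"
    by (auto simp: Basis_prod_def Basis_vec_def ax_def)
  moreover have "(0, 1) \<notin> range ax" by (auto simp: ax_def)
  moreover have "finite (range ax)" by simp
  ultimately have "(\<Sum>i\<in>(Basis :: ((real^'m) \<times> real) set). f i) = f (0, 1) + (\<Sum>i\<in>range ax. f i)"
    by (metis sum.insert)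
  then show ?thesis using sum.reindex[OF inj, of f] by (simp add: o_def ax_def add.commute)
qed

lemma Basis_vec_real_mem: "(axis j 1, 0) \<in> (Basis :: ((real^'m) \<times> real) set)" "(0, 1) \<in> (Basis :: ((real^'m) \<times> real) set)"
  by (auto simp: Basis_prod_def Basis_vec_def)

lemma L2_on_prismI:
  assumes "zero_ext B a b f \<in> borel_measurable borel" "integrable lborel (\<lambda>p. (zero_ext B a b f p)\<^sup>2)"
  shows "L2_on (prism B a b) f"
proof -
  have "zero_ext B a b f = (\<lambda>p. indicator (prism B a b) p *\<^sub>R f p)"
    "(\<lambda>p. (zero_ext B a b f p)\<^sup>2) = (\<lambda>p. indicator (prism B a b) p *\<^sub>R (f p)\<^sup>2)"
    by (auto simp: zero_ext_def indicator_def)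
  then show ?thesis using assms unfolding L2_on_def set_borel_measurable_def set_integrable_def by simp
qed

lemma L2_on_prism_lincomb:
  assumes f: "L2_on (prism B a b) f" and g: "L2_on (prism B a b) g"
  shows "L2_on (prism B a b) (\<lambda>p. f p + c * g p)"
proof (rule L2_on_prismI)
  have e: "zero_ext B a b (\<lambda>p. f p + c * g p) = (\<lambda>p. zero_ext B a b f p + c * zero_ext B a b g p)"
    by (auto simp: zero_ext_def algebra_simps)
  note m[measurable] = zero_ext_measurable[OF f] zero_ext_measurable[OF g]
  show "zero_ext B a b (\<lambda>p. f p + c * g p) \<in> borel_measurable borel" unfolding e by measurable
  have "integrable lborel (\<lambda>p. (zero_ext B a b f p)\<^sup>2 + 2 * c * (zero_ext B a b f p * zero_ext B a b g p) + c\<^sup>2 * (zero_ext B a b g p)\<^sup>2)"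
    by (intro Bochner_Integration.integrable_add integrable_mult_right integrable_mult_of_squares
        zero_ext_integrable f g) measurable
  then show "integrable lborel (\<lambda>p. (zero_ext B a b (\<lambda>p. f p + c * g p) p)\<^sup>2)"
    unfolding e by (simp add: power2_sum power_mult_distrib algebra_simps)
qed

lemma coef_lincomb:
  assumes f: "L2_on (prism B a b) f" and g: "L2_on (prism B a b) g"
  shows "AE z in lborel. coef B a b S k (\<lambda>p. f p + c * g p) z = coef B a b S k f z + c * coef B a b S k g z"
  using AE_slice_L2[OF f] AE_slice_L2[OF g]
proof eventually_elim
  case (elim z)
  have i: "integrable lborel (\<lambda>x. zero_ext B a b h (x, z) * trig_prod B S k x)"
    if "face_L2 B (\<lambda>x. zero_ext B a b h (x, z))" for h
    by (rule face_L2_mult_bounded[OF that _ trig_prod_bound]) simp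
  have "zero_ext B a b (\<lambda>p. f p + c * g p) (x, z) * trig_prod B S k x
      = zero_ext B a b f (x, z) * trig_prod B S k x + c * (zero_ext B a b g (x, z) * trig_prod B S k x)" for x
    by (simp add: zero_ext_def algebra_simps)
  then show ?case using i[OF elim(1)] i[OF elim(2)] by (simp add: coef_def fcoef_def)
qed

lemma L2_on_prism_sum:
  assumes "finite I" "\<And>i. i \<in> I \<Longrightarrow> L2_on (prism B a b) (f i)"
  shows "L2_on (prism B a b) (\<lambda>p. \<Sum>i\<in>I. f i p)"
    and "AE z in lborel. coef B a b S k (\<lambda>p. \<Sum>i\<in>I. f i p) z = (\<Sum>i\<in>I. coef B a b S k (f i) z)"
  using assms
proof (induction I rule: finite_induct)
  case empty
  {
    case 1
    then show ?case by (intro L2_on_prismI) (simp_all add: zero_ext_def[abs_def])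
  next
    case 2
    then show ?case by (simp add: coef_def fcoef_def zero_ext_def)
  }
next
  case (insert i I)
  {
    case 1
    then show ?case using L2_on_prism_lincomb[of B a b "f i" "\<lambda>p. \<Sum>i\<in>I. f i p" 1] insert by simp
  next
    case 2
    have L: "L2_on (prism B a b) (f i)" "L2_on (prism B a b) (\<lambda>p. \<Sum>i\<in>I. f i p)" using 2 insert by auto
    have "AE z in lborel. coef B a b S k (\<lambda>p. \<Sum>i\<in>I. f i p) z = (\<Sum>i\<in>I. coef B a b S k (f i) z)"
      using 2 insert by simp
    then show ?case
      using coef_lincomb[OF L, of S k 1] by eventually_elim (use insert in simp)
  }
qed

text \<open>A trace is viewed as a function on the prism that is constant in \<open>z\<close>. It
  can then be subtracted from \<open>u\<close>, and its modes are constants.\<close>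

lemma L2_on_lift:
  assumes g: "L2_on (face B) g"
  shows "face_L2 B (\<lambda>x. indicator (face B) x * g x)"
    and "(LINT x|lborel. (indicator (face B) x * g x)\<^sup>2) = (LINT x:face B|lborel. (g x)\<^sup>2)"
    and "L2_on (prism B a b) (\<lambda>p. g (fst p))"
    and "z \<in> {a<..<b} \<Longrightarrow> coef B a b S k (\<lambda>p. g (fst p)) z = fcoef B S k (\<lambda>x. indicator (face B) x * g x)"
proof -
  define G where "G x = indicator (face B) x * g x" for x
  have G2: "(\<lambda>x. (G x)\<^sup>2) = (\<lambda>x. indicator (face B) x *\<^sub>R (g x)\<^sup>2)" by (auto simp: G_def indicator_def)
  have m[measurable]: "G \<in> borel_measurable borel"
    using g by (simp add: L2_on_def set_borel_measurable_def G_def[abs_def])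
  have i: "integrable lborel (\<lambda>x. (G x)\<^sup>2)"
    using g unfolding G2 by (simp add: L2_on_def set_integrable_def)
  then show "face_L2 B (\<lambda>x. indicator (face B) x * g x)"
    unfolding G_def[symmetric] face_L2_def by (simp add: G_def[abs_def] m[unfolded G_def[abs_def]])
  show "(LINT x|lborel. (indicator (face B) x * g x)\<^sup>2) = (LINT x:face B|lborel. (g x)\<^sup>2)"
    unfolding G_def[symmetric] G2 set_lebesgue_integral_def ..
  have e: "zero_ext B a b (\<lambda>p. g (fst p)) p = G (fst p) * indicator {a<..<b} (snd p)" for p
    by (auto simp: zero_ext_def G_def prism_Times indicator_def mem_Times_iff)
  show "L2_on (prism B a b) (\<lambda>p. g (fst p))"
  proof (rule L2_on_prismI)
    show "zero_ext B a b (\<lambda>p. g (fst p)) \<in> borel_measurable borel"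
      unfolding e[abs_def] by measurable
    have "integrable lborel (indicator {a<..<b} :: real \<Rightarrow> real)"
      by (cases "a \<le> b") (auto intro!: integrable_real_indicator)
    then have "integrable (lborel \<Otimes>\<^sub>M lborel) (\<lambda>(x, z). (G x)\<^sup>2 * indicator {a<..<b} z)"
      using i by (intro lborel_pair.Fubini_integrable) (auto simp: abs_mult)
    moreover have "(\<lambda>p. (zero_ext B a b (\<lambda>p. g (fst p)) p)\<^sup>2) = (\<lambda>(x, z). (G x)\<^sup>2 * indicator {a<..<b} z)"
      by (auto simp: e indicator_def)
    ultimately show "integrable lborel (\<lambda>p. (zero_ext B a b (\<lambda>p. g (fst p)) p)\<^sup>2)" by (simp add: lborel_prod)
  qed
  show "coef B a b S k (\<lambda>p. g (fst p)) z = fcoef B S k (\<lambda>x. indicator (face B) x * g x)" if "z \<in> {a<..<b}"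
    using that unfolding coef_def e G_def by simp
qed

lemma coef_bottom:
  assumes B: "B > 0" and ab: "a < b" and f: "L2_on (prism B a b) f"
    and c: "continuous_on {a..b} c" and eq: "AE z in lborel. z \<in> {a..b} \<longrightarrow> coef B a b S k f z = c z"
    and lim: "((\<lambda>h. (1/h) * (LINT p:(prism B a b \<inter> {p. snd p < a + h})|lborel. (f p)^2)) \<longlongrightarrow> 0) (at_right 0)"
  shows "c a = 0"
proof (rule coef_endpoint_zero[where l="\<lambda>_. a" and Z="\<lambda>n. {..<a + layer_width n}", OF B ab f c _ eq])
  show "(\<lambda>n. (1 / layer_width n) * (LINT p:(prism B a b \<inter> {p. snd p \<in> {..<a + layer_width n}})|lborel. (f p)\<^sup>2)) \<longlonglongrightarrow> 0"
    using filterlim_compose[OF lim layer_width_at_right(1)] by simp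
qed (use ab in auto)

text \<open>The endpoint lemma is applied to \<open>f\<close> minus the lifted trace, whose mode is
  \<open>c\<close> minus a constant; the definition of \<open>trace_top\<close> says precisely that
  its mean squares vanish at the top.\<close>

lemma coef_top:
  assumes B: "B > 0" and ab: "a < b" and f: "L2_on (prism B a b) f"
    and c: "continuous_on {a..b} c" and eq: "AE z in lborel. z \<in> {a..b} \<longrightarrow> coef B a b S k f z = c z"
    and g: "trace_top B a b f g"
  shows "c b = fcoef B S k (\<lambda>x. indicator (face B) x * g x)"
proof -
  define \<gamma> where "\<gamma> = fcoef B S k (\<lambda>x. indicator (face B) x * g x)"
  have gL: "L2_on (face B) g"
    and lim: "((\<lambda>h. (1/h) * (LINT p:(prism B a b \<inter> {p. b - h < snd p})|lborel. (f p + (-1) * g (fst p))^2)) \<longlongrightarrow> 0) (at_right 0)"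
    using g by (auto simp: trace_top_def)
  note lift = L2_on_lift[OF gL]
  have "(\<lambda>z. c z - \<gamma>) b = 0"
  proof (rule coef_endpoint_zero[where c="\<lambda>z. c z - \<gamma>" and l="\<lambda>n. b - layer_width n" and Z="\<lambda>n. {b - layer_width n<..}", OF B ab L2_on_prism_lincomb[OF f lift(3)]])
    show "continuous_on {a..b} (\<lambda>z. c z - \<gamma>)" by (intro continuous_intros c)
    show "AE z in lborel. z \<in> {a..b} \<longrightarrow> coef B a b S k (\<lambda>p. f p + (-1) * g (fst p)) z = c z - \<gamma>"
      using eq coef_lincomb[OF f lift(3), of S k "-1"] AE_lborel_singleton[of a] AE_lborel_singleton[of b]
    proof eventually_elim
      case (elim z)
      then show ?case using lift(4)[of z a b S k] by (auto simp: \<gamma>_def)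
    qed
    show "(\<lambda>n. (1 / layer_width n) * (LINT p:(prism B a b \<inter> {p. snd p \<in> {b - layer_width n<..}})|lborel. (f p + (-1) * g (fst p))\<^sup>2)) \<longlonglongrightarrow> 0"
      using filterlim_compose[OF lim layer_width_at_right(1)] by simp
  qed (use ab in auto)
  then show ?thesis by (simp add: \<gamma>_def)
qed

text \<open>Du Bois-Reymond is applied to the modes of \<open>u\<close> and of
  \<open>du (0, 1)\<close>. The modes are determined only almost everywhere, while boundary values
  need the continuous representatives \<open>v\<close> and \<open>p\<close>.\<close>

lemma mode_profile:
  fixes u :: "(real^'m) \<times> real \<Rightarrow> real"
  assumes B: "B > 0" and ab: "a < b" and u: "H2_0 B a b u du d2u"
    and g: "trace_top B a b u g" and w: "trace_top B a b (du (0, 1)) w"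
  obtains v p where "AC_density a b v p" "AC_density a b p (coef B a b S k (d2u (0, 1) (0, 1)))"
    "v a = 0" "v b = fcoef B S k (\<lambda>x. indicator (face B) x * g x)"
    "p b = fcoef B S k (\<lambda>x. indicator (face B) x * w x)"
    "AE z in lborel. z \<in> {a..b} \<longrightarrow> coef B a b S k u z = v z"
    "AE z in lborel. z \<in> {a..b} \<longrightarrow> coef B a b S k (du (0, 1)) z = p z"
proof -
  let ?e = "(0, 1) :: (real^'m) \<times> real"
  note e = Basis_vec_real_mem(2)[where 'm='m]
  have L: "L2_on (prism B a b) u" "L2_on (prism B a b) (du ?e)" "L2_on (prism B a b) (d2u ?e ?e)"
    and W: "weak_deriv (prism B a b) u ?e (du ?e)" "weak_deriv (prism B a b) (du ?e) ?e (d2u ?e ?e)"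
    using u e unfolding H2_0_def H2_on_def H1_on_def by auto
  note c = coef_set_integrable(1)[OF B]
  obtain v where v: "AC_density a b v (coef B a b S k (du ?e))" "AE z in lborel. z \<in> {a..b} \<longrightarrow> coef B a b S k u z = v z"
    by (rule du_Bois_Reymond[OF ab c[OF L(1)] c[OF L(2)] coef_weak_z[OF B L(1,2) W(1)]])
  obtain p where p: "AC_density a b p (coef B a b S k (d2u ?e ?e))" "AE z in lborel. z \<in> {a..b} \<longrightarrow> coef B a b S k (du ?e) z = p z"
    by (rule du_Bois_Reymond[OF ab c[OF L(2)] c[OF L(3)] coef_weak_z[OF B L(2,3) W(2)]])
  note cv = AC_density_continuous[OF v(1)] and cp = AC_density_continuous[OF p(1)]
  \<comment> \<open>The density of \<open>v\<close>, known only as a mode of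
    \<open>du (0, 1)\<close>, is replaced by its continuous representative \<open>p\<close>, so the
    two profiles form a chain \<open>v' = p\<close>.\<close>
  have vp: "AC_density a b v p"
    by (rule AC_density_cong_AE[OF v(1) set_integrable_continuous[OF cp] p(2)])
  have "v a = 0"
    using u by (intro coef_bottom[OF B ab L(1) cv v(2)]) (simp add: H2_0_def vanishes_bottom_lateral_def)
  then show ?thesis
    using that[OF vp p(1) _ coef_top[OF B ab L(1) cv v(2) g] coef_top[OF B ab L(2) cp p(2) w] v(2) p(2)] by blast
qed

lemma lateral_layer_limit:
  fixes u :: "(real^'m) \<times> real \<Rightarrow> real"
  assumes f: "L2_on (prism B a b) u" and u: "vanishes_bottom_lateral B a b u"
  shows "(\<lambda>n. (1 / (2 * layer_width n)) * (LINT p|lborel. (zero_ext B a b u p)\<^sup>2 * indicator (lateral_layer B i (2 * layer_width n)) p)) \<longlonglongrightarrow> 0"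
proof -
  have [measurable]: "zero_ext B a b u \<in> borel_measurable borel" by (rule zero_ext_measurable[OF f])
  let ?R = "\<lambda>h. {p :: (real^'m) \<times> real. B - h < fst p $ i}" and ?L = "\<lambda>h. {p :: (real^'m) \<times> real. fst p $ i < -B + h}"
  let ?X = "\<lambda>h. (1/h) * (LINT p:(prism B a b \<inter> ?R h)|lborel. (u p)^2)"
  let ?Y = "\<lambda>h. (1/h) * (LINT p:(prism B a b \<inter> ?L h)|lborel. (u p)^2)"
  have "(?X \<longlongrightarrow> 0) (at_right 0)" "(?Y \<longlongrightarrow> 0) (at_right 0)"
    using u unfolding vanishes_bottom_lateral_def by blast+
  then have XY: "(\<lambda>n. ?X (2 * layer_width n)) \<longlonglongrightarrow> 0" "(\<lambda>n. ?Y (2 * layer_width n)) \<longlonglongrightarrow> 0"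
    using filterlim_compose[OF _ layer_width_at_right(2)] by blast+
  have [measurable]: "?R h \<in> sets borel" "?L h \<in> sets borel" for h
    by (intro borel_open open_Collect_less continuous_intros)+
  have le: "(1/h) * (LINT p|lborel. (zero_ext B a b u p)\<^sup>2 * indicator (lateral_layer B i h) p) \<le> ?X h + ?Y h" if h: "h > 0" for h
  proof -
    have i: "integrable lborel (\<lambda>p. (zero_ext B a b u p)\<^sup>2 * indicator A p)" if [measurable]: "A \<in> sets borel" for A
      by (rule Bochner_Integration.integrable_bound[OF zero_ext_integrable[OF f]]) (auto simp: indicator_def)
    have "(LINT p|lborel. (zero_ext B a b u p)\<^sup>2 * indicator (lateral_layer B i h) p)
        \<le> (LINT p|lborel. (zero_ext B a b u p)\<^sup>2 * indicator (?R h) p + (zero_ext B a b u p)\<^sup>2 * indicator (?L h) p)"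
    proof (rule integral_mono)
      show "integrable lborel (\<lambda>p. (zero_ext B a b u p)\<^sup>2 * indicator (lateral_layer B i h) p)" by (rule i) measurable
      show "integrable lborel (\<lambda>p. (zero_ext B a b u p)\<^sup>2 * indicator (?R h) p + (zero_ext B a b u p)\<^sup>2 * indicator (?L h) p)"
        by (intro Bochner_Integration.integrable_add i) measurable
      show "(zero_ext B a b u p)\<^sup>2 * indicator (lateral_layer B i h) p
          \<le> (zero_ext B a b u p)\<^sup>2 * indicator (?R h) p + (zero_ext B a b u p)\<^sup>2 * indicator (?L h) p" for p
        by (auto simp: lateral_layer_def indicator_def)
    qed
    also have "\<dots> = (LINT p:(prism B a b \<inter> ?R h)|lborel. (u p)^2) + (LINT p:(prism B a b \<inter> ?L h)|lborel. (u p)^2)"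
      unfolding LINT_prism_layer by (rule Bochner_Integration.integral_add) (rule i; measurable)+
    finally show ?thesis using h by (simp add: divide_right_mono flip: distrib_left add_divide_distrib)
  qed
  show ?thesis
  proof (rule tendsto_sandwich[OF _ _ tendsto_const])
    show "\<forall>\<^sub>F n in sequentially. 0 \<le> (1 / (2 * layer_width n)) * (LINT p|lborel. (zero_ext B a b u p)\<^sup>2 * indicator (lateral_layer B i (2 * layer_width n)) p)"
      by (intro always_eventually allI mult_nonneg_nonneg integral_nonneg_AE) auto
    show "\<forall>\<^sub>F n in sequentially. (1 / (2 * layer_width n)) * (LINT p|lborel. (zero_ext B a b u p)\<^sup>2 * indicator (lateral_layer B i (2 * layer_width n)) p)
        \<le> ?X (2 * layer_width n) + ?Y (2 * layer_width n)"
      by (intro always_eventually allI le) simp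
    show "(\<lambda>n. ?X (2 * layer_width n) + ?Y (2 * layer_width n)) \<longlonglongrightarrow> 0" using tendsto_add[OF XY] by simp
  qed
qed

text \<open>The first derivative is tested with a cosine in \<open>x_i\<close>, where the boundary
  condition on \<open>u\<close> removes the remainder; the second is tested with a sine, which
  vanishes at the faces by itself. Together they give the eigenvalue factor.\<close>

lemma mode_lateral:
  fixes u :: "(real^'m) \<times> real \<Rightarrow> real"
  assumes B: "B > 0" and ab: "a < b" and u: "H2_0 B a b u du d2u"
  defines "e i \<equiv> (axis i 1, 0) :: (real^'m) \<times> real"
  shows "AE z in lborel. z \<in> {a..b} \<longrightarrow> coef B a b (UNIV - {i}) k (du (e i)) z = freq B (k $ i) * coef B a b UNIV k u z"
    and "AE z in lborel. z \<in> {a..b} \<longrightarrow> coef B a b UNIV k (d2u (e i) (e i)) z = - (freq B (k $ i))\<^sup>2 * coef B a b UNIV k u z"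
proof -
  have eB: "e i \<in> Basis" unfolding e_def by (rule Basis_vec_real_mem)
  have L: "L2_on (prism B a b) u" "L2_on (prism B a b) (du (e i))" "L2_on (prism B a b) (d2u (e i) (e i))"
    and W: "weak_deriv (prism B a b) u (e i) (du (e i))" "weak_deriv (prism B a b) (du (e i)) (e i) (d2u (e i) (e i))"
    and V: "vanishes_bottom_lateral B a b u"
    using u eB unfolding H2_0_def H2_on_def H1_on_def by auto
  have 1: "AE z in lborel. z \<in> {a..b} \<longrightarrow> coef B a b (UNIV - {i}) k (du (e i)) z = freq B (k $ i) * coef B a b UNIV k u z"
    using coef_weak_lateral[OF B ab L(1) L(2)[unfolded e_def] W(1)[unfolded e_def] disjI2[OF lateral_layer_limit[OF L(1) V]], of "UNIV - {i}" k]
    by (simp add: insert_absorb e_def)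
  then show "AE z in lborel. z \<in> {a..b} \<longrightarrow> coef B a b (UNIV - {i}) k (du (e i)) z = freq B (k $ i) * coef B a b UNIV k u z" .
  have "AE z in lborel. z \<in> {a..b} \<longrightarrow> coef B a b UNIV k (d2u (e i) (e i)) z = - freq B (k $ i) * coef B a b (UNIV - {i}) k (du (e i)) z"
    using coef_weak_lateral[OF B ab L(2,3)[unfolded e_def] W(2)[unfolded e_def], of UNIV k] by (simp add: e_def)
  with 1 show "AE z in lborel. z \<in> {a..b} \<longrightarrow> coef B a b UNIV k (d2u (e i) (e i)) z = - (freq B (k $ i))\<^sup>2 * coef B a b UNIV k u z"
    by eventually_elim (simp add: power2_eq_square)
qed

subsection \<open>Summation over the modes\<close>

text \<open>One term of Parseval's sum for the weighted square integral; the division accounts for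
  the basis functions not being normalised.\<close>

definition mode_energy :: "real \<Rightarrow> real \<Rightarrow> real \<Rightarrow> real \<Rightarrow> 'm::finite set \<Rightarrow> nat^'m \<Rightarrow> ((real^'m) \<times> real \<Rightarrow> real) \<Rightarrow> real" where
  "mode_energy lam B a b S k f
     = (LINT z:{a..b}|lborel. (coef B a b S k f z)\<^sup>2 * exp (2 * lam * z^2)) / trig_norm_sq B S k"

definition energy :: "real \<Rightarrow> real \<Rightarrow> real \<Rightarrow> real \<Rightarrow> ((real^'m) \<times> real \<Rightarrow> real) \<Rightarrow> real" where
  "energy lam B a b f = (LINT p:prism B a b|lborel. (f p)\<^sup>2 * exp (2 * lam * (snd p)^2))"

lemma mode_energy_nonneg: "mode_energy lam B a b S k f \<ge> 0"
  unfolding mode_energy_def by (intro divide_nonneg_nonneg trig_norm_sq_nonneg) (simp add: set_lebesgue_integral_def)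

lemma energy_nonneg: "energy lam B a b f \<ge> 0"
  unfolding energy_def by (simp add: set_lebesgue_integral_def)

lemma weight_bound:
  fixes a b lam z :: real
  assumes "0 < a" "lam \<ge> 0"
  shows "indicator {a..b} z * exp (2 * lam * z^2) \<le> exp (2 * lam * b^2)"
proof (cases "z \<in> {a..b}")
  case True
  then have "z^2 \<le> b^2" using assms by (intro power_mono) auto
  then show ?thesis using True assms by (simp add: mult_left_mono)
qed simp

lemma energy_set_integrable:
  assumes a: "0 < a" "lam \<ge> 0" and f: "L2_on (prism B a b) f"
  shows "set_integrable lborel (prism B a b) (\<lambda>p. (f p)\<^sup>2 * exp (2 * lam * (snd p)^2))"
proof -
  have [measurable]: "zero_ext B a b f \<in> borel_measurable borel" by (rule zero_ext_measurable[OF f])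
  have e: "indicator (prism B a b) p *\<^sub>R ((f p)\<^sup>2 * exp (2 * lam * (snd p)^2))
      = (zero_ext B a b f p)\<^sup>2 * (indicator {a..b} (snd p) * exp (2 * lam * (snd p)^2))" for p
    by (auto simp: zero_ext_def indicator_def prism_def)
  show ?thesis unfolding set_integrable_def e
  proof (rule Bochner_Integration.integrable_bound)
    show "integrable lborel (\<lambda>p. exp (2 * lam * b^2) * (zero_ext B a b f p)\<^sup>2)"
      by (intro integrable_mult_right zero_ext_integrable f)
    show "AE p in lborel. norm ((zero_ext B a b f p)\<^sup>2 * (indicator {a..b} (snd p) * exp (2 * lam * (snd p)^2)))
        \<le> norm (exp (2 * lam * b^2) * (zero_ext B a b f p)\<^sup>2)"
    proof (rule AE_I2)
      fix p :: "(real^'a) \<times> real"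
      have "(zero_ext B a b f p)\<^sup>2 * (indicator {a..b} (snd p) * exp (2 * lam * (snd p)^2)) \<le> (zero_ext B a b f p)\<^sup>2 * exp (2 * lam * b^2)"
        by (intro mult_left_mono weight_bound[OF a]) simp
      then show "norm ((zero_ext B a b f p)\<^sup>2 * (indicator {a..b} (snd p) * exp (2 * lam * (snd p)^2)))
        \<le> norm (exp (2 * lam * b^2) * (zero_ext B a b f p)\<^sup>2)"
        by (simp add: abs_mult mult.commute)
    qed
  qed measurable
qed

text \<open>The weight depends on \<open>z\<close> only, so Parseval applies on almost every slice,
  and Tonelli exchanges the sum over the modes with the integral over \<open>z\<close>.\<close>

lemma energy_parseval:
  fixes f :: "(real^'m) \<times> real \<Rightarrow> real"
  assumes B: "B > 0" and a: "0 < a" "lam \<ge> 0" and f: "L2_on (prism B a b) f"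
  shows "(\<integral>\<^sup>+k. ennreal (mode_energy lam B a b S k f) \<partial>count_space UNIV) = ennreal (energy lam B a b f)"
proof -
  \<comment> \<open>The indicator makes the weight bounded on the whole line by its value at
    \<open>b\<close>.\<close>
  define w where "w z = indicator {a..b} z * exp (2 * lam * z^2)" for z
  have w0: "w z \<ge> 0" for z by (simp add: w_def)
  have wm[measurable]: "w \<in> borel_measurable borel" unfolding w_def[abs_def] by measurable
  have wW: "w z \<le> exp (2 * lam * b^2)" for z unfolding w_def by (rule weight_bound[OF a])
  define s where "s z = (LINT x|lborel. (zero_ext B a b f (x, z))\<^sup>2)" for z
  have s0: "s z \<ge> 0" for z by (simp add: s_def)
  have e: "indicator (prism B a b) p *\<^sub>R ((f p)\<^sup>2 * exp (2 * lam * (snd p)^2)) = (zero_ext B a b f p)\<^sup>2 * w (snd p)" for p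
    by (auto simp: zero_ext_def indicator_def prism_def w_def)
  have "integrable lborel (\<lambda>p. (zero_ext B a b f p)\<^sup>2 * w (snd p))"
    using energy_set_integrable[OF a f] unfolding set_integrable_def e .
  then have i: "integrable (lborel \<Otimes>\<^sub>M lborel) (\<lambda>(x, z). (zero_ext B a b f (x, z))\<^sup>2 * w z)"
    by (simp add: lborel_prod case_prod_beta')
  have "energy lam B a b f = (LINT p|lborel. (zero_ext B a b f p)\<^sup>2 * w (snd p))"
    unfolding energy_def set_lebesgue_integral_def e ..
  also have "\<dots> = (LINT z|lborel. LINT x|lborel. (zero_ext B a b f (x, z))\<^sup>2 * w z)"
    using lborel_pair.integral_snd[OF i] by (simp add: lborel_prod case_prod_beta')
  also have "\<dots> = (LINT z|lborel. s z * w z)" by (simp add: s_def)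
  finally have E: "energy lam B a b f = (LINT z|lborel. s z * w z)" .
  have isw: "integrable lborel (\<lambda>z. s z * w z)"
    using lborel_pair.integrable_snd[OF i] by (simp add: s_def)
  let ?t = "\<lambda>k z. (coef B a b S k f z)\<^sup>2 / trig_norm_sq B S k"
  have cm[measurable]: "coef B a b S k f \<in> borel_measurable borel" for k by (rule coef_measurable[OF f])
  have "ennreal (energy lam B a b f) = (\<integral>\<^sup>+z. ennreal (s z * w z) \<partial>lborel)"
    unfolding E using isw s0 w0 by (intro nn_integral_eq_integral[symmetric]) auto
  also have "\<dots> = (\<integral>\<^sup>+z. (\<integral>\<^sup>+k. ennreal (?t k z * w z) \<partial>count_space UNIV) \<partial>lborel)"
  proof (rule nn_integral_cong_AE)
    show "AE z in lborel. ennreal (s z * w z) = (\<integral>\<^sup>+k. ennreal (?t k z * w z) \<partial>count_space UNIV)"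
      using AE_slice_L2[OF f]
    proof eventually_elim
      case (elim z)
      have "ennreal (s z * w z) = ennreal (s z) * ennreal (w z)" using s0 w0 by (intro ennreal_mult) auto
      also have "ennreal (s z) = (\<integral>\<^sup>+k. ennreal (?t k z) \<partial>count_space UNIV)"
        using parseval[OF B elim, of S] by (simp add: s_def coef_def)
      also have "\<dots> * ennreal (w z) = (\<integral>\<^sup>+k. ennreal (?t k z) * ennreal (w z) \<partial>count_space UNIV)"
        by (rule nn_integral_multc[symmetric]) simp
      also have "\<dots> = (\<integral>\<^sup>+k. ennreal (?t k z * w z) \<partial>count_space UNIV)"
        using w0 by (intro nn_integral_cong ennreal_mult[symmetric] divide_nonneg_nonneg) (auto simp: trig_norm_sq_nonneg)
      finally show ?case .
    qed
  qed
  also have "\<dots> = (\<integral>\<^sup>+k. (\<integral>\<^sup>+z. ennreal (?t k z * w z) \<partial>lborel) \<partial>count_space UNIV)"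
    by (rule nn_integral_count_space_nn_integral) auto
  also have "\<dots> = (\<integral>\<^sup>+k. ennreal (mode_energy lam B a b S k f) \<partial>count_space UNIV)"
  proof (rule nn_integral_cong)
    fix k
    have ic: "integrable lborel (\<lambda>z. (coef B a b S k f z)\<^sup>2 * w z)"
    proof (rule Bochner_Integration.integrable_bound)
      show "integrable lborel (\<lambda>z. exp (2 * lam * b^2) * (coef B a b S k f z)\<^sup>2)"
        by (intro integrable_mult_right coef_sq_integrable[OF B f])
      show "AE z in lborel. norm ((coef B a b S k f z)\<^sup>2 * w z) \<le> norm (exp (2 * lam * b^2) * (coef B a b S k f z)\<^sup>2)"
        using mult_left_mono[OF wW, of "(coef B a b S k f z)\<^sup>2" z for z] w0
        by (auto simp: abs_mult mult.commute)
    qed measurable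
    have "(\<integral>\<^sup>+z. ennreal (?t k z * w z) \<partial>lborel) = ennreal (LINT z|lborel. (coef B a b S k f z)\<^sup>2 * w z / trig_norm_sq B S k)"
      unfolding times_divide_eq_left using ic w0 trig_norm_sq_nonneg[of B S k]
      by (intro nn_integral_eq_integral) auto
    also have "(LINT z|lborel. (coef B a b S k f z)\<^sup>2 * w z / trig_norm_sq B S k) = mode_energy lam B a b S k f"
      unfolding mode_energy_def set_lebesgue_integral_def w_def by (simp add: ac_simps)
    finally show "(\<integral>\<^sup>+z. ennreal (?t k z * w z) \<partial>lborel) = ennreal (mode_energy lam B a b S k f)" .
  qed
  finally show ?thesis ..
qed

text \<open>Sine and cosine of equal nonzero frequency have the same norm, because
  \<open>cos^2 - sin^2\<close> is the cosine of the double angle and orthogonal to constants. At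
  frequency zero the norms differ, but the factor \<open>freq\<close> vanishes.\<close>

lemma freq_trig_norm_sq:
  assumes B: "B > 0"
  shows "(freq B (k $ i))\<^sup>2 / trig_norm_sq B (UNIV - {i}) k = (freq B (k $ i))\<^sup>2 / trig_norm_sq B UNIV k"
proof (cases "k $ i = 0")
  case True
  then show ?thesis by (simp add: freq_def)
next
  case False
  have sc: "(LINT t:{-B<..<B}|lborel. (trig B False n t)\<^sup>2) = (LINT t:{-B<..<B}|lborel. (trig B True n t)\<^sup>2)" if n: "n \<noteq> 0" for n
  proof -
    have "set_integrable lborel {-B..B} (\<lambda>t. (trig B s n t)\<^sup>2)" for s
      by (intro set_integrable_continuous continuous_intros)
    then have i: "set_integrable lborel {-B<..<B} (\<lambda>t. (trig B s n t)\<^sup>2)" for s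
      by (rule set_integrable_subset) auto
    have "(trig B False n t)\<^sup>2 - (trig B True n t)\<^sup>2 = trig B False (2*n) t * trig B False 0 t" for t
      by (simp add: trig_def cos_double[symmetric] mult.assoc)
    then have "(LINT t:{-B<..<B}|lborel. (trig B False n t)\<^sup>2 - (trig B True n t)\<^sup>2) = 0"
      using trig_orthogonal[OF B, of "2*n" 0 False] n by simp
    then show ?thesis unfolding set_integral_diff(2)[OF i i] by simp
  qed
  have "trig_norm_sq B (UNIV - {i}) k = trig_norm_sq B UNIV k"
    unfolding trig_norm_sq_def
  proof (rule prod.cong[OF refl])
    fix j
    show "(LINT t:{-B<..<B}|lborel. (trig B (j \<in> UNIV - {i}) (k $ j) t)\<^sup>2)
        = (LINT t:{-B<..<B}|lborel. (trig B (j \<in> UNIV) (k $ j) t)\<^sup>2)"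
      using sc[OF False] by (cases "j = i") auto
  qed
  then show ?thesis by simp
qed

lemma mode_energy_cong:
  assumes B: "B > 0" and f: "L2_on (prism B a b) f" and c: "set_integrable lborel {a..b} c"
    and eq: "AE z in lborel. z \<in> {a..b} \<longrightarrow> coef B a b S k f z = c z"
  shows "(LINT z:{a..b}|lborel. (coef B a b S k f z)\<^sup>2 * exp (2 * lam * z^2))
     = (LINT z:{a..b}|lborel. (c z)\<^sup>2 * exp (2 * lam * z^2))"
  unfolding set_lebesgue_integral_def
proof (rule integral_cong_AE)
  have [measurable]: "coef B a b S k f \<in> borel_measurable borel" by (rule coef_measurable[OF f])
  show "(\<lambda>z. indicator {a..b} z *\<^sub>R ((coef B a b S k f z)\<^sup>2 * exp (2 * lam * z^2))) \<in> borel_measurable lborel" by measurable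
  have m[measurable]: "(\<lambda>z. indicator {a..b} z *\<^sub>R c z) \<in> borel_measurable borel" using c unfolding set_integrable_def by auto
  have "(\<lambda>z. indicator {a..b} z *\<^sub>R ((c z)\<^sup>2 * exp (2 * lam * z^2)))
      = (\<lambda>z. (indicator {a..b} z *\<^sub>R c z)\<^sup>2 * exp (2 * lam * z^2))" by (auto simp: indicator_def)
  moreover have "(\<lambda>z. (indicator {a..b} z *\<^sub>R c z)\<^sup>2 * exp (2 * lam * z^2)) \<in> borel_measurable lborel" using m by measurable
  ultimately show "(\<lambda>z. indicator {a..b} z *\<^sub>R ((c z)\<^sup>2 * exp (2 * lam * z^2))) \<in> borel_measurable lborel" by simp
  show "AE z in lborel. indicator {a..b} z *\<^sub>R ((coef B a b S k f z)\<^sup>2 * exp (2 * lam * z^2))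
      = indicator {a..b} z *\<^sub>R ((c z)\<^sup>2 * exp (2 * lam * z^2))"
    using eq by eventually_elim (auto simp: indicator_def)
qed

text \<open>For one index \<open>k\<close> every energy becomes a weighted integral of
  \<open>v\<close>, \<open>p\<close> or \<open>q - mu*v\<close> over the same norm. The lateral
  derivatives together contribute \<open>mu\<close> times the energy of \<open>v\<close>, which is
  exactly the extra term of the one-dimensional estimate.\<close>

lemma mode_carleman:
  fixes u :: "(real^'m) \<times> real \<Rightarrow> real"
  assumes B: "B > 0" and ab: "0 < a" "a < b" and u: "H2_0 B a b u du d2u"
    and g: "trace_top B a b u g" and w: "trace_top B a b (du (0, 1)) w"
    and carleman: "\<And>mu v p q. mu \<ge> 0 \<Longrightarrow> AC_density a b v p \<Longrightarrow> AC_density a b p q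
       \<Longrightarrow> set_integrable lborel {a..b} (\<lambda>t. (q t)\<^sup>2) \<Longrightarrow> v a = 0 \<Longrightarrow>
     C * (LINT t:{a..b}|lborel. (lam * ((p t)\<^sup>2 + mu * (v t)\<^sup>2) + lam^3 * (v t)\<^sup>2) * exp (2*lam*t^2))
     \<le> (LINT t:{a..b}|lborel. (q t - mu * v t)\<^sup>2 * exp (2*lam*t^2))
       + C * lam^3 * ((v b)\<^sup>2 + (p b)\<^sup>2) * exp (2*lam*b^2)"
  shows "C * (lam * (mode_energy lam B a b UNIV k (du (0, 1))
        + (\<Sum>j\<in>UNIV. mode_energy lam B a b (UNIV - {j}) k (du (axis j 1, 0)))) + lam^3 * mode_energy lam B a b UNIV k u)
     \<le> mode_energy lam B a b UNIV k (\<lambda>p. \<Sum>i\<in>Basis. d2u i i p)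
       + C * lam^3 * exp (2*lam*b^2) *
         ((fcoef B UNIV k (\<lambda>x. indicator (face B) x * g x))\<^sup>2 / trig_norm_sq B UNIV k
          + (fcoef B UNIV k (\<lambda>x. indicator (face B) x * w x))\<^sup>2 / trig_norm_sq B UNIV k)"
proof -
  let ?N = "trig_norm_sq B UNIV k"
  let ?\<rho> = "\<lambda>z. exp (2 * lam * z^2)"
  define \<gamma> where "\<gamma> = fcoef B UNIV k (\<lambda>x. indicator (face B) x * g x)"
  define \<eta> where "\<eta> = fcoef B UNIV k (\<lambda>x. indicator (face B) x * w x)"
  define q where "q = coef B a b UNIV k (d2u (0, 1) (0, 1))"
  \<comment> \<open>The eigenvalue of the lateral Dirichlet Laplacian belonging to
    \<open>k\<close>.\<close>
  define mu where "mu = (\<Sum>j\<in>UNIV. (freq B (k $ j))\<^sup>2)"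
  have mu: "mu \<ge> 0" unfolding mu_def by (intro sum_nonneg) simp
  have L: "L2_on (prism B a b) u" "\<And>i. i \<in> Basis \<Longrightarrow> L2_on (prism B a b) (du i)"
      "\<And>i j. i \<in> Basis \<Longrightarrow> j \<in> Basis \<Longrightarrow> L2_on (prism B a b) (d2u i j)"
    using u unfolding H2_0_def H2_on_def H1_on_def by auto
  note e = Basis_vec_real_mem[where 'm='m]
  obtain v p where vp: "AC_density a b v p" and pq: "AC_density a b p q"
    and va: "v a = 0" and vb: "v b = \<gamma>" and pb: "p b = \<eta>"
    and v: "AE z in lborel. z \<in> {a..b} \<longrightarrow> coef B a b UNIV k u z = v z"
    and p: "AE z in lborel. z \<in> {a..b} \<longrightarrow> coef B a b UNIV k (du (0, 1)) z = p z"
    by (rule mode_profile[OF B ab(2) u g w, of UNIV k, folded \<gamma>_def \<eta>_def q_def])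
  note cv = AC_density_continuous[OF vp] and cp = AC_density_continuous[OF pq]
  have iq: "set_integrable lborel {a..b} q" by (rule AC_density_integrable[OF pq])
  let ?V = "LINT z:{a..b}|lborel. (v z)\<^sup>2 * ?\<rho> z" and ?P = "LINT z:{a..b}|lborel. (p z)\<^sup>2 * ?\<rho> z"
  let ?I = "LINT z:{a..b}|lborel. (q z - mu * v z)\<^sup>2 * ?\<rho> z"
  have Eu: "mode_energy lam B a b UNIV k u = ?V / ?N"
    unfolding mode_energy_def mode_energy_cong[OF B L(1) set_integrable_continuous[OF cv] v] ..
  have Ez: "mode_energy lam B a b UNIV k (du (0, 1)) = ?P / ?N"
    unfolding mode_energy_def mode_energy_cong[OF B L(2)[OF e(2)] set_integrable_continuous[OF cp] p] ..
  have Ej: "mode_energy lam B a b (UNIV - {j}) k (du (axis j 1, 0)) = (freq B (k $ j))\<^sup>2 * ?V / ?N" for j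
  proof -
    have eq: "AE z in lborel. z \<in> {a..b} \<longrightarrow> coef B a b (UNIV - {j}) k (du (axis j 1, 0)) z = freq B (k $ j) * v z"
      using mode_lateral(1)[OF B ab(2) u, of j k] v by eventually_elim auto
    have "(LINT z:{a..b}|lborel. (coef B a b (UNIV - {j}) k (du (axis j 1, 0)) z)\<^sup>2 * ?\<rho> z)
        = (LINT z:{a..b}|lborel. (freq B (k $ j) * v z)\<^sup>2 * ?\<rho> z)"
      by (rule mode_energy_cong[OF B L(2)[OF e(1)] _ eq]) (intro set_integrable_continuous continuous_intros cv)
    also have "\<dots> = (freq B (k $ j))\<^sup>2 * ?V"
      by (simp add: power_mult_distrib mult.assoc)
    finally have "mode_energy lam B a b (UNIV - {j}) k (du (axis j 1, 0)) = (freq B (k $ j))\<^sup>2 / trig_norm_sq B (UNIV - {j}) k * ?V"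
      by (simp add: mode_energy_def)
    then show ?thesis unfolding freq_trig_norm_sq[OF B] by simp
  qed
  have El: "mode_energy lam B a b UNIV k (\<lambda>p. \<Sum>i\<in>Basis. d2u i i p) = ?I / ?N"
  proof -
    have LB: "L2_on (prism B a b) (\<lambda>p. \<Sum>i\<in>Basis. d2u i i p)"
      and cB: "AE z in lborel. coef B a b UNIV k (\<lambda>p. \<Sum>i\<in>Basis. d2u i i p) z = (\<Sum>i\<in>Basis. coef B a b UNIV k (d2u i i) z)"
      by (rule L2_on_prism_sum[OF finite_Basis L(3)]; assumption)+
    have lat: "AE z in lborel. \<forall>j\<in>UNIV. z \<in> {a..b} \<longrightarrow> coef B a b UNIV k (d2u (axis j 1, 0) (axis j 1, 0)) z
        = - (freq B (k $ j))\<^sup>2 * coef B a b UNIV k u z"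
      by (rule AE_finite_allI[OF finite]) (rule mode_lateral(2)[OF B ab(2) u])
    have eq: "AE z in lborel. z \<in> {a..b} \<longrightarrow> coef B a b UNIV k (\<lambda>p. \<Sum>i\<in>Basis. d2u i i p) z = q z - mu * v z"
      using cB lat v
    proof eventually_elim
      case (elim z)
      show ?case
      proof
        assume z: "z \<in> {a..b}"
        have "(\<Sum>i\<in>Basis. coef B a b UNIV k (d2u i i) z) = (\<Sum>j\<in>UNIV. - (freq B (k $ j))\<^sup>2 * v z) + q z"
          unfolding sum_Basis_vec_real q_def using elim z by simp
        also have "(\<Sum>j\<in>UNIV. - (freq B (k $ j))\<^sup>2 * v z) = - mu * v z"
          by (simp add: mu_def sum_negf sum_distrib_right)
        finally show "coef B a b UNIV k (\<lambda>p. \<Sum>i\<in>Basis. d2u i i p) z = q z - mu * v z"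
          using elim(1) by simp
      qed
    qed
    show ?thesis
      unfolding mode_energy_def
      by (subst mode_energy_cong[OF B LB _ eq])
        (intro set_integral_diff iq set_integrable_continuous continuous_intros cv, rule refl)
  qed
  have q2: "set_integrable lborel {a..b} (\<lambda>t. (q t)\<^sup>2)"
    unfolding q_def by (rule coef_set_integrable(2)[OF B L(3)[OF e(2) e(2)]])
  have "(LINT t:{a..b}|lborel. (lam * ((p t)\<^sup>2 + mu * (v t)\<^sup>2) + lam^3 * (v t)\<^sup>2) * ?\<rho> t)
      = (LINT t:{a..b}|lborel. lam * ((p t)\<^sup>2 * ?\<rho> t) + (lam * mu + lam^3) * ((v t)\<^sup>2 * ?\<rho> t))"
    by (simp add: algebra_simps)
  also have "\<dots> = lam * ?P + (lam * mu + lam^3) * ?V"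
  proof -
    have "set_integrable lborel {a..b} (\<lambda>t. lam * ((p t)\<^sup>2 * ?\<rho> t))" "set_integrable lborel {a..b} (\<lambda>t. (lam * mu + lam^3) * ((v t)\<^sup>2 * ?\<rho> t))"
      by (intro set_integrable_continuous continuous_intros cv cp)+
    then show ?thesis by (simp only: set_integral_add(2) set_integral_mult_right)
  qed
  finally have "C * (lam * ?P + (lam * mu + lam^3) * ?V) \<le> ?I + C * lam^3 * (\<gamma>\<^sup>2 + \<eta>\<^sup>2) * exp (2*lam*b^2)"
    using carleman[OF mu vp pq q2 va] by (simp add: vb pb)
  \<comment> \<open>Nonnegativity of the norm suffices: for a degenerate index both sides become
    zero.\<close>
  then have "C * (lam * ?P + (lam * mu + lam^3) * ?V) / ?N \<le> (?I + C * lam^3 * (\<gamma>\<^sup>2 + \<eta>\<^sup>2) * exp (2*lam*b^2)) / ?N"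
    by (rule divide_right_mono) (rule trig_norm_sq_nonneg)
  moreover have "(\<Sum>j\<in>UNIV. (freq B (k $ j))\<^sup>2 * ?V / ?N) = mu * ?V / ?N"
    by (simp add: mu_def sum_distrib_right sum_divide_distrib)
  ultimately show ?thesis
    unfolding Eu Ez Ej El \<gamma>_def[symmetric] \<eta>_def[symmetric]
    by (simp add: algebra_simps add_divide_distrib)
qed


theorem theorem4p2:
  fixes B a b :: real
  assumes "B > 0" and "0 < a" and "a < b"
  shows "\<exists>C>0. \<exists>lam0>1. \<forall>lam\<ge>lam0.
    \<forall>(u :: (real^'m) \<times> real \<Rightarrow> real) du d2u g dg w.
      H2_0 B a b u du d2u \<and> trace_top B a b u g \<and> H1_on (face B) g dg
      \<and> trace_top B a b (du (0, 1)) w \<longrightarrow>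
      (LINT p:prism B a b|lborel. (\<Sum>i\<in>Basis. d2u i i p)^2 * exp (2 * lam * (snd p)^2))
      \<ge> C * (LINT p:prism B a b|lborel.
               (lam * (\<Sum>i\<in>Basis. (du i p)^2) + lam^3 * (u p)^2) * exp (2 * lam * (snd p)^2))
        - C * lam^3 * (H1_norm_sq (face B) g dg + (LINT x:face B|lborel. (w x)^2)) * exp (2 * lam * b^2)"
proof -
  \<comment> \<open>The one-dimensional constants are uniform in \<open>mu\<close> and thus serve
    every mode; they depend only on \<open>a\<close> and \<open>b\<close>.\<close>
  obtain C lam0 where C: "C > 0" and lam0: "lam0 > 1"
    and carleman: "\<And>lam mu v p q. lam \<ge> lam0 \<Longrightarrow> mu \<ge> 0 \<Longrightarrow> AC_density a b v p \<Longrightarrow> AC_density a b p q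
       \<Longrightarrow> set_integrable lborel {a..b} (\<lambda>t. (q t)\<^sup>2) \<Longrightarrow> v a = 0 \<Longrightarrow>
     C * (LINT t:{a..b}|lborel. (lam * ((p t)\<^sup>2 + mu * (v t)\<^sup>2) + lam^3 * (v t)\<^sup>2) * exp (2*lam*t^2))
     \<le> (LINT t:{a..b}|lborel. (q t - mu * v t)\<^sup>2 * exp (2*lam*t^2))
       + C * lam^3 * ((v b)\<^sup>2 + (p b)\<^sup>2) * exp (2*lam*b^2)"
    using carleman_1d[OF assms(2,3)] by blast
  show ?thesis
  proof (intro exI[of _ C] conjI exI[of _ lam0] C lam0 allI impI; elim conjE)
    fix lam and u :: "(real^'m) \<times> real \<Rightarrow> real" and du d2u g dg w
    assume lam: "lam \<ge> lam0" and u: "H2_0 B a b u du d2u" and g: "trace_top B a b u g"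
      and dg: "H1_on (face B) g dg" and w: "trace_top B a b (du (0, 1)) w"
    have lam1: "lam \<ge> 1" "lam \<ge> 0" using lam lam0 by auto
    have L: "L2_on (prism B a b) u" "\<And>i. i \<in> Basis \<Longrightarrow> L2_on (prism B a b) (du i)"
      "\<And>i j. i \<in> Basis \<Longrightarrow> j \<in> Basis \<Longrightarrow> L2_on (prism B a b) (d2u i j)"
      using u unfolding H2_0_def H2_on_def H1_on_def by auto
    have gw: "L2_on (face B) g" "L2_on (face B) w" using g w by (auto simp: trace_top_def)
    note e = Basis_vec_real_mem[where 'm='m]
    note par = energy_parseval[OF assms(1,2) lam1(2)]
    have LB: "L2_on (prism B a b) (\<lambda>p. \<Sum>i\<in>Basis. d2u i i p)"
      by (rule L2_on_prism_sum(1)[OF finite_Basis L(3)])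
    define D where "D = C * lam^3 * exp (2*lam*b^2)"
    have D: "D \<ge> 0" using C lam1 by (simp add: D_def)
    define tk where "tk f k = (fcoef B UNIV k (\<lambda>x. indicator (face B) x * f x))\<^sup>2 / trig_norm_sq B UNIV k"
      for f :: "real^'m \<Rightarrow> real" and k :: "nat^'m"
    have tk0: "tk f k \<ge> 0" for f k unfolding tk_def by (intro divide_nonneg_nonneg trig_norm_sq_nonneg) simp
    have tk: "(\<integral>\<^sup>+k. ennreal (tk f k) \<partial>count_space UNIV) = ennreal (LINT x:face B|lborel. (f x)\<^sup>2)" if "L2_on (face B) f" for f
      unfolding tk_def using parseval[OF assms(1) L2_on_lift(1)[OF that], of UNIV] L2_on_lift(2)[OF that] by simp
    define Tg where "Tg = (LINT x:face B|lborel. (g x)\<^sup>2)"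
    define Tw where "Tw = (LINT x:face B|lborel. (w x)\<^sup>2)"
    have T0: "Tg \<ge> 0" "Tw \<ge> 0" by (auto simp: Tg_def Tw_def set_lebesgue_integral_def)
    define Eu where "Eu = energy lam B a b u"
    define Ez where "Ez = energy lam B a b (du (0, 1))"
    define Ej where "Ej j = energy lam B a b (du (axis j 1, 0))" for j
    define El where "El = energy lam B a b (\<lambda>p. \<Sum>i\<in>Basis. d2u i i p)"
    have E0: "Eu \<ge> 0" "Ez \<ge> 0" "Ej j \<ge> 0" "El \<ge> 0" for j by (simp_all add: Eu_def Ez_def Ej_def El_def energy_nonneg)
    define mu where "mu k = mode_energy lam B a b UNIV k u" for k
    define mz where "mz k = mode_energy lam B a b UNIV k (du (0, 1))" for k
    define mj where "mj j k = mode_energy lam B a b (UNIV - {j}) k (du (axis j 1, 0))" for j k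
    define ml where "ml k = mode_energy lam B a b UNIV k (\<lambda>p. \<Sum>i\<in>Basis. d2u i i p)" for k
    have m0: "mu k \<ge> 0" "mz k \<ge> 0" "mj j k \<ge> 0" "ml k \<ge> 0" for j k
      by (simp_all add: mu_def mz_def mj_def ml_def mode_energy_nonneg)
    \<comment> \<open>The sum over the modes is carried out in \<open>ennreal\<close>, where
      linearity holds without convergence questions. All total energies are finite reals, so the
      inequality can be brought back afterwards.\<close>
    have toenn: "ennreal (C * (lam * (z + (\<Sum>j\<in>UNIV. y j)) + lam^3 * x))
        = ennreal C * (ennreal lam * (ennreal z + (\<Sum>j\<in>UNIV. ennreal (y j))) + ennreal (lam^3) * ennreal x)"
      if "z \<ge> 0" "\<And>j. y j \<ge> 0" "x \<ge> 0" for x z and y :: "'m \<Rightarrow> real"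
      using that C lam1 by (simp add: ennreal_mult ennreal_plus sum_nonneg sum_ennreal)
    have toenn2: "ennreal (l + D * (s + t)) = ennreal l + ennreal D * (ennreal s + ennreal t)"
      if "l \<ge> 0" "s \<ge> 0" "t \<ge> 0" for l s t
      using that D by (simp add: ennreal_mult ennreal_plus)
    have mode: "ennreal C * (ennreal lam * (ennreal (mz k) + (\<Sum>j\<in>UNIV. ennreal (mj j k))) + ennreal (lam^3) * ennreal (mu k))
       \<le> ennreal (ml k) + ennreal D * (ennreal (tk g k) + ennreal (tk w k))" for k
      unfolding toenn[OF m0(2,3,1), symmetric] toenn2[OF m0(4) tk0 tk0, symmetric]
      unfolding mu_def mz_def mj_def ml_def tk_def D_def
      by (intro ennreal_leI mode_carleman[OF assms u g w] carleman[OF lam])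
    have "(\<integral>\<^sup>+k. ennreal C * (ennreal lam * (ennreal (mz k) + (\<Sum>j\<in>UNIV. ennreal (mj j k))) + ennreal (lam^3) * ennreal (mu k)) \<partial>count_space UNIV)
        \<le> (\<integral>\<^sup>+k. ennreal (ml k) + ennreal D * (ennreal (tk g k) + ennreal (tk w k)) \<partial>count_space UNIV)"
      by (intro nn_integral_mono mode)
    then have "ennreal C * (ennreal lam * (ennreal Ez + (\<Sum>j\<in>UNIV. ennreal (Ej j))) + ennreal (lam^3) * ennreal Eu)
        \<le> ennreal El + ennreal D * (ennreal Tg + ennreal Tw)"
      using par[OF L(1), of UNIV] par[OF L(2)[OF e(2)], of UNIV] par[OF L(2)[OF e(1)], of "UNIV - {j}" j for j]
        par[OF LB, of UNIV] tk[OF gw(1)] tk[OF gw(2)]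
      unfolding mu_def[symmetric] mz_def[symmetric] mj_def[symmetric] ml_def[symmetric]
        Eu_def[symmetric] Ez_def[symmetric] Ej_def[symmetric] El_def[symmetric] Tg_def[symmetric] Tw_def[symmetric]
      by (simp add: nn_integral_add nn_integral_cmult nn_integral_sum)
    then have "ennreal (C * (lam * (Ez + (\<Sum>j\<in>UNIV. Ej j)) + lam^3 * Eu)) \<le> ennreal (El + D * (Tg + Tw))"
      unfolding toenn[OF E0(2,3,1)] toenn2[OF E0(4) T0] .
    then have main: "C * (lam * (Ez + (\<Sum>j\<in>UNIV. Ej j)) + lam^3 * Eu) \<le> El + D * (Tg + Tw)"
      using E0(4) D T0 by (subst (asm) ennreal_le_iff) auto
    have "(LINT p:prism B a b|lborel. (lam * (\<Sum>i\<in>Basis. (du i p)^2) + lam^3 * (u p)^2) * exp (2 * lam * (snd p)^2))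
        = (LINT p:prism B a b|lborel. lam * (\<Sum>i\<in>Basis. (du i p)^2 * exp (2 * lam * (snd p)^2)) + lam^3 * ((u p)^2 * exp (2 * lam * (snd p)^2)))"
      by (simp add: distrib_right sum_distrib_right mult.assoc)
    also have "\<dots> = lam * (\<Sum>i\<in>Basis. energy lam B a b (du i)) + lam^3 * Eu"
    proof -
      note i = energy_set_integrable[OF assms(2) lam1(2)]
      have isum: "integrable lborel (\<lambda>p. indicator (prism B a b) p *\<^sub>R ((du j p)^2 * exp (2 * lam * (snd p)^2)))"
        if "j \<in> Basis" for j
        using i[OF L(2)[OF that]] unfolding set_integrable_def .
      have sm: "indicator (prism B a b) p *\<^sub>R (\<Sum>j\<in>Basis. (du j p)^2 * exp (2 * lam * (snd p)^2))
          = (\<Sum>j\<in>Basis. indicator (prism B a b) p *\<^sub>R ((du j p)^2 * exp (2 * lam * (snd p)^2)))" for p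
        by (rule scaleR_sum_right)
      have "set_integrable lborel (prism B a b) (\<lambda>p. lam * (\<Sum>i\<in>Basis. (du i p)^2 * exp (2 * lam * (snd p)^2)))"
        by (intro set_integrable_mult_right) (simp only: set_integrable_def sm Bochner_Integration.integrable_sum isum)
      moreover have "set_integrable lborel (prism B a b) (\<lambda>p. lam^3 * ((u p)^2 * exp (2 * lam * (snd p)^2)))"
        by (intro set_integrable_mult_right i L(1))
      moreover have "(LINT p:prism B a b|lborel. (\<Sum>i\<in>Basis. (du i p)^2 * exp (2 * lam * (snd p)^2)))
          = (\<Sum>i\<in>Basis. energy lam B a b (du i))"
        unfolding energy_def set_lebesgue_integral_def sm by (rule Bochner_Integration.integral_sum) (rule isum)
      ultimately show ?thesis by (simp add: set_integral_add(2) Eu_def energy_def)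
    qed
    also have "(\<Sum>i\<in>Basis. energy lam B a b (du i)) = Ez + (\<Sum>j\<in>UNIV. Ej j)"
      unfolding sum_Basis_vec_real Ej_def Ez_def by simp
    finally have M: "(LINT p:prism B a b|lborel. (lam * (\<Sum>i\<in>Basis. (du i p)^2) + lam^3 * (u p)^2) * exp (2 * lam * (snd p)^2))
        = lam * (Ez + (\<Sum>j\<in>UNIV. Ej j)) + lam^3 * Eu" .
    have "Tg \<le> H1_norm_sq (face B) g dg"
      unfolding H1_norm_sq_def Tg_def by (auto intro!: sum_nonneg simp: set_lebesgue_integral_def)
    then have "D * (Tg + Tw) \<le> D * (H1_norm_sq (face B) g dg + Tw)" using D by (intro mult_left_mono) auto
    with main show "C * (LINT p:prism B a b|lborel.
               (lam * (\<Sum>i\<in>Basis. (du i p)^2) + lam^3 * (u p)^2) * exp (2 * lam * (snd p)^2))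
        - C * lam^3 * (H1_norm_sq (face B) g dg + (LINT x:face B|lborel. (w x)^2)) * exp (2 * lam * b^2)
       \<le> (LINT p:prism B a b|lborel. (\<Sum>i\<in>Basis. d2u i i p)^2 * exp (2 * lam * (snd p)^2))"
      unfolding M El_def energy_def D_def Tw_def by (simp add: algebra_simps)
  qed
qed

end
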